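(* Let $1\le p<\infty$ and let $(k_n)_{n\in\mathbb N}$ be a sequence of positive integers with $1\le k_n\le n$, $k_n=\omega(1)$ and $k_n=o(n)$. For each $n$ let $X_n$ be uniformly distributed in $\mathbb B_p^n$, let $E_n$ be a random $k_n$-dimensional linear subspace of $\mathbb R^n$ distributed according to the Haar probability measure on the Grassmannian of $k_n$-dimensional subspaces and independent of $X_n$, and put $\mathscr Z_{n,p}:=n^{1/p}\|P_{E_n}X_n\|_2$. Let $M_p(2)=\frac{p^{2/p}}{3}\frac{\Gamma(1+3/p)}{\Gamma(1+1/p)}$. Then the following hold: (a) If $p\ge2$, then $k_n^{-1/2}\mathscr Z_{n,p}$ satisfies an MDP on $\mathbb R$ with speed $k_n$ and rate function $$\mathbb I(x)=\begin{cases}\frac{x^2-M_p(2)}{2M_p(2)}-\log\frac{x}{\sqrt{M_p(2)}}&: x>0\\+\infty&:\text{otherwise.}\end{cases}$$ (b1) If $1\le p<2$ and $k_n=o(n^{p/2})$, then $k_n^{-1/2}\mathscr Z_{n,p}$ satisfies an MDP on $\mathbb R$ with speed $k_n$ and rate function $$\mathbb I(x)=\begin{cases}\frac{x^2-M_p(2)}{2M_p(2)}-\log\frac{x}{\sqrt{M_p(2)}}&: x>0\\+\infty&:\text{otherwise.}\end{cases}$$ (b2) If $1\le p<2$ and $k_n$ equals $n^{p/2}$ up to rounding to an integer (i.e. $|k_n-n^{p/2}|<1$ for all $n$), then $k_n^{-1/2}\mathscr Z_{n,p}$ satisfies an MDP on $\mathbb R$ with speed $n^{p/2}$ and rate function $$\mathbb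 I(x)=\begin{cases}\inf\limits_{y\ge\sqrt{M_p(2)}}\Big[\frac{(x/y)^2-1}{2}-\log\big(\frac xy\big)+\frac1p\big(y^2-M_p(2)\big)^{p/2}\Big]&: x>0\\+\infty&:\text{otherwise.}\end{cases}$$ (b3) If $1\le p<2$ and $k_n=\omega(n^{p/2})$, then $k_n^{-1/2}\mathscr Z_{n,p}$ satisfies an MDP on $\mathbb R$ with speed $n^{p/2}$ and rate function $$\mathbb I(x)=\begin{cases}\frac1p\big(x^2-M_p(2)\big)^{p/2}&: x\ge\sqrt{M_p(2)}\\+\infty&:\text{otherwise.}\end{cases}$$
   Context: $\mathbb B_p^n=\{x\in\mathbb R^n:\|x\|_p\le1\}$ with $\|x\|_p=(\sum_{i=1}^n|x_i|^p)^{1/p}$; $P_E$ denotes orthogonal projection onto the subspace $E$. Landau notation: $x_n=o(y_n)$ means $\lim x_n/y_n=0$; $x_n=\omega(y_n)$ means $\lim|x_n/y_n|=+\infty$. A moderate deviations principle (MDP) is formally the same as a large deviations principle: given positive reals $(s_n)$, a sequence $(X_n)$ of random vectors in $\mathbb R^d$ satisfies it with speed $s_n$ and rate function $\mathbb I:\mathbb R^d\to[0,\infty]$ if $\mathbb I$ is lower semi-continuous with compact level sets $\{\mathbb I\le\alpha\}$, $\alpha\in\mathbb R$, and for all Borel sets $A\subseteq\mathbb R^d$ $$-\inf_{x\in A^\circ}\mathbb I(x)\le\liminf_{n\to\infty}s_n^{-1}\log\mathbb P[X_n\in A]\le\limsup_{n\to\infty}s_n^{-1}\log\mathbb P[X_n\in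 A]\le-\inf_{x\in\overline A}\mathbb I(x)$$ ($\log0=-\infty$, $\inf\emptyset=+\infty$). *)

theory Defs
  imports "HOL-Probability.Probability" "HOL-Library.Function_Algebras"
    "HOL-Library.Landau_Symbols"
begin

text \<open>
  Since the dimension varies, $\mathbb{R}^n$ is the subspace \<open>Rn n\<close> of the sequences
  of reals that vanish from index \<open>n\<close> on. The pointwise vector space
  structure makes \<^const>\<open>subspace\<close>, \<^const>\<open>dim\<close> and \<^const>\<open>linear\<close> available.
\<close>

instantiation "fun" :: (type, real_vector) real_vector
begin

definition scaleR_fun :: "real \<Rightarrow> ('a \<Rightarrow> 'b) \<Rightarrow> 'a \<Rightarrow> 'b"
  where "scaleR_fun c f = (\<lambda>x. c *\<^sub>R f x)"

instance
  by standard (auto simp: scaleR_fun_def fun_eq_iff scaleR_add_right scaleR_add_left)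

end

definition Rn :: "nat \<Rightarrow> (nat \<Rightarrow> real) set"
  where "Rn n = {x. \<forall>i\<ge>n. x i = 0}"

definition dot :: "nat \<Rightarrow> (nat \<Rightarrow> real) \<Rightarrow> (nat \<Rightarrow> real) \<Rightarrow> real"
  where "dot n x y = (\<Sum>i<n. x i * y i)"

definition lp_norm :: "real \<Rightarrow> nat \<Rightarrow> (nat \<Rightarrow> real) \<Rightarrow> real"
  where "lp_norm p n x = (\<Sum>i<n. \<bar>x i\<bar> powr p) powr (1 / p)"

definition lp_ball :: "real \<Rightarrow> nat \<Rightarrow> (nat \<Rightarrow> real) set"
  where "lp_ball p n = {x \<in> Rn n. lp_norm p n x \<le> 1}"

text \<open>Lebesgue measure on \<open>Rn n\<close>, as a Borel measure on the space of all sequences.\<close>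

definition lebesgue_Rn :: "nat \<Rightarrow> (nat \<Rightarrow> real) measure"
  where "lebesgue_Rn n =
    distr (PiM {..<n} (\<lambda>_. lborel)) borel (\<lambda>x i. if i < n then x i else 0)"

definition uniform_on_lp_ball :: "real \<Rightarrow> nat \<Rightarrow> (nat \<Rightarrow> real) measure"
  where "uniform_on_lp_ball p n = uniform_measure (lebesgue_Rn n) (lp_ball p n)"

definition orth_proj :: "nat \<Rightarrow> (nat \<Rightarrow> real) set \<Rightarrow> (nat \<Rightarrow> real) \<Rightarrow> nat \<Rightarrow> real"
  where "orth_proj n E x = (THE y. y \<in> E \<and> (\<forall>z\<in>E. dot n (x - y) z = 0))"

definition grassmannian :: "nat \<Rightarrow> nat \<Rightarrow> (nat \<Rightarrow> real) set set"
  where "grassmannian n k = {E. subspace E \<and> E \<subseteq> Rn n \<and> dim E = k}"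

text \<open>
  The Grassmannian carries its usual topology, in which a subspace is identified with the matrix
  of its orthogonal projection.
\<close>

definition proj_matrix :: "nat \<Rightarrow> (nat \<Rightarrow> real) set \<Rightarrow> nat \<Rightarrow> nat \<Rightarrow> real"
  where "proj_matrix n E i j =
    (if i < n \<and> j < n then orth_proj n E (\<lambda>l. if l = j then 1 else 0) i else 0)"

definition grassmannian_topology :: "nat \<Rightarrow> nat \<Rightarrow> (nat \<Rightarrow> real) set topology"
  where "grassmannian_topology n k =
    pullback_topology (grassmannian n k) (proj_matrix n) euclidean"

definition grassmannian_borel :: "nat \<Rightarrow> nat \<Rightarrow> (nat \<Rightarrow> real) set measure"
  where "grassmannian_borel n k =
    sigma (grassmannian n k) {U. openin (grassmannian_topology n k) U}"

definition orth_group :: "nat \<Rightarrow> ((nat \<Rightarrow> real) \<Rightarrow> nat \<Rightarrow> real) set"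
  where "orth_group n = {T. linear T \<and> T ` Rn n \<subseteq> Rn n \<and>
    (\<forall>x\<in>Rn n. \<forall>y\<in>Rn n. dot n (T x) (T y) = dot n x y)}"

text \<open>The Haar probability measure is the rotation invariant Borel probability measure.\<close>

definition grassmannian_haar :: "nat \<Rightarrow> nat \<Rightarrow> (nat \<Rightarrow> real) set measure \<Rightarrow> bool"
  where "grassmannian_haar n k \<mu> \<longleftrightarrow>
    prob_space \<mu> \<and> sets \<mu> = sets (grassmannian_borel n k) \<and>
    (\<forall>T\<in>orth_group n. distr \<mu> (grassmannian_borel n k) (\<lambda>E. T ` E) = \<mu>)"

text \<open>
  Independence of two random variables; \<^const>\<open>prob_space.indep_var\<close> is the same notion but
  requires both variables to take values in the same type.
\<close>

definition indep_rvs ::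
    "'a measure \<Rightarrow> 'b measure \<Rightarrow> ('a \<Rightarrow> 'b) \<Rightarrow> 'c measure \<Rightarrow> ('a \<Rightarrow> 'c) \<Rightarrow> bool"
  where "indep_rvs M S X T Y \<longleftrightarrow>
    X \<in> M \<rightarrow>\<^sub>M S \<and> Y \<in> M \<rightarrow>\<^sub>M T \<and>
    prob_space.indep_set M
      (sigma_sets (space M) {X -` A \<inter> space M | A. A \<in> sets S})
      (sigma_sets (space M) {Y -` A \<inter> space M | A. A \<in> sets T})"

definition log_prob :: "real \<Rightarrow> ereal"
  where "log_prob q = (if q = 0 then - \<infinity> else ereal (ln q))"

definition good_rate_function :: "('d::topological_space \<Rightarrow> ereal) \<Rightarrow> bool"
  where "good_rate_function I \<longleftrightarrow>
    (\<forall>x. 0 \<le> I x) \<and> (\<forall>x. I x \<le> Liminf (at x) I) \<and>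
    (\<forall>\<alpha>::real. compact {x. I x \<le> ereal \<alpha>})"

text \<open>Sequences are indexed by the positive integers; their value at index 0 is irrelevant.\<close>

definition satisfies_MDP ::
    "(nat \<Rightarrow> 'a measure) \<Rightarrow> (nat \<Rightarrow> 'a \<Rightarrow> 'd::topological_space) \<Rightarrow> (nat \<Rightarrow> real) \<Rightarrow> ('d \<Rightarrow> ereal) \<Rightarrow> bool"
  where "satisfies_MDP M X s I \<longleftrightarrow>
    (\<forall>n\<ge>1. s n > 0) \<and> (\<forall>n\<ge>1. X n \<in> borel_measurable (M n)) \<and> good_rate_function I \<and>
    (\<forall>A\<in>sets borel.
      - (INF x\<in>interior A. I x)
        \<le> liminf (\<lambda>n. ereal (1 / s n) * log_prob (measure (M n) {\<omega> \<in> space (M n). X n \<omega> \<in> A})) \<and>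
      liminf (\<lambda>n. ereal (1 / s n) * log_prob (measure (M n) {\<omega> \<in> space (M n). X n \<omega> \<in> A}))
        \<le> limsup (\<lambda>n. ereal (1 / s n) * log_prob (measure (M n) {\<omega> \<in> space (M n). X n \<omega> \<in> A})) \<and>
      limsup (\<lambda>n. ereal (1 / s n) * log_prob (measure (M n) {\<omega> \<in> space (M n). X n \<omega> \<in> A}))
        \<le> - (INF x\<in>closure A. I x))"

definition Mp2 :: "real \<Rightarrow> real"
  where "Mp2 p = p powr (2 / p) / 3 * (Gamma (1 + 3 / p) / Gamma (1 + 1 / p))"

definition proj_norm ::
    "real \<Rightarrow> (nat \<Rightarrow> 'a \<Rightarrow> nat \<Rightarrow> real) \<Rightarrow> (nat \<Rightarrow> 'a \<Rightarrow> (nat \<Rightarrow> real) set) \<Rightarrow> nat \<Rightarrow> 'a \<Rightarrow> real"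
  where "proj_norm p X E n \<omega> = real n powr (1 / p) * lp_norm 2 n (orth_proj n (E n \<omega>) (X n \<omega>))"

definition rate_gauss :: "real \<Rightarrow> real \<Rightarrow> ereal"
  where "rate_gauss p x =
    (if x > 0 then ereal ((x\<^sup>2 - Mp2 p) / (2 * Mp2 p) - ln (x / sqrt (Mp2 p))) else \<infinity>)"

definition rate_critical :: "real \<Rightarrow> real \<Rightarrow> ereal"
  where "rate_critical p x =
    (if x > 0 then
      (INF y\<in>{sqrt (Mp2 p)..}.
        ereal (((x / y)\<^sup>2 - 1) / 2 - ln (x / y) + 1 / p * (y\<^sup>2 - Mp2 p) powr (p / 2)))
     else \<infinity>)"

definition rate_stretched :: "real \<Rightarrow> real \<Rightarrow> ereal"
  where "rate_stretched p x =
    (if x \<ge> sqrt (Mp2 p) then ereal (1 / p * (x\<^sup>2 - Mp2 p) powr (p / 2)) else \<infinity>)"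

end

theory Submission
  imports Defs "HOL-Real_Asymp.Real_Asymp"
begin

text \<open>
  The rescaled norm factors as
  \<open>k^(-1/2) n^(1/p) \<parallel>P X\<parallel> = V * B\<close> with the radius \<open>V = n^(1/p - 1/2) \<parallel>X\<parallel>\<close> and the direction
  factor \<open>B = (n/k)^(1/2) \<parallel>P X\<parallel> / \<parallel>X\<parallel>\<close>, all norms being Euclidean and \<open>P\<close> the projection onto the
  random subspace. By rotation invariance of the Haar measure the conditional law of \<open>B\<close> given
  \<open>X\<close> does not depend on \<open>X\<close>; hence \<open>V\<close> and \<open>B\<close> are independent (\<open>projection_joint_law\<close>).

  The law of \<open>B\<close> does not change if \<open>X\<close> is replaced by a standard Gaussian vector \<open>g\<close> and the random
  subspace by the span of the first \<open>k\<close> unit vectors (\<open>haar_projection_law\<close>). So \<open>B\<^sup>2\<close> has the law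
  of the mean of \<open>k\<close> squared normal variables divided by the mean of all \<open>n\<close> of them. Since
  \<open>k = o(n)\<close>, the denominator is \<open>1\<close> at the speed \<open>k\<close>, and \<open>B\<close> has there the chi-square rate
  \<open>(u\<^sup>2 - 1) / 2 - log u\<close> (\<open>ratio_upper_tail\<close>, \<open>ratio_lower_tail\<close>, \<open>ratio_at\<close>).

  For the radius, let \<open>Y\<close> have independent coordinates with density proportional to
  \<open>exp (- \<bar>t\<bar>^p / p)\<close>. Its law is that of \<open>\<tau>^(1/p) X\<close> with an independent Gamma variable \<open>\<tau>\<close> which
  stays within a factor \<open>1 \<plusminus> \<epsilon>\<close> of \<open>n\<close> up to a probability exponentially small in \<open>n\<close>
  (\<open>pgauss_law_mixture\<close>). Therefore \<open>V\<^sup>2\<close> deviates like the mean of the \<open>n\<close> squared coordinates of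
  \<open>Y\<close>, whose expectation is \<open>Mp2 p\<close>. Lower deviations, and upper ones if \<open>p \<ge> 2\<close>, have the speed
  \<open>n\<close> and are infinitely expensive at the speeds in question. If \<open>p < 2\<close>, the squares have tails
  \<open>exp (- z^(p/2) / p)\<close>, and the cheapest way to an excess \<open>n y\<close> of their sum is one single large
  coordinate; this has the speed \<open>n^(p/2)\<close> and the rate \<open>y^(p/2) / p\<close>
  (\<open>radius_upper_tail_heavy\<close>, \<open>radius_at_heavy\<close>).

  For independent factors the rate of the product at \<open>x\<close> is the infimum of \<open>J (x / y) + K y\<close> over
  the values \<open>y\<close> of \<open>V\<close> (\<open>product_MDP\<close>). The cases of the theorem correspond to the comparison of the
  two speeds \<open>k\<close> and \<open>n^(p/2)\<close>: the factor with the faster speed is frozen at its typical value,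
  and if the speeds agree, both rates enter the infimum.
\<close>

section \<open>Exponential tail bounds\<close>

text \<open>
  Since \<open>log 0 = -\<infinity>\<close> gets in the way of calculations, the two halves of a deviations principle
  are phrased by comparison with exponentials: \<open>exp_upper s P r\<close> says that
  \<open>limsup (1/s n) log (P n) \<le> -r\<close>, and \<open>exp_lower s P r\<close> that \<open>liminf (1/s n) log (P n) \<ge> -r\<close>.
\<close>

definition exp_upper :: "(nat \<Rightarrow> real) \<Rightarrow> (nat \<Rightarrow> real) \<Rightarrow> ereal \<Rightarrow> bool"
  where "exp_upper s P r \<longleftrightarrow>
    (\<forall>c. ereal c < r \<longrightarrow> (\<forall>\<^sub>F n in sequentially. P n \<le> exp (- (c * s n))))"

definition exp_lower :: "(nat \<Rightarrow> real) \<Rightarrow> (nat \<Rightarrow> real) \<Rightarrow> ereal \<Rightarrow> bool"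
  where "exp_lower s P r \<longleftrightarrow>
    (\<forall>c. r < ereal c \<longrightarrow> (\<forall>\<^sub>F n in sequentially. exp (- (c * s n)) \<le> P n))"

lemma exp_upperD: "exp_upper s P r \<Longrightarrow> ereal c < r \<Longrightarrow> \<forall>\<^sub>F n in sequentially. P n \<le> exp (- (c * s n))"
  by (simp add: exp_upper_def)

lemma exp_lowerD: "exp_lower s P r \<Longrightarrow> r < ereal c \<Longrightarrow> \<forall>\<^sub>F n in sequentially. exp (- (c * s n)) \<le> P n"
  by (simp add: exp_lower_def)

lemma exp_upper_mono:
  assumes "exp_upper s Q r" "\<forall>\<^sub>F n in sequentially. P n \<le> Q n" "r' \<le> r"
  shows "exp_upper s P r'"
  unfolding exp_upper_def
proof (intro allI impI)
  fix c assume "ereal c < r'"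
  then have "\<forall>\<^sub>F n in sequentially. Q n \<le> exp (- (c * s n))"
    using assms by (intro exp_upperD[OF assms(1)]) (auto intro: less_le_trans)
  with assms(2) show "\<forall>\<^sub>F n in sequentially. P n \<le> exp (- (c * s n))"
    by eventually_elim simp
qed

lemma exp_lower_mono:
  assumes "exp_lower s Q r" "\<forall>\<^sub>F n in sequentially. Q n \<le> P n" "r \<le> r'"
  shows "exp_lower s P r'"
  unfolding exp_lower_def
proof (intro allI impI)
  fix c assume "r' < ereal c"
  then have "\<forall>\<^sub>F n in sequentially. exp (- (c * s n)) \<le> Q n"
    using assms by (intro exp_lowerD[OF assms(1)]) (auto intro: le_less_trans)
  with assms(2) show "\<forall>\<^sub>F n in sequentially. exp (- (c * s n)) \<le> P n"
    by eventually_elim simp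
qed

text \<open>
  A loss in the exponent absorbs every constant factor, because the speed tends to infinity. All
  constants that occur below disappear in this way.
\<close>

lemma eventually_mult_exp_le:
  fixes s :: "nat \<Rightarrow> real"
  assumes s: "filterlim s at_top sequentially" and "c < c'" and "0 < C"
  shows "\<forall>\<^sub>F n in sequentially. C * exp (- (c' * s n)) \<le> exp (- (c * s n))"
proof -
  have "\<forall>\<^sub>F n in sequentially. s n \<ge> ln C / (c' - c)"
    using s by (auto simp: filterlim_at_top)
  then show ?thesis
  proof eventually_elim
    case (elim n)
    then have "ln C + - (c' * s n) \<le> - (c * s n)"
      using \<open>c < c'\<close> by (simp add: field_simps)
    then have "exp (ln C + - (c' * s n)) \<le> exp (- (c * s n))" by simp
    then show ?case using \<open>0 < C\<close> by (simp only: exp_add) simp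
  qed
qed

lemma exp_upper_add:
  assumes s: "filterlim s at_top sequentially" and "exp_upper s P r" "exp_upper s Q r"
  shows "exp_upper s (\<lambda>n. P n + Q n) r"
  unfolding exp_upper_def
proof (intro allI impI)
  fix c assume "ereal c < r"
  then obtain c' where c': "ereal c < ereal c'" "ereal c' < r"
    using ereal_dense2 by blast
  then have "\<forall>\<^sub>F n in sequentially. 2 * exp (- (c' * s n)) \<le> exp (- (c * s n))"
    by (intro eventually_mult_exp_le[OF s]) auto
  with exp_upperD[OF assms(2) c'(2)] exp_upperD[OF assms(3) c'(2)]
  show "\<forall>\<^sub>F n in sequentially. P n + Q n \<le> exp (- (c * s n))"
    by eventually_elim simp
qed

lemma exp_upperI_bound:
  assumes s: "filterlim s at_top sequentially" and C: "0 < C"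
    and le: "\<forall>\<^sub>F n in sequentially. P n \<le> C * exp (- (c * s n))"
  shows "exp_upper s P (ereal c)"
  unfolding exp_upper_def
proof (intro allI impI)
  fix c' assume "ereal c' < ereal c"
  then have "\<forall>\<^sub>F n in sequentially. C * exp (- (c * s n)) \<le> exp (- (c' * s n))"
    using C by (intro eventually_mult_exp_le[OF s]) auto
  with le show "\<forall>\<^sub>F n in sequentially. P n \<le> exp (- (c' * s n))" by eventually_elim linarith
qed

lemma exp_upper_scale:
  assumes s: "filterlim s at_top sequentially" and C: "0 < C" and "exp_upper s P r"
  shows "exp_upper s (\<lambda>n. C * P n) r"
  unfolding exp_upper_def
proof (intro allI impI)
  fix c assume "ereal c < r"
  then obtain c' where c': "ereal c < ereal c'" "ereal c' < r" using ereal_dense2 by blast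
  have "\<forall>\<^sub>F n in sequentially. C * exp (- (c' * s n)) \<le> exp (- (c * s n))"
    using c' C by (intro eventually_mult_exp_le[OF s]) auto
  with exp_upperD[OF assms(3) c'(2)] show "\<forall>\<^sub>F n in sequentially. C * P n \<le> exp (- (c * s n))"
  proof eventually_elim
    case (elim n)
    then have "C * P n \<le> C * exp (- (c' * s n))" using C by simp
    then show ?case using elim by linarith
  qed
qed

lemma eventually_exp_small:
  fixes c e :: real
  assumes "0 < c" "0 < e" shows "\<forall>\<^sub>F n in sequentially. r * exp (- (c * real n)) < e"
proof -
  have "((\<lambda>n. r * exp (- (c * real n))) \<longlongrightarrow> r * 0) sequentially"
    using assms(1) by (intro tendsto_mult tendsto_const) real_asymp
  then show ?thesis using assms(2) by (intro order_tendstoD(2)) auto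
qed

lemma exp_upper_sum:
  assumes s: "filterlim s at_top sequentially" and "finite A" "\<And>i. i \<in> A \<Longrightarrow> exp_upper s (P i) r"
  shows "exp_upper s (\<lambda>n. \<Sum>i\<in>A. P i n) r"
  using assms(2,3)
proof (induction A rule: finite_induct)
  case empty
  then show ?case by (auto simp: exp_upper_def)
next
  case (insert a A)
  then show ?case using exp_upper_add[OF s, of "P a" r "\<lambda>n. \<Sum>i\<in>A. P i n"] by simp
qed

lemma exp_upper_nonpos:
  assumes s: "filterlim s at_top sequentially" and "\<forall>\<^sub>F n in sequentially. P n \<le> 1" "r \<le> 0"
  shows "exp_upper s P r"
  unfolding exp_upper_def
proof (intro allI impI)
  fix c assume "ereal c < r"
  then have "ereal c < 0" using assms(3) by (rule less_le_trans)
  then have c: "c < 0" by simp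
  have "\<forall>\<^sub>F n in sequentially. s n \<ge> 0" using s by (auto simp: filterlim_at_top)
  with assms(2) show "\<forall>\<^sub>F n in sequentially. P n \<le> exp (- (c * s n))"
  proof eventually_elim
    case (elim n)
    have "c * s n \<le> 0" using c elim by (simp add: mult_nonpos_nonneg)
    then have "1 \<le> exp (- (c * s n))" by simp
    then show ?case using elim by linarith
  qed
qed

text \<open>
  Splitting a bound below a sum of two rates is delicate only because either of them may be
  infinite; then a trivial bound for the other one is enough.
\<close>

lemma ereal_less_add_split:
  fixes a b :: ereal
  assumes "ereal c < a + b" "0 \<le> a" "0 \<le> b"
  obtains c1 c2 where "ereal c1 < a" "ereal c2 < b" "c < c1 + c2"
proof (cases "a = \<infinity>")
  case True
  have "ereal (-1) < b" using assms(3) by (rule less_le_trans[rotated]) simp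
  then show ?thesis using that[of "c + 2" "-1"] True by simp
next
  case af: False
  then obtain x where x: "a = ereal x" using assms(2) by (cases a) auto
  show ?thesis
  proof (cases "b = \<infinity>")
    case True
    show ?thesis using that[of "x - 1" "c - x + 2"] x True by simp
  next
    case False
    then obtain y where y: "b = ereal y" using assms(3) by (cases b) auto
    define d where "d = (x + y - c) / 3"
    have "d > 0" using assms(1) x y by (simp add: d_def)
    then show ?thesis using that[of "x - d" "y - d"] x y by (simp add: d_def field_simps)
  qed
qed

lemma ereal_add_less_split:
  fixes a b :: ereal
  assumes "a + b < ereal c" "0 \<le> a" "0 \<le> b"
  obtains c1 c2 where "a < ereal c1" "b < ereal c2" "c1 + c2 < c"
proof -
  obtain x where x: "a = ereal x" using assms by (cases a) auto
  obtain y where y: "b = ereal y" using assms by (cases b) auto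
  define d where "d = (c - x - y) / 3"
  have "d > 0" using assms(1) x y by (simp add: d_def)
  then show ?thesis using that[of "x + d" "y + d"] x y by (simp add: d_def field_simps)
qed

lemma exp_upper_mult:
  assumes s: "filterlim s at_top sequentially" and "exp_upper s P r" "exp_upper s Q r'"
    and "0 \<le> r" "0 \<le> r'" and "\<And>n. 0 \<le> P n" "\<And>n. 0 \<le> Q n"
  shows "exp_upper s (\<lambda>n. P n * Q n) (r + r')"
  unfolding exp_upper_def
proof (intro allI impI)
  fix c assume "ereal c < r + r'"
  then obtain c1 c2 where c: "ereal c1 < r" "ereal c2 < r'" "c < c1 + c2"
    using ereal_less_add_split assms(4,5) by blast
  have "\<forall>\<^sub>F n in sequentially. s n \<ge> 0" using s by (auto simp: filterlim_at_top)
  with exp_upperD[OF assms(2) c(1)] exp_upperD[OF assms(3) c(2)]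
  show "\<forall>\<^sub>F n in sequentially. P n * Q n \<le> exp (- (c * s n))"
  proof eventually_elim
    case (elim n)
    have "P n * Q n \<le> exp (- (c1 * s n)) * exp (- (c2 * s n))"
      using elim assms(6,7) by (intro mult_mono) auto
    also have "\<dots> = exp (- ((c1 + c2) * s n))" by (simp flip: exp_add add: algebra_simps)
    also have "\<dots> \<le> exp (- (c * s n))" using elim c(3) by (simp add: mult_right_mono)
    finally show ?case .
  qed
qed

lemma exp_lower_mult:
  assumes s: "filterlim s at_top sequentially" and "exp_lower s P r" "exp_lower s Q r'"
    and "0 \<le> r" "0 \<le> r'"
  shows "exp_lower s (\<lambda>n. P n * Q n) (r + r')"
  unfolding exp_lower_def
proof (intro allI impI)
  fix c assume "r + r' < ereal c"
  then obtain c1 c2 where c: "r < ereal c1" "r' < ereal c2" "c1 + c2 < c"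
    using ereal_add_less_split assms(4,5) by blast
  have "\<forall>\<^sub>F n in sequentially. s n \<ge> 0" using s by (auto simp: filterlim_at_top)
  with exp_lowerD[OF assms(2) c(1)] exp_lowerD[OF assms(3) c(2)]
  show "\<forall>\<^sub>F n in sequentially. exp (- (c * s n)) \<le> P n * Q n"
  proof eventually_elim
    case (elim n)
    have "exp (- (c * s n)) \<le> exp (- ((c1 + c2) * s n))" using elim c(3) by (simp add: mult_right_mono)
    also have "\<dots> = exp (- (c1 * s n)) * exp (- (c2 * s n))"  by (simp flip: exp_add add: algebra_simps)
    also have "\<dots> \<le> P n * Q n"
      using elim by (intro mult_mono) (auto intro: order_trans[OF exp_ge_zero])
    finally show ?case .
  qed
qed

text \<open>
  A quantity of strictly larger rate is exponentially negligible, so that subtracting it leaves the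
  lower bound intact.
\<close>

lemma exp_lower_diff:
  assumes s: "filterlim s at_top sequentially" and "exp_lower s P r" "exp_upper s Q r'" "r < r'"
  shows "exp_lower s (\<lambda>n. P n - Q n) r"
  unfolding exp_lower_def
proof (intro allI impI)
  fix c assume "r < ereal c"
  then have "r < min r' (ereal c)" using assms(4) by simp
  then obtain c1 where c1: "r < ereal c1" "ereal c1 < min r' (ereal c)" using ereal_dense2 by blast
  then have "ereal c1 < min r' (ereal c)" by simp
  then obtain c2 where c2: "ereal c1 < ereal c2" "ereal c2 < min r' (ereal c)" using ereal_dense2 by blast
  have le: "c1 < c" "c1 < c2" "ereal c2 < r'" using c1 c2 by auto
  show "\<forall>\<^sub>F n in sequentially. exp (- (c * s n)) \<le> P n - Q n"
    using exp_lowerD[OF assms(2) c1(1)] exp_upperD[OF assms(3) le(3)]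
      eventually_mult_exp_le[OF s le(1), of 2, simplified] eventually_mult_exp_le[OF s le(2), of 2, simplified]
  proof eventually_elim
    case (elim n)
    then show ?case by linarith
  qed
qed

lemma exp_lower_nonneg:
  assumes s: "filterlim s at_top sequentially" and "\<forall>\<^sub>F n in sequentially. 1 / 2 \<le> P n" "0 \<le> r"
  shows "exp_lower s P r"
  unfolding exp_lower_def
proof (intro allI impI)
  fix c assume "r < ereal c"
  then have "0 < ereal c" using assms(3) by (rule le_less_trans[rotated])
  then have c: "0 < c" by simp
  have "\<forall>\<^sub>F n in sequentially. 2 * exp (- (c * s n)) \<le> exp (- (0 * s n))"
    using c by (intro eventually_mult_exp_le[OF s]) auto
  with assms(2) show "\<forall>\<^sub>F n in sequentially. exp (- (c * s n)) \<le> P n"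
    by eventually_elim simp
qed

text \<open>
  An event with any positive rate at a faster speed is infinitely expensive at the slower one. This
  is how the different scales of radius and direction decouple.
\<close>

lemma exp_upper_faster:
  assumes t: "filterlim t at_top sequentially" "exp_upper t P r" "0 < r"
    and o: "s \<in> o(t)"
  shows "exp_upper s P r'"
  unfolding exp_upper_def
proof (intro allI impI)
  fix c :: real
  obtain d where d: "ereal 0 < ereal d" "ereal d < r" using assms(3) ereal_dense2[of 0 r] by (auto simp: zero_ereal_def)
  have "\<forall>\<^sub>F n in sequentially. norm (s n) \<le> d / (\<bar>c\<bar> + 1) * norm (t n)"
    using o d(1) by (intro landau_o.smallD) auto
  moreover have "\<forall>\<^sub>F n in sequentially. t n \<ge> 0" using t by (auto simp: filterlim_at_top)
  ultimately show "\<forall>\<^sub>F n in sequentially. P n \<le> exp (- (c * s n))"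
    using exp_upperD[OF t(2) d(2)]
  proof eventually_elim
    case (elim n)
    have "c * s n \<le> \<bar>c\<bar> * \<bar>s n\<bar>" by (metis abs_ge_self abs_mult)
    also have "\<dots> \<le> (\<bar>c\<bar> + 1) * \<bar>s n\<bar>" by (intro mult_right_mono) auto
    also have "\<dots> \<le> d * t n" using elim by (simp add: field_simps)
    finally have "exp (- (d * t n)) \<le> exp (- (c * s n))" by simp
    then show ?case using elim by linarith
  qed
qed

lemma exp_upper_speed:
  assumes "filterlim t at_top sequentially" "exp_upper t P r" and lim: "(\<lambda>n. s n / t n) \<longlonglongrightarrow> 1"
  shows "exp_upper s P r"
  unfolding exp_upper_def
proof (intro allI impI)
  fix c :: real assume "ereal c < r"
  then obtain c' where c': "ereal c < ereal c'" "ereal c' < r" using ereal_dense2 by blast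
  have "(\<lambda>n. c * (s n / t n)) \<longlonglongrightarrow> c * 1" by (intro tendsto_intros lim)
  then have "\<forall>\<^sub>F n in sequentially. c * (s n / t n) < c'" using c'(1) by (intro order_tendstoD(2)) auto
  moreover have "\<forall>\<^sub>F n in sequentially. t n > 0" using assms(1) by (auto simp: filterlim_at_top_dense)
  ultimately show "\<forall>\<^sub>F n in sequentially. P n \<le> exp (- (c * s n))"
    using exp_upperD[OF assms(2) c'(2)]
  proof eventually_elim
    case (elim n)
    then have "c * s n \<le> c' * t n" by (simp add: field_simps)
    then have "exp (- (c' * t n)) \<le> exp (- (c * s n))" by simp
    then show ?case using elim by linarith
  qed
qed

lemma exp_lower_speed:
  assumes "filterlim t at_top sequentially" "exp_lower t P r" and lim: "(\<lambda>n. s n / t n) \<longlonglongrightarrow> 1"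
  shows "exp_lower s P r"
  unfolding exp_lower_def
proof (intro allI impI)
  fix c :: real assume "r < ereal c"
  then obtain c' where c': "r < ereal c'" "ereal c' < ereal c" using ereal_dense2 by blast
  have "(\<lambda>n. c * (s n / t n)) \<longlonglongrightarrow> c * 1" by (intro tendsto_intros lim)
  then have "\<forall>\<^sub>F n in sequentially. c * (s n / t n) > c'" using c'(2) by (intro order_tendstoD(1)) auto
  moreover have "\<forall>\<^sub>F n in sequentially. t n > 0" using assms(1) by (auto simp: filterlim_at_top_dense)
  ultimately show "\<forall>\<^sub>F n in sequentially. exp (- (c * s n)) \<le> P n"
    using exp_lowerD[OF assms(2) c'(1)]
  proof eventually_elim
    case (elim n)
    then have "c' * t n \<le> c * s n" by (simp add: field_simps)
    then have "exp (- (c * s n)) \<le> exp (- (c' * t n))" by simp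
    then show ?case using elim by linarith
  qed
qed

text \<open>
  Closed sublevel sets express lower semicontinuity; this is the neighbourhood form in which it is
  used.
\<close>

lemma sublevel_nbhd:
  fixes I :: "real \<Rightarrow> ereal"
  assumes "\<And>\<alpha>::real. closed {x. I x \<le> ereal \<alpha>}" "ereal c < I b"
  obtains \<delta> where "0 < \<delta>" "\<And>z. \<bar>z - b\<bar> < \<delta> \<Longrightarrow> ereal c < I z"
proof -
  have "open (- {x. I x \<le> ereal c})" using assms(1) by (simp add: open_closed)
  moreover have "b \<in> - {x. I x \<le> ereal c}" using assms(2) by auto
  ultimately obtain \<delta> where "\<delta> > 0" "\<forall>z. dist z b < \<delta> \<longrightarrow> z \<in> - {x. I x \<le> ereal c}"
    unfolding open_dist by blast
  then show ?thesis using that[of \<delta>] by (auto simp: dist_real_def not_le)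
qed

lemma good_rate_functionI:
  fixes I :: "real \<Rightarrow> ereal"
  assumes "\<And>x. 0 \<le> I x" and compact: "\<And>\<alpha>::real. compact {x. I x \<le> ereal \<alpha>}"
  shows "good_rate_function I"
  unfolding good_rate_function_def
proof (intro conjI allI assms)
  fix x show "I x \<le> Liminf (at x) I"
    unfolding le_Liminf_iff
  proof (intro allI impI)
    fix y assume "y < I x"
    then obtain c where c: "y < ereal c" "ereal c < I x" using ereal_dense2 by blast
    then obtain \<delta> where \<delta>: "0 < \<delta>" "\<And>z. \<bar>z - x\<bar> < \<delta> \<Longrightarrow> ereal c < I z"
      using sublevel_nbhd[OF compact_imp_closed[OF compact]] by blast
    have "\<forall>\<^sub>F z in at x. dist z x < \<delta>" using \<delta>(1) eventually_at[of _ x UNIV] by auto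
    then show "\<forall>\<^sub>F z in at x. y < I z"
      by eventually_elim (use \<delta>(2) c(1) in \<open>auto simp: dist_real_def intro: less_trans\<close>)
  qed
qed

lemma limsup_log_prob_le:
  assumes "exp_upper s P r" "\<And>n. 0 \<le> P n" "\<forall>\<^sub>F n in sequentially. 0 < s n"
  shows "limsup (\<lambda>n. ereal (1 / s n) * log_prob (P n)) \<le> - r"
proof (rule ccontr)
  assume "\<not> ?thesis"
  then have "- r < limsup (\<lambda>n. ereal (1 / s n) * log_prob (P n))" by simp
  then obtain c where c: "- r < ereal c" "ereal c < limsup (\<lambda>n. ereal (1 / s n) * log_prob (P n))"
    using ereal_dense2 by blast
  have "ereal (- c) < r" using c(1) by (cases r) auto
  from exp_upperD[OF assms(1) this] assms(3)
  have "\<forall>\<^sub>F n in sequentially. ereal (1 / s n) * log_prob (P n) \<le> ereal c"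
  proof eventually_elim
    case (elim n)
    show ?case
    proof (cases "P n = 0")
      case True
      then show ?thesis using elim by (simp add: log_prob_def)
    next
      case False
      then have "P n > 0" using assms(2)[of n] by simp
      have "ln (P n) \<le> ln (exp (c * s n))" using elim \<open>P n > 0\<close> by (subst ln_le_cancel_iff) auto
      then have "ln (P n) \<le> c * s n" by simp
      then show ?thesis using False elim by (simp add: log_prob_def field_simps)
    qed
  qed
  then have "limsup (\<lambda>n. ereal (1 / s n) * log_prob (P n)) \<le> ereal c" by (rule Limsup_bounded)
  then show False using c(2) by simp
qed

lemma liminf_log_prob_ge:
  assumes "exp_lower s P r" "\<forall>\<^sub>F n in sequentially. 0 < s n"
  shows "- r \<le> liminf (\<lambda>n. ereal (1 / s n) * log_prob (P n))"
proof (rule ccontr)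
  assume "\<not> ?thesis"
  then have "liminf (\<lambda>n. ereal (1 / s n) * log_prob (P n)) < - r" by simp
  then obtain c where c: "liminf (\<lambda>n. ereal (1 / s n) * log_prob (P n)) < ereal c" "ereal c < - r"
    using ereal_dense2 by blast
  have "r < ereal (- c)" using c(2) by (cases r) auto
  from exp_lowerD[OF assms(1) this] assms(2)
  have "\<forall>\<^sub>F n in sequentially. ereal c \<le> ereal (1 / s n) * log_prob (P n)"
  proof eventually_elim
    case (elim n)
    have "P n > 0" using elim by (auto intro: less_le_trans[OF exp_gt_zero])
    then have "c * s n \<le> ln (P n)" using elim by (subst ln_ge_iff) auto
    then show ?case using \<open>P n > 0\<close> elim by (simp add: log_prob_def field_simps)
  qed
  then have "ereal c \<le> liminf (\<lambda>n. ereal (1 / s n) * log_prob (P n))" by (rule Liminf_bounded)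
  then show False using c(1) by simp
qed

text \<open>
  Monotonicity reduces Borel sets to closed sets for the upper bound and to balls around single
  points for the lower bound.
\<close>

lemma satisfies_MDP_I:
  fixes M :: "nat \<Rightarrow> 'a measure" and X :: "nat \<Rightarrow> 'a \<Rightarrow> real"
  assumes s_pos: "\<And>n. n \<ge> 1 \<Longrightarrow> s n > 0"
    and prob: "\<And>n. n \<ge> 1 \<Longrightarrow> prob_space (M n)"
    and meas: "\<And>n. n \<ge> 1 \<Longrightarrow> X n \<in> borel_measurable (M n)"
    and good: "good_rate_function I"
    and upper: "\<And>F. closed F \<Longrightarrow> exp_upper s (\<lambda>n. \<P>(\<omega> in M n. X n \<omega> \<in> F)) (INF x\<in>F. I x)"
    and lower: "\<And>x e. 0 < e \<Longrightarrow> exp_lower s (\<lambda>n. \<P>(\<omega> in M n. X n \<omega> \<in> ball x e)) (I x)"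
  shows "satisfies_MDP M X s I"
proof -
  have sp: "\<forall>\<^sub>F n in sequentially. 0 < s n" using s_pos eventually_at_top_linorder by blast
  have n1: "\<forall>\<^sub>F n in sequentially. (1::nat) \<le> n" by (rule eventually_ge_at_top)
  have mono: "\<forall>\<^sub>F n in sequentially. \<P>(\<omega> in M n. X n \<omega> \<in> A) \<le> \<P>(\<omega> in M n. X n \<omega> \<in> A')"
    if A: "A \<subseteq> A'" "A' \<in> sets borel" for A A'
    using n1
  proof eventually_elim
    case (elim n)
    interpret prob_space "M n" by (rule prob[OF elim])
    have "{\<omega> \<in> space (M n). X n \<omega> \<in> A'} \<in> sets (M n)"
      using measurable_sets[OF meas[OF elim] A(2)] by (simp add: vimage_def Int_def conj_commute)
    then show ?case using A(1) by (intro finite_measure_mono) blast+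
  qed
  let ?u = "\<lambda>A n. ereal (1 / s n) * log_prob (\<P>(\<omega> in M n. X n \<omega> \<in> A))"
  have up: "limsup (?u A) \<le> - (INF x\<in>closure A. I x)" for A
  proof (intro limsup_log_prob_le sp)
    show "exp_upper s (\<lambda>n. \<P>(\<omega> in M n. X n \<omega> \<in> A)) (INF x\<in>closure A. I x)"
      by (rule exp_upper_mono[OF upper[of "closure A"] mono[of A "closure A"]]) (simp_all add: closure_subset)
  qed auto
  have lo: "- (INF x\<in>interior A. I x) \<le> liminf (?u A)" if A: "A \<in> sets borel" for A
  proof -
    have "- I x \<le> liminf (?u A)" if x: "x \<in> interior A" for x
    proof -
      obtain e where e: "0 < e" "ball x e \<subseteq> A" using x by (auto simp: mem_interior)
      have "exp_lower s (\<lambda>n. \<P>(\<omega> in M n. X n \<omega> \<in> A)) (I x)"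
        by (rule exp_lower_mono[OF lower[OF e(1)] mono]) (use e A in auto)
      then show ?thesis by (intro liminf_log_prob_ge sp)
    qed
    then have "- liminf (?u A) \<le> I x" if "x \<in> interior A" for x
      using \<open>\<And>x. x \<in> interior A \<Longrightarrow> - I x \<le> liminf (?u A)\<close>[OF that] by (simp add: ereal_uminus_le_reorder)
    then have "- liminf (?u A) \<le> (INF x\<in>interior A. I x)" by (rule INF_greatest)
    then show ?thesis by (simp add: ereal_uminus_le_reorder)
  qed
  show ?thesis
    unfolding satisfies_MDP_def
    using s_pos meas good up lo Liminf_le_Limsup[OF sequentially_bot] by auto
qed

section \<open>Deviations of a product of independent factors\<close>

text \<open>
  The rate functions \<open>K\<close> and \<open>J\<close> of two independent nonnegative factors \<open>V\<close> and \<open>B\<close>: the factor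
  \<open>V\<close> concentrates at \<open>m\<close> and deviates at finite cost only upwards, whence \<open>K\<close> matters only on
  \<open>{m..}\<close>; the factor \<open>B\<close> concentrates at \<open>1\<close>.
\<close>

locale multiplicative_rate =
  fixes m :: real and K J :: "real \<Rightarrow> ereal"
  assumes m_pos: "0 < m" and K_m: "K m = 0" and J_1: "J 1 = 0"
    and K_nonneg: "\<And>y. 0 \<le> K y" and J_nonneg: "\<And>u. 0 \<le> J u"
    and K_mono: "\<And>y z. m \<le> y \<Longrightarrow> y \<le> z \<Longrightarrow> K y \<le> K z"
    and J_nonpos: "\<And>u. u \<le> 0 \<Longrightarrow> J u = \<infinity>"
    and K_compact: "\<And>\<alpha>::real. compact {y. m \<le> y \<and> K y \<le> ereal \<alpha>}"
    and J_compact: "\<And>\<alpha>::real. compact {u. J u \<le> ereal \<alpha>}"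
begin

definition rate :: "real \<Rightarrow> ereal"
  where "rate x = (INF y\<in>{m..}. J (x / y) + K y)"

lemma rate_nonneg: "0 \<le> rate x"
  unfolding rate_def by (intro INF_greatest add_nonneg_nonneg J_nonneg K_nonneg)

lemma rate_le: "m \<le> y \<Longrightarrow> rate x \<le> J (x / y) + K y"
  unfolding rate_def by (intro INF_lower) auto

text \<open>
  The cheapest of the obvious strategies bound the rate: keep \<open>V\<close> at \<open>m\<close> and let \<open>B\<close> deviate, or keep
  \<open>B\<close> at \<open>1\<close> and let \<open>V\<close> deviate.
\<close>

lemma rate_le_J: "rate x \<le> J (x / m)"
  using rate_le[of m x] K_m by simp

lemma rate_le_K: "m \<le> y \<Longrightarrow> rate y \<le> K y"
  using rate_le[of y y] J_1 m_pos by simp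

lemma rate_m: "rate m = 0"
  using rate_le_K[of m] K_m rate_nonneg[of m] by simp

text \<open>
  A sum of two extended reals is at most \<open>\<beta>\<close> iff for every real \<open>a\<close> the first is at most \<open>a\<close> or the
  second at most \<open>\<beta> - a\<close>; this exhibits the sublevel set as an intersection of closed sets, without
  any continuity of \<open>K\<close> or \<open>J\<close>.
\<close>

lemma compact_sum_sublevel:
  fixes \<beta> :: real
  shows "compact {(y, u). m \<le> y \<and> K y + J u \<le> ereal \<beta>}" (is "compact ?C")
proof -
  have eq: "?C = (\<Inter>a::real. {y. m \<le> y \<and> K y \<le> ereal a} \<times> UNIV \<union> {m..} \<times> {u. J u \<le> ereal (\<beta> - a)})"
    (is "_ = ?D")
  proof (intro subset_antisym subsetI)
    fix p assume "p \<in> ?C"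
    then obtain y u where p: "p = (y, u)" "m \<le> y" "K y + J u \<le> ereal \<beta>" by auto
    have "K y \<le> ereal a \<or> J u \<le> ereal (\<beta> - a)" for a
    proof (rule ccontr)
      assume neg: "\<not> ?thesis"
      then have "ereal a < K y" "ereal (\<beta> - a) < J u" by auto
      then have "ereal a + ereal (\<beta> - a) < K y + J u" by (rule ereal_add_strict_mono2)
      then show False using p(3) by simp
    qed
    then show "p \<in> ?D" using p by auto
  next
    fix p assume p: "p \<in> ?D"
    obtain y u where yu: "p = (y, u)" by (cases p)
    have d: "m \<le> y \<and> (K y \<le> ereal a \<or> J u \<le> ereal (\<beta> - a))" for a
      using p yu by auto
    have "K y + J u \<le> ereal \<beta>"
    proof (rule ccontr)
      assume "\<not> ?thesis"
      then have "ereal \<beta> < K y + J u" by simp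
      then obtain c1 c2 where c: "ereal c1 < K y" "ereal c2 < J u" "\<beta> < c1 + c2"
        using ereal_less_add_split K_nonneg J_nonneg by blast
      from c(3) have "ereal (\<beta> - c1) < ereal c2" by simp
      then have "ereal (\<beta> - c1) < J u" using c(2) by (rule less_trans)
      then show False using d[of c1] c(1) by auto
    qed
    then show "p \<in> ?C" using d yu by auto
  qed
  have "closed ?D"
    by (intro closed_INT ballI closed_Un closed_Times closed_UNIV closed_atLeast
        compact_imp_closed[OF K_compact] compact_imp_closed[OF J_compact])
  moreover have "?C \<subseteq> {y. m \<le> y \<and> K y \<le> ereal \<beta>} \<times> {u. J u \<le> ereal \<beta>}"
    using K_nonneg J_nonneg
    by (auto intro: order_trans[OF add_increasing2[OF _ order_refl]] order_trans[OF add_increasing[OF _ order_refl]])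
  ultimately show ?thesis
    using compact_Int_closed[OF compact_Times[OF K_compact[of \<beta>] J_compact[of \<beta>]], of ?C] eq
    by (simp add: inf.absorb2)
qed

text \<open>
  For each \<open>\<beta> > \<alpha>\<close> the sublevel set lies in the image under multiplication of a compact set of pairs
  \<open>(y, u)\<close>. Intersecting over \<open>\<beta>\<close> avoids the question whether the infimum that defines the rate is
  attained.
\<close>

lemma compact_rate_sublevel: "compact {x. rate x \<le> ereal \<alpha>}"
proof -
  let ?C = "\<lambda>\<beta>. {(y, u). m \<le> y \<and> K y + J u \<le> ereal \<beta>}"
  have "{x. rate x \<le> ereal \<alpha>} = (\<Inter>\<beta>\<in>{\<alpha><..}. (\<lambda>(y, u). y * u) ` ?C \<beta>)"
  proof (intro subset_antisym subsetI INT_I)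
    fix x \<beta> assume "x \<in> {x. rate x \<le> ereal \<alpha>}" "\<beta> \<in> {\<alpha><..}"
    then have "rate x < ereal \<beta>" by (auto intro: le_less_trans)
    then obtain y where y: "m \<le> y" "J (x / y) + K y < ereal \<beta>"
      unfolding rate_def by (auto simp: INF_less_iff)
    then show "x \<in> (\<lambda>(y, u). y * u) ` ?C \<beta>"
      using m_pos by (intro image_eqI[of _ _ "(y, x / y)"]) (auto simp: add.commute)
  next
    fix x assume x: "x \<in> (\<Inter>\<beta>\<in>{\<alpha><..}. (\<lambda>(y, u). y * u) ` ?C \<beta>)"
    have le: "rate x \<le> ereal \<beta>" if \<beta>: "\<alpha> < \<beta>" for \<beta>
    proof -
      have "x \<in> (\<lambda>(y, u). y * u) ` ?C \<beta>" using x \<beta> by blast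
      then obtain y u where "x = y * u" "m \<le> y" "K y + J u \<le> ereal \<beta>" by auto
      then show ?thesis using rate_le[of y x] m_pos by (simp add: add.commute)
    qed
    have "rate x \<le> ereal \<alpha>"
    proof (rule dense_ge)
      fix z assume z: "ereal \<alpha> < z"
      then show "rate x \<le> z" using le by (cases z) auto
    qed
    then show "x \<in> {x. rate x \<le> ereal \<alpha>}" by simp
  qed
  moreover have "compact ((\<lambda>(y, u). y * u) ` ?C \<beta>)" for \<beta>
    by (intro compact_continuous_image compact_sum_sublevel) (auto simp: case_prod_beta intro!: continuous_intros)
  ultimately show ?thesis by (auto intro!: compact_Inter)
qed

lemma good_rate: "good_rate_function rate"
  by (intro good_rate_functionI rate_nonneg compact_rate_sublevel)

text \<open>
  One-sided tail bounds of the two independent factors suffice for the deviations of the product.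
  Only the upper bound on the far right mixes the factors: there a deviation can be shared between
  them in many ways, and a finite grid of ways is enough.
\<close>

lemma product_MDP:
  fixes M :: "nat \<Rightarrow> 'a measure" and V B W :: "nat \<Rightarrow> 'a \<Rightarrow> real"
  assumes s: "filterlim s at_top sequentially" and s_pos: "\<And>n. n \<ge> 1 \<Longrightarrow> s n > 0"
    and prob: "\<And>n. n \<ge> 1 \<Longrightarrow> prob_space (M n)"
    and V_meas: "\<And>n. n \<ge> 1 \<Longrightarrow> V n \<in> borel_measurable (M n)"
    and B_meas: "\<And>n. n \<ge> 1 \<Longrightarrow> B n \<in> borel_measurable (M n)"
    and W_meas: "\<And>n. n \<ge> 1 \<Longrightarrow> W n \<in> borel_measurable (M n)"
    and W: "\<And>n \<omega>. n \<ge> 1 \<Longrightarrow> \<omega> \<in> space (M n) \<Longrightarrow> W n \<omega> = V n \<omega> * B n \<omega>"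
    and V_nonneg: "\<And>n \<omega>. 0 \<le> V n \<omega>" and B_nonneg: "\<And>n \<omega>. 0 \<le> B n \<omega>"
    and indep: "\<And>n A C. n \<ge> 1 \<Longrightarrow> A \<in> sets borel \<Longrightarrow> C \<in> sets borel \<Longrightarrow>
      \<P>(\<omega> in M n. V n \<omega> \<in> A \<and> B n \<omega> \<in> C) = \<P>(\<omega> in M n. V n \<omega> \<in> A) * \<P>(\<omega> in M n. B n \<omega> \<in> C)"
    and V_low: "\<And>v. v < m \<Longrightarrow> exp_upper s (\<lambda>n. \<P>(\<omega> in M n. V n \<omega> \<in> {..v})) \<infinity>"
    and V_up: "\<And>v. m < v \<Longrightarrow> exp_upper s (\<lambda>n. \<P>(\<omega> in M n. V n \<omega> \<in> {v..})) (K v)"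
    and V_at: "\<And>v e. m \<le> v \<Longrightarrow> 0 < e \<Longrightarrow> exp_lower s (\<lambda>n. \<P>(\<omega> in M n. V n \<omega> \<in> ball v e)) (K v)"
    and B_low: "\<And>u. u < 1 \<Longrightarrow> exp_upper s (\<lambda>n. \<P>(\<omega> in M n. B n \<omega> \<in> {..u})) (J u)"
    and B_up: "\<And>u. 1 < u \<Longrightarrow> exp_upper s (\<lambda>n. \<P>(\<omega> in M n. B n \<omega> \<in> {u..})) (J u)"
    and B_at: "\<And>u e. 0 < u \<Longrightarrow> 0 < e \<Longrightarrow> exp_lower s (\<lambda>n. \<P>(\<omega> in M n. B n \<omega> \<in> ball u e)) (J u)"
  shows "satisfies_MDP M W s rate"
proof -
  have n1: "\<forall>\<^sub>F n in sequentially. (1::nat) \<le> n" by (rule eventually_ge_at_top)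
  have meas [measurable]: "{\<omega> \<in> space (M n). V n \<omega> \<in> A \<and> B n \<omega> \<in> C} \<in> sets (M n)"
    "{\<omega> \<in> space (M n). V n \<omega> \<in> A} \<in> sets (M n)" "{\<omega> \<in> space (M n). B n \<omega> \<in> C} \<in> sets (M n)"
    "{\<omega> \<in> space (M n). W n \<omega> \<in> A} \<in> sets (M n)"
    if n: "n \<ge> 1" and [measurable]: "A \<in> sets borel" "C \<in> sets borel" for n A C
  proof -
    note [measurable] = V_meas[OF n] B_meas[OF n] W_meas[OF n]
    show "{\<omega> \<in> space (M n). V n \<omega> \<in> A \<and> B n \<omega> \<in> C} \<in> sets (M n)"
      "{\<omega> \<in> space (M n). V n \<omega> \<in> A} \<in> sets (M n)" "{\<omega> \<in> space (M n). B n \<omega> \<in> C} \<in> sets (M n)"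
      "{\<omega> \<in> space (M n). W n \<omega> \<in> A} \<in> sets (M n)" by measurable
  qed
  \<comment> \<open>Choose a nearly optimal splitting \<open>x = y * (x / y)\<close> and let both factors be close to it.\<close>
  have lower: "exp_lower s (\<lambda>n. \<P>(\<omega> in M n. W n \<omega> \<in> ball x e)) (rate x)" if "0 < e" for x e
    unfolding exp_lower_def
  proof (intro allI impI)
    fix c assume "rate x < ereal c"
    then obtain y where y: "m \<le> y" "J (x / y) + K y < ereal c"
      unfolding rate_def by (auto simp: INF_less_iff)
    have y0: "y > 0" using y m_pos by simp
    have x: "x / y > 0"
    proof (rule ccontr)
      assume "\<not> ?thesis"
      then have "J (x / y) = \<infinity>" by (intro J_nonpos) simp
      then show False using y(2) by simp
    qed
    have "isCont (\<lambda>p::real \<times> real. fst p * snd p) (y, x / y)" by (intro continuous_intros)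
    then have "\<exists>d>0. \<forall>p. dist p (y, x / y) < d \<longrightarrow> dist (fst p * snd p) (y * (x / y)) < e"
      unfolding continuous_at_eps_delta using \<open>0 < e\<close> by auto
    then obtain d where d: "d > 0" "\<And>p. dist p (y, x / y) < d \<Longrightarrow> dist (fst p * snd p) x < e"
      using y0 by auto
    have pd: "dist (v, b) (y, x / y) < d" if "dist v y < d / 2" "dist b (x / y) < d / 2" for v b
    proof -
      have "dist (v, b) (y, x / y) \<le> dist v y + dist b (x / y)"
        unfolding dist_Pair_Pair by (rule sqrt_sum_squares_le_sum) auto
      then show ?thesis using that by linarith
    qed
    have "exp_lower s (\<lambda>n. \<P>(\<omega> in M n. V n \<omega> \<in> ball y (d / 2)) * \<P>(\<omega> in M n. B n \<omega> \<in> ball (x / y) (d / 2)))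
      (K y + J (x / y))"
      using d(1) y x by (intro exp_lower_mult s V_at B_at K_nonneg J_nonneg) auto
    moreover have "\<forall>\<^sub>F n in sequentially.
      \<P>(\<omega> in M n. V n \<omega> \<in> ball y (d / 2)) * \<P>(\<omega> in M n. B n \<omega> \<in> ball (x / y) (d / 2))
      \<le> \<P>(\<omega> in M n. W n \<omega> \<in> ball x e)"
      using n1
    proof eventually_elim
      case (elim n)
      interpret prob_space "M n" by (rule prob[OF elim])
      note [measurable] = V_meas[OF elim] B_meas[OF elim] W_meas[OF elim]
      have "\<P>(\<omega> in M n. V n \<omega> \<in> ball y (d / 2) \<and> B n \<omega> \<in> ball (x / y) (d / 2))
        \<le> \<P>(\<omega> in M n. W n \<omega> \<in> ball x e)"
      proof (intro finite_measure_mono subsetI)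
        fix \<omega> assume *: "\<omega> \<in> {\<omega> \<in> space (M n). V n \<omega> \<in> ball y (d / 2) \<and> B n \<omega> \<in> ball (x / y) (d / 2)}"
        then have "dist (V n \<omega> * B n \<omega>) x < e"
          using d(2)[of "(V n \<omega>, B n \<omega>)"] pd[of "V n \<omega>" "B n \<omega>"] by (auto simp: dist_commute)
        then show "\<omega> \<in> {\<omega> \<in> space (M n). W n \<omega> \<in> ball x e}"
          using * W[OF elim, of \<omega>] by (auto simp: dist_commute)
      qed (use meas(4)[OF elim, of "ball x e"] in simp)
      then show ?case using indep[OF elim, of "ball y (d / 2)" "ball (x / y) (d / 2)"] by simp
    qed
    ultimately have "exp_lower s (\<lambda>n. \<P>(\<omega> in M n. W n \<omega> \<in> ball x e)) (K y + J (x / y))"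
      by (rule exp_lower_mono) simp
    then show "\<forall>\<^sub>F n in sequentially. exp (- (c * s n)) \<le> \<P>(\<omega> in M n. W n \<omega> \<in> ball x e)"
      using y(2) by (intro exp_lowerD[of s _ "K y + J (x / y)"]) (auto simp: add.commute)
  qed

  \<comment> \<open>Below \<open>m\<close> the factor \<open>V\<close> cannot help: either \<open>V \<le> v\<close> with \<open>v < m\<close>, which is infinitely
    expensive, or \<open>B \<le> a / v\<close>, where \<open>v\<close> is close enough to \<open>m\<close> for lower semicontinuity of \<open>J\<close>.\<close>
  have left: "exp_upper s (\<lambda>n. \<P>(\<omega> in M n. W n \<omega> \<in> {..a})) (rate a)" if a: "a < m" for a
    unfolding exp_upper_def
  proof (intro allI impI)
    fix c assume "ereal c < rate a"
    \<comment> \<open>The rate \<open>J\<close> is infinite up to \<open>0\<close>, so nothing is lost by raising a negative level to \<open>0\<close>.\<close>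
    define a' where "a' = max a 0"
    have a': "a \<le> a'" "0 \<le> a'" "a' < m" using a m_pos by (auto simp: a'_def)
    have "ereal c < J (a / m)" using \<open>ereal c < rate a\<close> rate_le_J[of a] by (rule less_le_trans)
    also have "J (a / m) \<le> J (a' / m)"
      using J_nonpos[of "a' / m"] m_pos by (auto simp: a'_def max_def)
    finally have "ereal c < J (a' / m)" .
    then obtain \<delta> where \<delta>: "0 < \<delta>" "\<And>z. \<bar>z - a' / m\<bar> < \<delta> \<Longrightarrow> ereal c < J z"
      using sublevel_nbhd[OF compact_imp_closed[OF J_compact]] by blast
    have "((\<lambda>v. a' / v) \<longlongrightarrow> a' / m) (at_left m)"
      using m_pos by (auto intro!: tendsto_intros)
    then have "\<forall>\<^sub>F v in at_left m. dist (a' / v) (a' / m) < min \<delta> (1 - a' / m)"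
      using \<delta>(1) a' m_pos by (intro tendstoD) auto
    moreover have "\<forall>\<^sub>F v in at_left m. v \<in> {0<..<m}"
      by (intro eventually_at_leftI[of 0]) (use m_pos in auto)
    ultimately have "\<forall>\<^sub>F v in at_left m. dist (a' / v) (a' / m) < min \<delta> (1 - a' / m) \<and> v \<in> {0<..<m}"
      by (rule eventually_conj)
    then obtain v where v: "dist (a' / v) (a' / m) < min \<delta> (1 - a' / m)" "0 < v" "v < m"
      using eventually_happens by fastforce
    have u1: "a' / v < 1" using v(1) by (auto simp: dist_real_def)
    have c: "ereal c < J (a' / v)" using \<delta>(2)[of "a' / v"] v(1) by (auto simp: dist_real_def)
    have "exp_upper s (\<lambda>n. \<P>(\<omega> in M n. V n \<omega> \<in> {..v}) + \<P>(\<omega> in M n. B n \<omega> \<in> {..a' / v})) (J (a' / v))"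
      by (intro exp_upper_add s B_low u1 exp_upper_mono[OF V_low[OF v(3)]]) auto
    moreover have "\<forall>\<^sub>F n in sequentially. \<P>(\<omega> in M n. W n \<omega> \<in> {..a})
        \<le> \<P>(\<omega> in M n. V n \<omega> \<in> {..v}) + \<P>(\<omega> in M n. B n \<omega> \<in> {..a' / v})"
      using n1
    proof eventually_elim
      case (elim n)
      interpret prob_space "M n" by (rule prob[OF elim])
      note [measurable] = V_meas[OF elim] B_meas[OF elim] W_meas[OF elim]
      have "\<P>(\<omega> in M n. W n \<omega> \<in> {..a}) \<le>
        prob ({\<omega> \<in> space (M n). V n \<omega> \<in> {..v}} \<union> {\<omega> \<in> space (M n). B n \<omega> \<in> {..a' / v}})"
      proof (intro finite_measure_mono subsetI)
        fix \<omega> assume *: "\<omega> \<in> {\<omega> \<in> space (M n). W n \<omega> \<in> {..a}}"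
        then have le: "V n \<omega> * B n \<omega> \<le> a'" using W[OF elim, of \<omega>] a' by auto
        have "B n \<omega> \<le> a' / v" if "v < V n \<omega>"
        proof -
          have "v * B n \<omega> \<le> V n \<omega> * B n \<omega>" using that B_nonneg by (intro mult_right_mono) auto
          then show ?thesis using le v by (simp add: field_simps)
        qed
        then show "\<omega> \<in> {\<omega> \<in> space (M n). V n \<omega> \<in> {..v}} \<union> {\<omega> \<in> space (M n). B n \<omega> \<in> {..a' / v}}"
          using * by force
      qed measurable
      also have "\<dots> \<le> \<P>(\<omega> in M n. V n \<omega> \<in> {..v}) + \<P>(\<omega> in M n. B n \<omega> \<in> {..a' / v})"
        by (intro measure_Un_le) measurable
      finally show ?case .
    qed
    ultimately have "exp_upper s (\<lambda>n. \<P>(\<omega> in M n. W n \<omega> \<in> {..a})) (J (a' / v))"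
      by (rule exp_upper_mono) simp
    from exp_upperD[OF this c] show "\<forall>\<^sub>F n in sequentially. \<P>(\<omega> in M n. W n \<omega> \<in> {..a}) \<le> exp (- (c * s n))" .
  qed

  \<comment> \<open>On a cell \<open>v i \<le> V < q * v i\<close> of a geometric grid, \<open>b \<le> V * B\<close> forces \<open>B \<ge> b' / v i\<close> with
    \<open>b' = b / q\<close>. The grid is finite because beyond \<open>b\<close> the factor \<open>V\<close> alone pays for the deviation,
    and replacing \<open>b\<close> by \<open>b'\<close> is harmless by lower semicontinuity of the rate.\<close>
  have right: "exp_upper s (\<lambda>n. \<P>(\<omega> in M n. W n \<omega> \<in> {b..})) (rate b)" if b: "m < b" for b
    unfolding exp_upper_def
  proof (intro allI impI)
    fix c assume c: "ereal c < rate b"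
    obtain \<delta> where \<delta>: "0 < \<delta>" "\<And>z. \<bar>z - b\<bar> < \<delta> \<Longrightarrow> ereal c < rate z"
      using sublevel_nbhd[OF compact_imp_closed[OF compact_rate_sublevel] c] by blast
    have b0: "b > 0" using b m_pos by simp
    define b' where "b' = b - min (\<delta> / 2) ((b - m) / 2)"
    have b': "m < b'" "b' < b" "\<bar>b' - b\<bar> < \<delta>" using b \<delta>(1) unfolding b'_def by (simp_all add: min_less_iff_disj min_def field_simps)
    have b'0: "b' > 0" using b' m_pos by simp
    define q where "q = b / b'"
    have q: "q > 1" using b' b'0 by (simp add: q_def)
    define v where "v i = m * q ^ i" for i
    have v: "m \<le> v i" "v i > 0" for i using m_pos q by (auto simp: v_def)
    obtain N where "b / m < q ^ N" using real_arch_pow[OF q] by blast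
    then have N: "b < v N" using m_pos by (simp add: v_def field_simps)
    have vm: "v i < v (Suc i)" for i using m_pos q by (simp add: v_def)
    have r: "rate b' \<le> K (v N)"
      using rate_le_K[of b'] K_mono[of b' "v N"] b' N by (auto intro: order_trans)
    \<comment> \<open>In the lowest cell the condition on \<open>V\<close> is dropped: since \<open>K\<close> vanishes at \<open>m\<close>, it would
      contribute nothing.\<close>
    have cell: "exp_upper s (\<lambda>n. \<P>(\<omega> in M n. (if i = 0 then True else V n \<omega> \<in> {v i..}) \<and> B n \<omega> \<in> {b' / v i..})) (rate b')" for i
    proof (cases "i = 0")
      case True
      have "1 < b' / m" using b' m_pos by simp
      from B_up[OF this] show ?thesis using True rate_le_J[of b'] by (simp add: v_def exp_upper_mono)
    next
      case False
      then have "v i > m" using q m_pos by (simp add: v_def one_less_power)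
      show ?thesis
      proof (cases "b' / v i > 1")
        case True
        have "exp_upper s (\<lambda>n. \<P>(\<omega> in M n. V n \<omega> \<in> {v i..}) * \<P>(\<omega> in M n. B n \<omega> \<in> {b' / v i..})) (K (v i) + J (b' / v i))"
          by (intro exp_upper_mult s V_up B_up True K_nonneg J_nonneg \<open>v i > m\<close>) auto
        moreover have "\<forall>\<^sub>F n in sequentially.
           \<P>(\<omega> in M n. (if i = 0 then True else V n \<omega> \<in> {v i..}) \<and> B n \<omega> \<in> {b' / v i..})
           \<le> \<P>(\<omega> in M n. V n \<omega> \<in> {v i..}) * \<P>(\<omega> in M n. B n \<omega> \<in> {b' / v i..})"
          using n1
        proof eventually_elim
          case (elim n)
          show ?case using False indep[OF elim, of "{v i..}" "{b' / v i..}"] by simp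
        qed
        ultimately show ?thesis
          by (rule exp_upper_mono) (use rate_le[OF v(1)[of i], of b'] in \<open>simp add: add.commute\<close>)
      next
        case le: False
        \<comment> \<open>Here the condition on \<open>B\<close> is void, but \<open>V\<close> alone already costs enough.\<close>
        then have "b' \<le> v i" using v(2)[of i] by (simp add: field_simps)
        then have rk: "rate b' \<le> K (v i)" using rate_le_K[of b'] K_mono[of b' "v i"] b' by (auto intro: order_trans)
        have "\<forall>\<^sub>F n in sequentially.
           \<P>(\<omega> in M n. (if i = 0 then True else V n \<omega> \<in> {v i..}) \<and> B n \<omega> \<in> {b' / v i..})
           \<le> \<P>(\<omega> in M n. V n \<omega> \<in> {v i..})"
          using n1
        proof eventually_elim
          case (elim n)
          interpret prob_space "M n" by (rule prob[OF elim])
          note [measurable] = V_meas[OF elim] B_meas[OF elim] W_meas[OF elim]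
          show ?case using False by (intro finite_measure_mono) (force, measurable)
        qed
        from exp_upper_mono[OF V_up[OF \<open>v i > m\<close>] this rk] show ?thesis .
      qed
    qed
    have top: "exp_upper s (\<lambda>n. \<P>(\<omega> in M n. V n \<omega> \<in> {v N..})) (rate b')"
      by (rule exp_upper_mono[OF V_up _ r]) (use N b in auto)
    let ?D = "\<lambda>n i. {\<omega> \<in> space (M n). (if i = 0 then True else V n \<omega> \<in> {v i..}) \<and> B n \<omega> \<in> {b' / v i..}}"
    have cover: "\<omega> \<in> (\<Union>i<Suc k. ?D n i) \<union> {\<omega> \<in> space (M n). V n \<omega> \<in> {v k..}}"
      if "1 \<le> n" "\<omega> \<in> space (M n)" "W n \<omega> \<in> {b..}" for n k \<omega>
    proof -
      have ge: "b \<le> V n \<omega> * B n \<omega>" using that W[OF that(1,2)] by simp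
      have cell: "b' / v j \<le> B n \<omega>" if "V n \<omega> < q * v j" for j
      proof -
        have "b \<le> (q * v j) * B n \<omega>" using ge mult_right_mono[of "V n \<omega>" "q * v j" "B n \<omega>"] that B_nonneg[of n \<omega>]
          by linarith
        then have "q * b' \<le> q * (v j * B n \<omega>)" using b'0 by (simp add: q_def)
        then have "b' \<le> v j * B n \<omega>" using q by simp
        then show ?thesis using v(2)[of j] by (simp add: field_simps)
      qed
      show ?thesis
      proof (induction k)
        case 0
        have "V n \<omega> < q * v 0" if "V n \<omega> < v 0" using that q m_pos v(2)[of 0]
          by (auto intro: less_trans simp: v_def)
        then show ?case using cell[of 0] that by force
      next
        case (Suc k)
        show ?case
        proof (cases "\<omega> \<in> (\<Union>i<Suc k. ?D n i)")
          case True
          moreover have "(\<Union>i<Suc k. ?D n i) \<subseteq> (\<Union>i<Suc (Suc k). ?D n i)"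
            by (intro UN_mono) auto
          ultimately show ?thesis by blast
        next
          case False
          then have vk: "V n \<omega> \<ge> v k" using Suc by auto
          have "V n \<omega> \<ge> v (Suc k)"
          proof (rule ccontr)
            assume "\<not> ?thesis"
            then have "b' / v k \<le> B n \<omega>" by (intro cell) (simp add: v_def algebra_simps)
            then have "\<omega> \<in> ?D n k" using vk that by simp
            then show False using False by blast
          qed
          then show ?thesis using that by simp
        qed
      qed
    qed
    have "exp_upper s (\<lambda>n. (\<Sum>i<Suc N. measure (M n) (?D n i)) + \<P>(\<omega> in M n. V n \<omega> \<in> {v N..})) (rate b')"
      by (intro exp_upper_add s top exp_upper_sum cell) auto
    moreover have "\<forall>\<^sub>F n in sequentially. \<P>(\<omega> in M n. W n \<omega> \<in> {b..})
      \<le> (\<Sum>i<Suc N. measure (M n) (?D n i)) + \<P>(\<omega> in M n. V n \<omega> \<in> {v N..})"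
      using n1
    proof eventually_elim
      case (elim n)
      interpret prob_space "M n" by (rule prob[OF elim])
      note [measurable] = V_meas[OF elim] B_meas[OF elim] W_meas[OF elim]
      have D: "?D n i \<in> sets (M n)" for i by measurable
      have "\<P>(\<omega> in M n. W n \<omega> \<in> {b..}) \<le> prob ((\<Union>i<Suc N. ?D n i) \<union> {\<omega> \<in> space (M n). V n \<omega> \<in> {v N..}})"
        using cover[OF elim] D by (intro finite_measure_mono sets.Un sets.finite_UN) (blast, auto, measurable)
      also have "\<dots> \<le> prob (\<Union>i<Suc N. ?D n i) + \<P>(\<omega> in M n. V n \<omega> \<in> {v N..})"
        using D by (intro measure_Un_le sets.finite_UN) (auto, measurable)
      also have "prob (\<Union>i<Suc N. ?D n i) \<le> (\<Sum>i<Suc N. prob (?D n i))"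
        using D by (intro measure_UNION_le) auto
      finally show ?case by simp
    qed
    ultimately have "exp_upper s (\<lambda>n. \<P>(\<omega> in M n. W n \<omega> \<in> {b..})) (rate b')"
      by (rule exp_upper_mono) simp
    from exp_upperD[OF this \<delta>(2)[OF b'(3)]]
    show "\<forall>\<^sub>F n in sequentially. \<P>(\<omega> in M n. W n \<omega> \<in> {b..}) \<le> exp (- (c * s n))" .
  qed

  \<comment> \<open>Unless the minimizer \<open>m\<close> lies in \<open>F\<close>, the set is covered by two half-lines that start at the
    points \<open>a\<close> and \<open>b\<close> of \<open>F\<close> nearest to \<open>m\<close>.\<close>
  have upper: "exp_upper s (\<lambda>n. \<P>(\<omega> in M n. W n \<omega> \<in> F)) (INF x\<in>F. rate x)" if F: "closed F" for F
  proof (cases "m \<in> F")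
    case True
    then have "(INF x\<in>F. rate x) \<le> 0" using rate_m by (metis INF_lower)
    moreover have "\<forall>\<^sub>F n in sequentially. \<P>(\<omega> in M n. W n \<omega> \<in> F) \<le> 1"
      using n1 by eventually_elim (auto intro: prob_space.prob_le_1[OF prob])
    ultimately show ?thesis by (intro exp_upper_nonpos s)
  next
    case False
    have "\<exists>a<m. F \<inter> {..m} \<subseteq> {..a} \<and> (INF x\<in>F. rate x) \<le> rate a \<or> F \<inter> {..m} = {}"
    proof (cases "F \<inter> {..m} = {}")
      case True then show ?thesis by (auto intro: exI[of _ "m - 1"])
    next
      case ne: False
      have "bdd_above (F \<inter> {..m})" by (auto intro: bdd_aboveI[of _ m])
      moreover from this ne have "Sup (F \<inter> {..m}) \<in> F \<inter> {..m}"
        by (intro closed_contains_Sup closed_Int F) auto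
      ultimately show ?thesis using False
        by (intro exI[of _ "Sup (F \<inter> {..m})"]) (auto intro!: cSup_upper INF_lower simp: less_le)
    qed
    then obtain a where a: "a < m" "F \<inter> {..m} \<subseteq> {..a} \<and> (INF x\<in>F. rate x) \<le> rate a \<or> F \<inter> {..m} = {}" by blast
    have "\<exists>b>m. F \<inter> {m..} \<subseteq> {b..} \<and> (INF x\<in>F. rate x) \<le> rate b \<or> F \<inter> {m..} = {}"
    proof (cases "F \<inter> {m..} = {}")
      case True then show ?thesis by (auto intro: exI[of _ "m + 1"])
    next
      case ne: False
      have "bdd_below (F \<inter> {m..})" by (auto intro: bdd_belowI[of _ m])
      moreover from this ne have "Inf (F \<inter> {m..}) \<in> F \<inter> {m..}"
        by (intro closed_contains_Inf closed_Int F) auto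
      ultimately show ?thesis using False
        by (intro exI[of _ "Inf (F \<inter> {m..})"]) (auto intro!: cInf_lower INF_lower simp: less_le)
    qed
    then obtain b where b: "b > m" "F \<inter> {m..} \<subseteq> {b..} \<and> (INF x\<in>F. rate x) \<le> rate b \<or> F \<inter> {m..} = {}" by blast
    have Fb: "F \<in> sets borel" using F by simp
    have half: "exp_upper s (\<lambda>n. \<P>(\<omega> in M n. W n \<omega> \<in> F \<inter> A)) (INF x\<in>F. rate x)"
      if "F \<inter> A \<subseteq> A' \<and> (INF x\<in>F. rate x) \<le> rate z \<or> F \<inter> A = {}" "A' \<in> sets borel"
        "exp_upper s (\<lambda>n. \<P>(\<omega> in M n. W n \<omega> \<in> A')) (rate z)" for A A' z
    proof (cases "F \<inter> A = {}")
      case True then show ?thesis by (auto simp: exp_upper_def)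
    next
      case False
      show ?thesis
      proof (rule exp_upper_mono[OF that(3)])
        show "\<forall>\<^sub>F n in sequentially. \<P>(\<omega> in M n. W n \<omega> \<in> F \<inter> A) \<le> \<P>(\<omega> in M n. W n \<omega> \<in> A')"
          using n1
        proof eventually_elim
          case (elim n)
          interpret prob_space "M n" by (rule prob[OF elim])
          note [measurable] = V_meas[OF elim] B_meas[OF elim] W_meas[OF elim]
          show ?case using that False by (intro finite_measure_mono) auto
        qed
      qed (use that False in auto)
    qed
    have "exp_upper s (\<lambda>n. \<P>(\<omega> in M n. W n \<omega> \<in> F \<inter> {..m}) + \<P>(\<omega> in M n. W n \<omega> \<in> F \<inter> {m..})) (INF x\<in>F. rate x)"
      using half[OF a(2) _ left[OF a(1)]] half[OF b(2) _ right[OF b(1)]] by (intro exp_upper_add s) auto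
    then show ?thesis
    proof (rule exp_upper_mono)
      show "\<forall>\<^sub>F n in sequentially. \<P>(\<omega> in M n. W n \<omega> \<in> F) \<le> \<P>(\<omega> in M n. W n \<omega> \<in> F \<inter> {..m}) + \<P>(\<omega> in M n. W n \<omega> \<in> F \<inter> {m..})"
        using n1
      proof eventually_elim
        case (elim n)
        interpret prob_space "M n" by (rule prob[OF elim])
        note [measurable] = V_meas[OF elim] B_meas[OF elim] W_meas[OF elim]
        have "\<P>(\<omega> in M n. W n \<omega> \<in> F) \<le> prob ({\<omega> \<in> space (M n). W n \<omega> \<in> F \<inter> {..m}} \<union> {\<omega> \<in> space (M n). W n \<omega> \<in> F \<inter> {m..}})"
          using elim Fb by (intro finite_measure_mono sets.Un meas) auto
        also have "\<dots> \<le> \<P>(\<omega> in M n. W n \<omega> \<in> F \<inter> {..m}) + \<P>(\<omega> in M n. W n \<omega> \<in> F \<inter> {m..})"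
          using elim Fb by (intro measure_Un_le meas) auto
        finally show ?case .
      qed
    qed simp
  qed
  show ?thesis
    by (intro satisfies_MDP_I s_pos prob W_meas good_rate upper lower)
qed

end

section \<open>The p-Gaussian density\<close>

lemma nn_integral_even:
  fixes f :: "real \<Rightarrow> real"
  assumes [measurable]: "f \<in> borel_measurable borel" and even: "\<And>t. f (- t) = f t"
  shows "(\<integral>\<^sup>+t. ennreal (f t) \<partial>lborel) = 2 * (\<integral>\<^sup>+t. ennreal (f t) * indicator {0<..} t \<partial>lborel)"
proof -
  have "AE t in lborel. t \<noteq> (0::real)" by (rule AE_lborel_singleton)
  then have "(\<integral>\<^sup>+t. ennreal (f t) \<partial>lborel)
    = (\<integral>\<^sup>+t. ennreal (f t) * indicator {0<..} t + ennreal (f t) * indicator {..<0} t \<partial>lborel)"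
    by (intro nn_integral_cong_AE, eventually_elim) (auto simp: indicator_def)
  also have "\<dots> = (\<integral>\<^sup>+t. ennreal (f t) * indicator {0<..} t \<partial>lborel) + (\<integral>\<^sup>+t. ennreal (f t) * indicator {..<0} t \<partial>lborel)"
    by (rule nn_integral_add) measurable
  also have "(\<integral>\<^sup>+t. ennreal (f t) * indicator {..<0} t \<partial>lborel) = (\<integral>\<^sup>+t. ennreal (f t) * indicator {0<..} t \<partial>lborel)"
    by (subst nn_integral_real_affine[of _ "- 1" 0]) (auto simp: even intro!: nn_integral_cong split: split_indicator)
  finally show ?thesis by (simp add: mult_2)
qed

text \<open>
  Substitute \<open>u = s t^p\<close> in Euler's integral.
\<close>

lemma nn_integral_gamma_powr:
  fixes a p s :: real
  assumes p: "0 < p" and s: "0 < s" and a: "0 \<le> a"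
  shows "(\<integral>\<^sup>+t. ennreal (t powr a * exp (- (s * t powr p))) * indicator {0<..} t \<partial>lborel)
    = ennreal (1 / p * s powr (- ((a + 1) / p)) * Gamma ((a + 1) / p))"
proof -
  define x where "x = (a + 1) / p"
  have x: "0 < x" using a p by (simp add: x_def)
  have px: "p * x = a + 1" using p by (simp add: x_def)
  let ?f = "\<lambda>t. t powr (x - 1) / exp t"
  let ?g = "\<lambda>t. s * t powr p" and ?h = "\<lambda>t. s * (p * t powr (p - 1))"
  have "(?f has_integral Gamma x) {0..}" by (rule Gamma_integral_real[OF x])
  then have f: "(?f has_integral Gamma x) {0<..}"
    by (subst has_integral_spike_set_eq[where T = "{0..}"]) (auto intro: negligible_subset[of "{0}"])
  then have fa: "?f absolutely_integrable_on {0<..}"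
    by (intro nonnegative_absolutely_integrable_1) (auto simp: has_integral_integrable_integral)
  have img: "?g ` {0<..} = {0<..}"
  proof (intro subset_antisym subsetI)
    fix u :: real assume "u \<in> {0<..}"
    then show "u \<in> ?g ` {0<..}" using p s
      by (intro image_eqI[of _ _ "(u / s) powr (1 / p)"]) (auto simp: powr_powr)
  qed (use s in auto)
  have inj: "inj_on ?g {0<..}"
  proof (rule inj_onI)
    fix y z :: real assume "y \<in> {0<..}" "z \<in> {0<..}" "?g y = ?g z"
    then have "y powr p = z powr p" using s by simp
    then have "(y powr p) powr (1 / p) = (z powr p) powr (1 / p)" by simp
    then show "y = z" using \<open>y \<in> {0<..}\<close> \<open>z \<in> {0<..}\<close> p by (simp add: powr_powr)
  qed
  have "((\<lambda>t. \<bar>?h t\<bar> * ?f (?g t)) absolutely_integrable_on {0<..} \<and> integral {0<..} (\<lambda>t. \<bar>?h t\<bar> * ?f (?g t)) = Gamma x)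
    \<longleftrightarrow> (?f absolutely_integrable_on ?g ` {0<..} \<and> integral (?g ` {0<..}) ?f = Gamma x)"
    by (rule has_absolute_integral_change_of_variables_1'[OF _ _ inj])
      (auto intro!: derivative_eq_intros)
  then have "((\<lambda>t. \<bar>?h t\<bar> * ?f (?g t)) has_integral Gamma x) {0<..}"
    using f fa unfolding img by (auto simp: absolutely_integrable_on_def has_integral_iff)
  then have "((\<lambda>t. p * s powr x * (t powr a * exp (- (s * t powr p)))) has_integral Gamma x) {0<..}"
  proof (rule has_integral_eq[rotated])
    fix t :: real assume "t \<in> {0<..}"
    then have t: "0 < t" by simp
    have "\<bar>?h t\<bar> * ?f (?g t) = p * (s * s powr (x - 1)) * (t powr (p - 1) * t powr (p * (x - 1))) * exp (- (s * t powr p))"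
      using t p s by (simp add: powr_mult powr_powr exp_minus field_simps)
    also have "s * s powr (x - 1) = s powr x" using s powr_add[of s 1 "x - 1"] by simp
    also have "t powr (p - 1) * t powr (p * (x - 1)) = t powr a"
      using px by (simp add: powr_add[symmetric] algebra_simps)
    finally show "\<bar>?h t\<bar> * ?f (?g t) = p * s powr x * (t powr a * exp (- (s * t powr p)))" by simp
  qed
  from has_integral_mult_right[OF this, of "1 / (p * s powr x)"]
  have "((\<lambda>t. t powr a * exp (- (s * t powr p))) has_integral 1 / (p * s powr x) * Gamma x) {0<..}"
    using p s by simp
  from nn_integral_has_integral_lebesgue'[OF _ this]
  have "(\<integral>\<^sup>+t. ennreal (t powr a * exp (- (s * t powr p))) * indicator {0<..} t \<partial>lborel) = ennreal (1 / (p * s powr x) * Gamma x)"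
    by simp
  also have "1 / (p * s powr x) * Gamma x = 1 / p * s powr (- x) * Gamma x"
    by (simp add: powr_minus field_simps)
  finally show ?thesis by (simp add: x_def)
qed

text \<open>
  The integral of \<open>\<bar>t\<bar>^a exp (- s \<bar>t\<bar>^p)\<close> over the real line.
\<close>

definition gen_gamma :: "real \<Rightarrow> real \<Rightarrow> real \<Rightarrow> real"
  where "gen_gamma p a s = 2 / p * s powr (- ((a + 1) / p)) * Gamma ((a + 1) / p)"

lemma gen_gamma_pos: "0 < p \<Longrightarrow> 0 < s \<Longrightarrow> 0 \<le> a \<Longrightarrow> 0 < gen_gamma p a s"
  by (auto simp: gen_gamma_def intro!: mult_pos_pos divide_pos_pos Gamma_real_pos)

lemma nn_integral_gen_gamma:
  fixes a p s :: real
  assumes "0 < p" "0 < s" "0 \<le> a"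
  shows "(\<integral>\<^sup>+t. ennreal (\<bar>t\<bar> powr a * exp (- (s * \<bar>t\<bar> powr p))) \<partial>lborel) = ennreal (gen_gamma p a s)"
proof -
  have "(\<integral>\<^sup>+t. ennreal (\<bar>t\<bar> powr a * exp (- (s * \<bar>t\<bar> powr p))) \<partial>lborel)
    = 2 * (\<integral>\<^sup>+t. ennreal (\<bar>t\<bar> powr a * exp (- (s * \<bar>t\<bar> powr p))) * indicator {0<..} t \<partial>lborel)"
    by (rule nn_integral_even) auto
  also have "(\<integral>\<^sup>+t. ennreal (\<bar>t\<bar> powr a * exp (- (s * \<bar>t\<bar> powr p))) * indicator {0<..} t \<partial>lborel)
    = (\<integral>\<^sup>+t. ennreal (t powr a * exp (- (s * t powr p))) * indicator {0<..} t \<partial>lborel)"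
    by (intro nn_integral_cong) (auto simp: indicator_def)
  also have "2 * \<dots> = ennreal (gen_gamma p a s)"
  proof -
    have "0 \<le> 1 / p * s powr (- ((a + 1) / p)) * Gamma ((a + 1) / p)"
      using assms by (auto intro!: mult_nonneg_nonneg less_imp_le[OF Gamma_real_pos] divide_nonneg_pos)
    then have "2 * ennreal (1 / p * s powr (- ((a + 1) / p)) * Gamma ((a + 1) / p))
      = ennreal (2 * (1 / p * s powr (- ((a + 1) / p)) * Gamma ((a + 1) / p)))"
      by (subst ennreal_mult) auto
    moreover have "2 * (1 / p * s powr (- ((a + 1) / p)) * Gamma ((a + 1) / p)) = gen_gamma p a s"
      by (simp add: gen_gamma_def)
    ultimately show ?thesis by (simp only: nn_integral_gamma_powr[OF assms])
  qed
  finally show ?thesis .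
qed

text \<open>
  The \<open>p\<close>-Gaussian density. With the factor \<open>1 / p\<close> in the exponent, \<open>\<bar>Y\<bar>^p\<close> has mean \<open>1\<close>, and so
  \<open>n\<close> independent copies have \<open>p\<close>-norm about \<open>n^(1/p)\<close>.
\<close>

definition pgauss :: "real \<Rightarrow> real \<Rightarrow> real"
  where "pgauss p t = exp (- (1 / p * \<bar>t\<bar> powr p)) / gen_gamma p 0 (1 / p)"

lemma pgauss_measurable [measurable]: "pgauss p \<in> borel_measurable borel"
  unfolding pgauss_def[abs_def] by measurable

lemma pgauss_nonneg: "0 < p \<Longrightarrow> 0 \<le> pgauss p t"
  using gen_gamma_pos[of p "1 / p" 0] by (simp add: pgauss_def)

lemma nn_integral_pgauss:
  assumes p: "0 < p" and s: "0 < s" and a: "0 \<le> a"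
  shows "(\<integral>\<^sup>+t. ennreal (pgauss p t * (\<bar>t\<bar> powr a * exp ((1 / p - s) * \<bar>t\<bar> powr p))) \<partial>lborel)
    = ennreal (gen_gamma p a s / gen_gamma p 0 (1 / p))"
proof -
  have Z: "0 < gen_gamma p 0 (1 / p)" using p by (intro gen_gamma_pos) auto
  have "(\<integral>\<^sup>+t. ennreal (pgauss p t * (\<bar>t\<bar> powr a * exp ((1 / p - s) * \<bar>t\<bar> powr p))) \<partial>lborel)
    = (\<integral>\<^sup>+t. ennreal (1 / gen_gamma p 0 (1 / p)) * ennreal (\<bar>t\<bar> powr a * exp (- (s * \<bar>t\<bar> powr p))) \<partial>lborel)"
  proof (intro nn_integral_cong)
    fix t :: real
    have "exp (- (1 / p * \<bar>t\<bar> powr p)) * exp ((1 / p - s) * \<bar>t\<bar> powr p) = exp (- (s * \<bar>t\<bar> powr p))"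
      by (simp flip: exp_add add: algebra_simps)
    then have "pgauss p t * (\<bar>t\<bar> powr a * exp ((1 / p - s) * \<bar>t\<bar> powr p))
      = 1 / gen_gamma p 0 (1 / p) * (\<bar>t\<bar> powr a * exp (- (s * \<bar>t\<bar> powr p)))"
      by (simp add: pgauss_def field_simps)
    then show "ennreal (pgauss p t * (\<bar>t\<bar> powr a * exp ((1 / p - s) * \<bar>t\<bar> powr p)))
      = ennreal (1 / gen_gamma p 0 (1 / p)) * ennreal (\<bar>t\<bar> powr a * exp (- (s * \<bar>t\<bar> powr p)))"
      using Z by (simp flip: ennreal_mult)
  qed
  also have "\<dots> = ennreal (1 / gen_gamma p 0 (1 / p)) * ennreal (gen_gamma p a s)"
    by (subst nn_integral_cmult) (simp_all add: nn_integral_gen_gamma[OF assms])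
  also have "\<dots> = ennreal (gen_gamma p a s / gen_gamma p 0 (1 / p))"
    using Z by (simp flip: ennreal_mult')
  finally show ?thesis .
qed

lemma nn_integral_pgauss_1:
  assumes "0 < p" shows "(\<integral>\<^sup>+t. ennreal (pgauss p t) \<partial>lborel) = 1"
proof -
  have "(\<integral>\<^sup>+t. ennreal (pgauss p t) \<partial>lborel) = (\<integral>\<^sup>+t. ennreal (pgauss p t * (\<bar>t\<bar> powr 0 * exp ((1 / p - 1 / p) * \<bar>t\<bar> powr p))) \<partial>lborel)"
    using AE_lborel_singleton[of "0::real"] by (intro nn_integral_cong_AE, eventually_elim) simp
  also have "\<dots> = 1"
    using nn_integral_pgauss[of p "1 / p" 0] gen_gamma_pos[of p "1 / p" 0] assms by simp
  finally show ?thesis .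
qed

lemma abs_powr_2: "\<bar>x\<bar> powr 2 = (x::real)\<^sup>2"
  by (cases "x = 0") simp_all

lemma square_powr_half: "(t\<^sup>2) powr (a / 2) = \<bar>t\<bar> powr a" for t a :: real
proof -
  have "(t\<^sup>2) powr (a / 2) = (\<bar>t\<bar> powr 2) powr (a / 2)" by (simp only: abs_powr_2)
  then show ?thesis by (simp only: powr_powr) simp
qed

text \<open>
  This is where the constant \<open>Mp2 p\<close> comes from: it is the second moment of the \<open>p\<close>-Gaussian law.
\<close>

lemma nn_integral_pgauss_sq:
  assumes p: "0 < p" shows "(\<integral>\<^sup>+t. ennreal (pgauss p t * t\<^sup>2) \<partial>lborel) = ennreal (Mp2 p)"
proof -
  have "(\<integral>\<^sup>+t. ennreal (pgauss p t * t\<^sup>2) \<partial>lborel) = (\<integral>\<^sup>+t. ennreal (pgauss p t * (\<bar>t\<bar> powr 2 * exp ((1 / p - 1 / p) * \<bar>t\<bar> powr p))) \<partial>lborel)"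
    by (simp add: abs_powr_2)
  also have "\<dots> = ennreal (gen_gamma p 2 (1 / p) / gen_gamma p 0 (1 / p))"
    using p by (intro nn_integral_pgauss) auto
  also have "gen_gamma p 2 (1 / p) / gen_gamma p 0 (1 / p) = Mp2 p"
  proof -
    have "3 / p \<notin> \<int>\<^sub>\<le>\<^sub>0" "1 / p \<notin> \<int>\<^sub>\<le>\<^sub>0"
      using p nonpos_Ints_nonpos[of "3 / p"] nonpos_Ints_nonpos[of "1 / p"] by (auto simp: field_simps)
    then have G: "Gamma (1 + 3 / p) = 3 / p * Gamma (3 / p)" "Gamma (1 + 1 / p) = 1 / p * Gamma (1 / p)"
      using Gamma_plus1[of "3 / p"] Gamma_plus1[of "1 / p"] by (simp_all add: add.commute)
    have pw: "(1 / p) powr (- (3 / p)) = p powr (3 / p)" "(1 / p) powr (- (1 / p)) = p powr (1 / p)"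
      using p by (simp_all add: powr_minus powr_divide)
    have p3: "p powr (3 / p) = p powr (2 / p) * p powr (1 / p)" by (simp flip: powr_add add: field_simps)
    have n: "(2 + 1) / p = 3 / p" "(0 + 1) / p = 1 / p" by simp_all
    have pos: "Gamma (1 / p) > 0" "p powr (1 / p) > 0" using p by (auto intro: Gamma_real_pos)
    show ?thesis
      unfolding gen_gamma_def Mp2_def G n pw p3 using p pos by (simp add: divide_simps)
  qed
  finally show ?thesis .
qed

lemma Mp2_pos: "0 < p \<Longrightarrow> 0 < Mp2 p"
  unfolding Mp2_def by (intro mult_pos_pos divide_pos_pos Gamma_real_pos powr_gt_zero[THEN iffD2]) (auto intro: add_pos_pos)

section \<open>Lebesgue measure in n dimensions\<close>

lemma borel_measurable_coordinate [measurable]: "(\<lambda>x::nat \<Rightarrow> real. x i) \<in> borel_measurable borel"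
  by (intro borel_measurable_continuous_onI continuous_on_product_coordinates)

lemma measurable_extend [measurable]:
  "(\<lambda>x i. if i < n then x i else 0) \<in> PiM {..<n} (\<lambda>_. lborel) \<rightarrow>\<^sub>M (borel :: (nat \<Rightarrow> real) measure)"
proof (rule measurable_coordinatewise_then_product)
  fix i
  show "(\<lambda>x. if i < n then x i else 0) \<in> borel_measurable (Pi\<^sub>M {..<n} (\<lambda>_. lborel))"
    by (cases "i < n") (auto intro!: measurable_component_singleton)
qed

lemma space_lebesgue_Rn [simp]: "space (lebesgue_Rn n) = UNIV"
  and sets_lebesgue_Rn [simp, measurable_cong]: "sets (lebesgue_Rn n) = sets borel"
  by (simp_all add: lebesgue_Rn_def)

lemma nn_integral_lebesgue_Rn:
  assumes [measurable]: "f \<in> borel_measurable borel"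
  shows "(\<integral>\<^sup>+x. f x \<partial>lebesgue_Rn n) = (\<integral>\<^sup>+x. f (\<lambda>i. if i < n then x i else 0) \<partial>PiM {..<n} (\<lambda>_. lborel))"
  unfolding lebesgue_Rn_def by (intro nn_integral_distr) simp_all

lemma product_sigma_finite_lborel: "product_sigma_finite (\<lambda>_::nat. lborel :: real measure)"
  by (simp add: product_sigma_finite_def lborel.sigma_finite_measure_axioms)

lemma nn_integral_lebesgue_Rn_prod:
  fixes h :: "nat \<Rightarrow> real \<Rightarrow> ennreal"
  assumes [measurable]: "\<And>i. h i \<in> borel_measurable borel"
  shows "(\<integral>\<^sup>+x. (\<Prod>i<n. h i (x i)) \<partial>lebesgue_Rn n) = (\<Prod>i<n. \<integral>\<^sup>+t. h i t \<partial>lborel)"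
proof -
  interpret product_sigma_finite "\<lambda>_::nat. lborel :: real measure" by (rule product_sigma_finite_lborel)
  have "(\<integral>\<^sup>+x. (\<Prod>i<n. h i (x i)) \<partial>lebesgue_Rn n)
    = (\<integral>\<^sup>+x. (\<Prod>i<n. h i (x i)) \<partial>PiM {..<n} (\<lambda>_. lborel))"
    by (subst nn_integral_lebesgue_Rn) auto
  also have "\<dots> = (\<Prod>i<n. \<integral>\<^sup>+t. h i t \<partial>lborel)"
    by (rule product_nn_integral_prod) auto
  finally show ?thesis .
qed

lemma sets_Rn [measurable]: "Rn n \<in> sets borel"
proof -
  have "Rn n = {x\<in>space borel. \<forall>i\<in>{n..}. x i = 0}" by (auto simp: Rn_def)
  also have "\<dots> \<in> sets borel" by measurable
  finally show ?thesis .
qed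

lemma AE_lebesgue_Rn: "AE x in lebesgue_Rn n. x \<in> Rn n"
  unfolding lebesgue_Rn_def by (subst AE_distr_iff) (auto simp: Rn_def)

lemma sigma_finite_lebesgue_Rn: "sigma_finite_measure (lebesgue_Rn n)"
proof
  let ?A = "\<lambda>j::nat. {x::nat \<Rightarrow> real. \<forall>i<n. x i \<in> {- real j..real j}}"
  have [measurable]: "?A j \<in> sets borel" for j by measurable
  have "emeasure (lebesgue_Rn n) (?A j) \<noteq> \<infinity>" for j
  proof -
    have "emeasure (lebesgue_Rn n) (?A j) = (\<integral>\<^sup>+x. indicator (?A j) x \<partial>lebesgue_Rn n)" by simp
    also have "\<dots> = (\<integral>\<^sup>+x. (\<Prod>i<n. indicator {- real j..real j} (x i)) \<partial>lebesgue_Rn n)"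
      by (intro nn_integral_cong) (auto simp: indicator_def prod.If_cases intro: prod_zero[symmetric])
    also have "\<dots> = (\<Prod>i<n. ennreal (2 * real j))"
      by (subst nn_integral_lebesgue_Rn_prod) (auto intro!: prod.cong)
    also have "\<dots> < \<infinity>" by (simp add: power_less_top_ennreal)
    finally show ?thesis by simp
  qed
  moreover have "\<Union>(range ?A) = UNIV"
  proof (intro subset_antisym subsetI)
    fix x :: "nat \<Rightarrow> real"
    obtain j :: nat where "(\<Sum>i<n. \<bar>x i\<bar>) \<le> real j" using real_arch_simple by blast
    then have "\<bar>x i\<bar> \<le> real j" if "i < n" for i
      using member_le_sum[of i "{..<n}" "\<lambda>i. \<bar>x i\<bar>"] that by (auto intro: order_trans)
    then show "x \<in> \<Union>(range ?A)" by (auto intro!: exI[of _ j] simp: abs_le_iff) (smt (verit))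
  qed auto
  ultimately show "\<exists>A. countable A \<and> A \<subseteq> sets (lebesgue_Rn n) \<and> \<Union>A = space (lebesgue_Rn n) \<and> (\<forall>a\<in>A. emeasure (lebesgue_Rn n) a \<noteq> \<infinity>)"
    by (intro exI[of _ "range ?A"]) auto
qed

text \<open>
  A product measure is determined by its values on boxes, and on a box each of the \<open>n\<close> coordinates
  contributes one factor \<open>c\<close>. Reflections and dilations are special cases.
\<close>

lemma nn_integral_lebesgue_Rn_coordinatewise:
  assumes [measurable]: "\<And>i. \<phi> i \<in> borel_measurable borel" "f \<in> borel_measurable borel"
    and scale: "\<And>i A. A \<in> sets borel \<Longrightarrow> emeasure lborel (\<phi> i -` A) = ennreal c * emeasure lborel A"
    and c: "0 < c" and zero: "\<And>i. i \<ge> n \<Longrightarrow> \<phi> i 0 = 0"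
  shows "(\<integral>\<^sup>+x. f (\<lambda>i. \<phi> i (x i)) \<partial>lebesgue_Rn n) = ennreal (c ^ n) * (\<integral>\<^sup>+x. f x \<partial>lebesgue_Rn n)"
proof -
  interpret product_sigma_finite "\<lambda>_::nat. lborel :: real measure" by (rule product_sigma_finite_lborel)
  let ?P = "PiM {..<n} (\<lambda>_::nat. lborel :: real measure)"
  let ?g = "\<lambda>x. \<lambda>i\<in>{..<n}. \<phi> i (x i)"
  have g[measurable]: "?g \<in> ?P \<rightarrow>\<^sub>M ?P" by measurable
  have ext[measurable]: "(\<lambda>x i. \<phi> i (x i)) \<in> borel \<rightarrow>\<^sub>M (borel :: (nat \<Rightarrow> real) measure)"
    by (intro measurable_coordinatewise_then_product) measurable
  have "scale_measure (ennreal (1 / c ^ n)) (distr ?P ?P ?g) = ?P"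
  proof (rule PiM_eqI)
    fix A :: "nat \<Rightarrow> real set" assume A: "\<And>i. i \<in> {..<n} \<Longrightarrow> A i \<in> sets lborel"
    have "emeasure (distr ?P ?P ?g) (Pi\<^sub>E {..<n} A) = emeasure ?P (Pi\<^sub>E {..<n} (\<lambda>i. \<phi> i -` A i))"
      using A by (subst emeasure_distr)
        (auto intro!: sets_PiM_I_finite arg_cong2[where f = emeasure] simp: space_PiM PiE_iff extensional_def)
    also have "\<dots> = (\<Prod>i<n. emeasure lborel (\<phi> i -` A i))"
      using A by (subst emeasure_PiM) (auto intro!: measurable_sets_borel[where M = borel])
    also have "\<dots> = (\<Prod>i<n. ennreal c * emeasure lborel (A i))"
      using A by (intro prod.cong scale) auto
    also have "\<dots> = ennreal (c ^ n) * (\<Prod>i<n. emeasure lborel (A i))"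
      using c by (simp add: prod.distrib ennreal_power)
    finally show "emeasure (scale_measure (ennreal (1 / c ^ n)) (distr ?P ?P ?g)) (Pi\<^sub>E {..<n} A) = (\<Prod>i<n. emeasure lborel (A i))"
      using c by (simp flip: mult.assoc ennreal_mult)
  qed simp_all
  then have "(\<integral>\<^sup>+x. f x \<partial>lebesgue_Rn n)
    = (\<integral>\<^sup>+x. f (\<lambda>i. if i < n then x i else 0) \<partial>scale_measure (ennreal (1 / c ^ n)) (distr ?P ?P ?g))"
    by (simp add: nn_integral_lebesgue_Rn)
  also have "\<dots> = ennreal (1 / c ^ n) * (\<integral>\<^sup>+x. f (\<lambda>i. if i < n then ?g x i else 0) \<partial>?P)"
    by (subst nn_integral_scale_measure, simp) (subst nn_integral_distr, auto)
  also have "(\<integral>\<^sup>+x. f (\<lambda>i. if i < n then ?g x i else 0) \<partial>?P) = (\<integral>\<^sup>+x. f (\<lambda>i. \<phi> i (x i)) \<partial>lebesgue_Rn n)"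
    by (subst nn_integral_lebesgue_Rn, simp) (auto intro!: nn_integral_cong arg_cong[of _ _ f] simp: zero)
  finally show ?thesis
    using c by (simp flip: mult.assoc ennreal_mult)
qed

lemma emeasure_lborel_vimage_affine:
  assumes A: "A \<in> sets borel" and c: "c \<noteq> 0"
  shows "emeasure lborel ((\<lambda>t. a + c * t) -` A) = ennreal (1 / \<bar>c\<bar>) * emeasure lborel A"
proof -
  have V: "(\<lambda>t. a + c * t) -` A \<in> sets borel" by (rule measurable_sets_borel[OF _ A]) simp
  have "emeasure lborel A = (\<integral>\<^sup>+t. indicator A t \<partial>lborel)" using A by simp
  also have "\<dots> = ennreal \<bar>c\<bar> * (\<integral>\<^sup>+t. indicator A (a + c * t) \<partial>lborel)"
    using A c by (intro nn_integral_real_affine) auto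
  also have "(\<integral>\<^sup>+t. indicator A (a + c * t) \<partial>lborel) = (\<integral>\<^sup>+t. indicator ((\<lambda>t. a + c * t) -` A) t \<partial>lborel)"
    by (intro nn_integral_cong) (simp add: indicator_def)
  also have "\<dots> = emeasure lborel ((\<lambda>t. a + c * t) -` A)" using V by (intro nn_integral_indicator) auto
  finally show ?thesis using c by (simp flip: mult.assoc ennreal_mult)
qed

lemma measurable_fun_diff [measurable (raw)]:
  fixes f g :: "'a \<Rightarrow> nat \<Rightarrow> real"
  assumes [measurable]: "f \<in> borel_measurable M" "g \<in> borel_measurable M"
  shows "(\<lambda>x. f x - g x) \<in> borel_measurable M"
  by (rule measurable_coordinatewise_then_product) (simp add: fun_diff_def)

lemma nn_integral_lebesgue_Rn_reflect:
  assumes [measurable]: "f \<in> borel_measurable borel" and v: "v \<in> Rn n"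
  shows "(\<integral>\<^sup>+x. f (v - x) \<partial>lebesgue_Rn n) = (\<integral>\<^sup>+x. f x \<partial>lebesgue_Rn n)"
  using nn_integral_lebesgue_Rn_coordinatewise[of "\<lambda>i t. v i + (- 1) * t" f 1 n]
    emeasure_lborel_vimage_affine[of _ "- 1"] v by (simp add: Rn_def fun_diff_def)

lemma nn_integral_lebesgue_Rn_translate:
  assumes [measurable]: "f \<in> borel_measurable borel" and v: "v \<in> Rn n"
  shows "(\<integral>\<^sup>+x. f (x - v) \<partial>lebesgue_Rn n) = (\<integral>\<^sup>+x. f x \<partial>lebesgue_Rn n)"
proof -
  have [measurable]: "(\<lambda>x. f (0 - x)) \<in> borel_measurable borel" by measurable
  have "(\<integral>\<^sup>+x. f (x - v) \<partial>lebesgue_Rn n) = (\<integral>\<^sup>+x. f (0 - (v - x)) \<partial>lebesgue_Rn n)" by simp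
  also have "\<dots> = (\<integral>\<^sup>+x. f (0 - x) \<partial>lebesgue_Rn n)"
    by (rule nn_integral_lebesgue_Rn_reflect[OF _ v]) measurable
  also have "\<dots> = (\<integral>\<^sup>+x. f x \<partial>lebesgue_Rn n)"
    by (rule nn_integral_lebesgue_Rn_reflect) (simp_all add: Rn_def)
  finally show ?thesis .
qed

lemma nn_integral_lebesgue_Rn_scale:
  assumes [measurable]: "f \<in> borel_measurable borel" and r: "0 < r"
  shows "(\<integral>\<^sup>+x. f (r *\<^sub>R x) \<partial>lebesgue_Rn n) = ennreal ((1 / r) ^ n) * (\<integral>\<^sup>+x. f x \<partial>lebesgue_Rn n)"
  using nn_integral_lebesgue_Rn_coordinatewise[of "\<lambda>i t. 0 + r * t" f "1 / r" n]
    emeasure_lborel_vimage_affine[of _ r 0] r by (simp add: scaleR_fun_def)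

lemma measurable_dot [measurable (raw)]:
  fixes f g :: "'a \<Rightarrow> nat \<Rightarrow> real"
  assumes [measurable]: "f \<in> borel_measurable M" "g \<in> borel_measurable M"
  shows "(\<lambda>x. dot n (f x) (g x)) \<in> borel_measurable M"
  unfolding dot_def by measurable

definition gauss_density :: "nat \<Rightarrow> (nat \<Rightarrow> real) \<Rightarrow> ennreal"
  where "gauss_density n x = (\<Prod>i<n. ennreal (std_normal_density (x i)))"

lemma gauss_density_measurable [measurable]: "gauss_density n \<in> borel_measurable borel"
  unfolding gauss_density_def[abs_def] by measurable

lemma gauss_density_eq: "gauss_density n x = ennreal ((1 / sqrt (2 * pi)) ^ n * exp (- dot n x x / 2))"
proof -
  have "gauss_density n x = ennreal (\<Prod>i<n. 1 / sqrt (2 * pi) * exp (- (x i)\<^sup>2 / 2))"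
    unfolding gauss_density_def std_normal_density_def by (intro prod_ennreal) auto
  also have "(\<Prod>i<n. 1 / sqrt (2 * pi) * exp (- (x i)\<^sup>2 / 2)) = (1 / sqrt (2 * pi)) ^ n * exp (\<Sum>i<n. - (x i)\<^sup>2 / 2)"
    by (simp only: prod.distrib prod_constant card_lessThan exp_sum[OF finite_lessThan])
  also have "(\<Sum>i<n. - (x i)\<^sup>2 / 2) = - dot n x x / 2"
    by (simp add: dot_def power2_eq_square sum_negf sum_divide_distrib)
  finally show ?thesis .
qed

lemma nn_integral_gauss_density: "(\<integral>\<^sup>+x. gauss_density n x \<partial>lebesgue_Rn n) = 1"
proof -
  have "(\<integral>\<^sup>+t. ennreal (std_normal_density t) \<partial>lborel) = 1"
    by (subst nn_integral_eq_integral) (auto intro: integrable_normal_density)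
  then show ?thesis
    unfolding gauss_density_def by (subst nn_integral_lebesgue_Rn_prod) auto
qed

text \<open>
  Rotation invariance is deduced from the rotation invariance of the Gaussian density alone, without
  determinants. Insert the factor \<open>1 = \<integral> g (y - T x) dy\<close>, exchange the integrals, and reflect
  \<open>x \<mapsto> w - x\<close> with \<open>T w = y\<close>: this turns \<open>f (T x) g (y - T x)\<close> into \<open>f (y - T x) g (T x)\<close>, where
  \<open>g (T x) = g x\<close> and the integral over \<open>y\<close> no longer sees \<open>T\<close>.
\<close>

lemma nn_integral_lebesgue_Rn_rotate:
  assumes [measurable]: "f \<in> borel_measurable borel" and T[measurable]: "T \<in> borel_measurable borel"
    and diff: "\<And>x y. T (x - y) = T x - T y"
    and Rn: "\<And>x. x \<in> Rn n \<Longrightarrow> T x \<in> Rn n" and surj: "\<And>y. y \<in> Rn n \<Longrightarrow> \<exists>w\<in>Rn n. T w = y"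
    and norm: "\<And>x. x \<in> Rn n \<Longrightarrow> dot n (T x) (T x) = dot n x x"
  shows "(\<integral>\<^sup>+x. f (T x) \<partial>lebesgue_Rn n) = (\<integral>\<^sup>+x. f x \<partial>lebesgue_Rn n)"
proof -
  interpret sigma_finite_measure "lebesgue_Rn n" by (rule sigma_finite_lebesgue_Rn)
  interpret pair_sigma_finite "lebesgue_Rn n" "lebesgue_Rn n" ..
  let ?L = "lebesgue_Rn n" and ?g = "gauss_density n"
  have gT: "?g (T x) = ?g x" if "x \<in> Rn n" for x using norm[OF that] by (simp add: gauss_density_eq)
  have neg: "?g (- x) = ?g x" for x by (simp add: gauss_density_eq dot_def)
  have "(\<integral>\<^sup>+x. f (T x) \<partial>?L) = (\<integral>\<^sup>+x. (\<integral>\<^sup>+y. f (T x) * ?g (y - T x) \<partial>?L) \<partial>?L)"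
    using AE_lebesgue_Rn[of n]
    by (intro nn_integral_cong_AE, eventually_elim)
      (simp add: nn_integral_cmult nn_integral_lebesgue_Rn_translate[OF _ Rn] nn_integral_gauss_density)
  also have "\<dots> = (\<integral>\<^sup>+y. (\<integral>\<^sup>+x. f (T x) * ?g (y - T x) \<partial>?L) \<partial>?L)"
    by (rule Fubini'[symmetric]) measurable
  also have "\<dots> = (\<integral>\<^sup>+y. (\<integral>\<^sup>+x. f (y - T x) * ?g (T x) \<partial>?L) \<partial>?L)"
    using AE_lebesgue_Rn[of n]
  proof (intro nn_integral_cong_AE, eventually_elim)
    case (elim y)
    then obtain w where w: "w \<in> Rn n" "T w = y" using surj by blast
    \<comment> \<open>Reflect at \<open>w\<close>, the preimage of \<open>y\<close>.\<close>
    have "(\<integral>\<^sup>+x. f (T x) * ?g (y - T x) \<partial>?L) = (\<integral>\<^sup>+x. f (T (w - x)) * ?g (y - T (w - x)) \<partial>?L)"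
      by (subst nn_integral_lebesgue_Rn_reflect[OF _ w(1), of "\<lambda>x. f (T x) * ?g (y - T x)"]) auto
    then show ?case by (simp add: diff w)
  qed
  also have "\<dots> = (\<integral>\<^sup>+x. (\<integral>\<^sup>+y. f (y - T x) * ?g (T x) \<partial>?L) \<partial>?L)"
    by (rule Fubini') measurable
  also have "\<dots> = (\<integral>\<^sup>+x. (\<integral>\<^sup>+y. f y \<partial>?L) * ?g x \<partial>?L)"
    using AE_lebesgue_Rn[of n]
    by (intro nn_integral_cong_AE, eventually_elim)
      (simp add: nn_integral_multc nn_integral_lebesgue_Rn_translate[OF _ Rn] gT)
  also have "\<dots> = (\<integral>\<^sup>+y. f y \<partial>?L)"
    by (simp add: nn_integral_cmult nn_integral_gauss_density)
  finally show ?thesis .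
qed

section \<open>Orthonormal bases and orthogonal projections\<close>

lemma scaleR_fun_apply [simp]: "(c *\<^sub>R f) x = c *\<^sub>R f x"
  by (simp add: scaleR_fun_def)

lemma sum_fun_apply: "(\<Sum>i\<in>A. f i) x = (\<Sum>i\<in>A. f i x)"
  by (induction A rule: infinite_finite_induct) (simp_all add: plus_fun_def zero_fun_def)

lemma dot_sym: "dot n x y = dot n y x"
  by (simp add: dot_def mult.commute)

lemma dot_add_left: "dot n (x + y) z = dot n x z + dot n y z"
  by (simp add: dot_def distrib_right sum.distrib)

lemma dot_diff_left: "dot n (x - y) z = dot n x z - dot n y z"
  by (simp add: dot_def left_diff_distrib sum_subtractf)

lemma dot_scaleR_left: "dot n (c *\<^sub>R x) z = c * dot n x z"
  by (simp add: dot_def sum_distrib_left mult.assoc)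

lemma dot_zero_left [simp]: "dot n 0 z = 0"
  by (simp add: dot_def)

lemma dot_sum_left: "dot n (\<Sum>i\<in>A. f i) z = (\<Sum>i\<in>A. dot n (f i) z)"
  unfolding dot_def sum_fun_apply sum_distrib_right by (rule sum.swap)

lemma dot_add_right: "dot n z (x + y) = dot n z x + dot n z y"
  by (simp add: dot_sym[of n z] dot_add_left)

lemma dot_scaleR_right: "dot n z (c *\<^sub>R x) = c * dot n z x"
  by (simp add: dot_sym[of n z] dot_scaleR_left)

lemma dot_self_nonneg: "0 \<le> dot n x x"
  by (simp add: dot_def sum_nonneg)

lemma dot_self_eq_0: "x \<in> Rn n \<Longrightarrow> dot n x x = 0 \<longleftrightarrow> x = 0"
  by (auto simp: dot_def sum_nonneg_eq_0_iff Rn_def fun_eq_iff) (metis leI lessThan_iff)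

lemma subspace_Rn: "subspace (Rn n)"
  by (auto simp: subspace_def Rn_def)

definition unit_vec :: "nat \<Rightarrow> nat \<Rightarrow> real"
  where "unit_vec j = (\<lambda>l. if l = j then 1 else 0)"

lemma unit_vec_Rn: "i < n \<Longrightarrow> unit_vec i \<in> Rn n"
  by (auto simp: unit_vec_def Rn_def)

lemma dot_unit_vec: "i < n \<Longrightarrow> dot n x (unit_vec i) = x i"
  by (simp add: dot_def unit_vec_def if_distrib[of "(*) _"] cong: if_cong)

lemma Rn_expand: "x \<in> Rn n \<Longrightarrow> x = (\<Sum>i<n. x i *\<^sub>R unit_vec i)"
  by (auto simp: fun_eq_iff unit_vec_def Rn_def if_distrib[of "(*) _"] not_less sum_fun_apply cong: if_cong)

definition orthonormal :: "nat \<Rightarrow> nat \<Rightarrow> (nat \<Rightarrow> nat \<Rightarrow> real) \<Rightarrow> bool"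
  where "orthonormal n d u \<longleftrightarrow>
    (\<forall>i<d. u i \<in> Rn n) \<and> (\<forall>i<d. \<forall>j<d. dot n (u i) (u j) = (if i = j then 1 else 0))"

lemma orthonormal_unit_vec: "d \<le> n \<Longrightarrow> orthonormal n d unit_vec"
  by (auto simp: orthonormal_def unit_vec_Rn dot_unit_vec) (auto simp: unit_vec_def)

lemma orthonormal_expand:
  assumes u: "orthonormal n d u" and x: "x \<in> span (u ` {..<d})"
  shows "x = (\<Sum>i<d. dot n x (u i) *\<^sub>R u i)"
proof -
  let ?S = "{x. x = (\<Sum>i<d. dot n x (u i) *\<^sub>R u i)}"
  have "subspace ?S"
    unfolding subspace_def
  proof (intro conjI ballI allI impI; unfold mem_Collect_eq)
    fix x y assume *: "x = (\<Sum>i<d. dot n x (u i) *\<^sub>R u i)" "y = (\<Sum>i<d. dot n y (u i) *\<^sub>R u i)"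
    show "x + y = (\<Sum>i<d. dot n (x + y) (u i) *\<^sub>R u i)"
      unfolding dot_add_left scaleR_add_left sum.distrib by (rule arg_cong2[OF *])
  next
    fix c x assume *: "x = (\<Sum>i<d. dot n x (u i) *\<^sub>R u i)"
    show "c *\<^sub>R x = (\<Sum>i<d. dot n (c *\<^sub>R x) (u i) *\<^sub>R u i)"
      unfolding dot_scaleR_left scaleR_scaleR[symmetric] scaleR_sum_right[symmetric] by (rule arg_cong[OF *])
  qed simp
  moreover have "u ` {..<d} \<subseteq> ?S"
  proof clarsimp
    fix j assume "j < d"
    then have "(\<Sum>i<d. dot n (u j) (u i) *\<^sub>R u i) = (\<Sum>i<d. (if j = i then 1 else 0) *\<^sub>R u i)"
      using u by (intro sum.cong) (auto simp: orthonormal_def)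
    also have "\<dots> = (\<Sum>i<d. if j = i then u i else 0)" by (intro sum.cong) auto
    finally show "u j = (\<Sum>i<d. dot n (u j) (u i) *\<^sub>R u i)" using \<open>j < d\<close> by simp
  qed
  ultimately have "span (u ` {..<d}) \<subseteq> ?S" by (intro span_minimal)
  then show ?thesis using x by blast
qed

lemma orthonormal_combination:
  assumes "orthonormal n d u" "j < d"
  shows "dot n (\<Sum>i<d. c i *\<^sub>R u i) (u j) = c j"
proof -
  have "dot n (\<Sum>i<d. c i *\<^sub>R u i) (u j) = (\<Sum>i<d. if i = j then c i else 0)"
    using assms unfolding dot_sum_left dot_scaleR_left by (intro sum.cong) (auto simp: orthonormal_def)
  then show ?thesis using assms by simp
qed

lemma orthonormal_independent:
  assumes u: "orthonormal n d u"
  shows "inj_on u {..<d}" "independent (u ` {..<d})"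
proof -
  have d1: "dot n (u i) (u j) = (if i = j then 1 else 0)" if "i < d" "j < d" for i j
    using u that by (auto simp: orthonormal_def)
  show "inj_on u {..<d}"
  proof (rule inj_onI)
    fix i j assume "i \<in> {..<d}" "j \<in> {..<d}" "u i = u j"
    then show "i = j" using d1[of i j] d1[of j j] by (auto split: if_splits)
  qed
  show "independent (u ` {..<d})"
  proof
    assume "dependent (u ` {..<d})"
    then obtain j where j: "j < d" "u j \<in> span (u ` {..<d} - {u j})" by (auto simp: dependent_def)
    have "subspace {x. dot n x (u j) = 0}"
      by (auto simp: subspace_def dot_add_left dot_scaleR_left)
    moreover have "u ` {..<d} - {u j} \<subseteq> {x. dot n x (u j) = 0}"
      using d1 j(1) by force
    ultimately have "u j \<in> {x. dot n x (u j) = 0}" using j(2) span_minimal by blast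
    then show False using d1[OF j(1) j(1)] by simp
  qed
qed

lemma card_orthonormal: "orthonormal n d u \<Longrightarrow> card (u ` {..<d}) = d"
  using orthonormal_independent(1)[of n d u] by (simp add: card_image)

lemma span_unit_vec: "span (unit_vec ` {..<n}) = Rn n"
proof (intro subset_antisym span_minimal subspace_Rn subsetI)
  fix x assume "x \<in> Rn n"
  then have "x = (\<Sum>i<n. x i *\<^sub>R unit_vec i)" by (rule Rn_expand)
  also have "\<dots> \<in> span (unit_vec ` {..<n})" by (intro span_sum span_scale span_base) auto
  finally show "x \<in> span (unit_vec ` {..<n})" .
qed (auto simp: unit_vec_Rn)

lemma dim_Rn: "dim (Rn n) = n"
proof -
  have "span (unit_vec ` {..<n}) = span (Rn n)"
    unfolding span_unit_vec span_eq_iff[THEN iffD2, OF subspace_Rn] ..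
  from dim_eq_card[OF this orthonormal_independent(2)[OF orthonormal_unit_vec[OF order_refl]]]
  show ?thesis unfolding card_orthonormal[OF orthonormal_unit_vec[OF order_refl]] .
qed

lemma independent_card_le_dim_Rn:
  assumes "F \<subseteq> Rn n" "independent S" "S \<subseteq> span F"
  shows "card S \<le> dim F"
proof -
  obtain B where B: "B \<subseteq> F" "independent B" "F \<subseteq> span B" "card B = dim F"
    by (rule basis_exists)
  have "B \<subseteq> span (unit_vec ` {..<n})" unfolding span_unit_vec using B(1) assms(1) by (rule subset_trans)
  from independent_span_bound[OF _ B(2) this] have "finite B" by simp
  moreover have "S \<subseteq> span B"
    using assms(3) span_minimal[OF B(3) subspace_span] by (rule subset_trans)
  ultimately have "card S \<le> card B" using independent_span_bound[OF _ assms(2)] by blast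
  then show ?thesis using B(4) by simp
qed

lemma orthonormal_spans:
  assumes F: "subspace F" "F \<subseteq> Rn n" "dim F \<le> d" and u: "orthonormal n d u" "\<And>i. i < d \<Longrightarrow> u i \<in> F"
  shows "span (u ` {..<d}) = F"
proof (rule subset_antisym)
  show "span (u ` {..<d}) \<subseteq> F"
    using u(2) by (intro span_minimal F(1) image_subsetI) simp
  show "F \<subseteq> span (u ` {..<d})"
  proof
    fix x assume x: "x \<in> F"
    show "x \<in> span (u ` {..<d})"
    proof (rule ccontr)
      assume nx: "x \<notin> span (u ` {..<d})"
      then have nu: "x \<notin> u ` {..<d}" using span_superset[of "u ` {..<d}"] by (rule contra_subsetD[rotated])
      have ind: "independent (insert x (u ` {..<d}))"
        using nx orthonormal_independent(2)[OF u(1)] by (rule independent_insertI)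
      have "insert x (u ` {..<d}) \<subseteq> F" using u(2) x by (auto simp: image_subset_iff)
      then have "insert x (u ` {..<d}) \<subseteq> span F" using span_superset by (rule subset_trans)
      from independent_card_le_dim_Rn[OF F(2) ind this]
      have "Suc (card (u ` {..<d})) \<le> dim F" unfolding card_insert_disjoint[OF finite_imageI[OF finite_lessThan] nu] .
      then show False using F(3) unfolding card_orthonormal[OF u(1)] by linarith
    qed
  qed
qed

text \<open>
  Gram--Schmidt, one vector at a time. Keeping the given vectors makes it possible to adapt a basis
  first to a subspace or to a single vector and then to complete it.
\<close>

lemma orthonormal_extend:
  assumes F: "subspace F" "F \<subseteq> Rn n" "dim F = d"
    and "orthonormal n j u" "\<And>i. i < j \<Longrightarrow> u i \<in> F" "j \<le> d"
  shows "\<exists>u'. orthonormal n d u' \<and> (\<forall>i<d. u' i \<in> F) \<and> (\<forall>i<j. u' i = u i)"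
  using assms(4-)
proof (induction "d - j" arbitrary: j u)
  case 0
  then have "j = d" by simp
  then show ?case using 0 by blast
next
  case (Suc m)
  note u = Suc.prems(1,2)
  have j: "j < d" using Suc.hyps(2) by simp
  have "\<not> F \<subseteq> span (u ` {..<j})"
  proof
    assume sub: "F \<subseteq> span (u ` {..<j})"
    obtain B where B: "B \<subseteq> F" "independent B" "F \<subseteq> span B" "card B = dim F"
      by (rule basis_exists)
    from B(1) sub have "B \<subseteq> span (u ` {..<j})" by (rule subset_trans)
    from independent_span_bound[OF _ B(2) this] have "card B \<le> card (u ` {..<j})" by simp
    also have "\<dots> = j" by (rule card_orthonormal[OF u(1)])
    finally show False using B(4) F(3) j by linarith
  qed
  then obtain x where x: "x \<in> F" "x \<notin> span (u ` {..<j})" by blast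
  define y where "y = (\<Sum>i<j. dot n x (u i) *\<^sub>R u i)"
  define w where "w = x - y"
  have ysp: "y \<in> span (u ` {..<j})" unfolding y_def by (intro span_sum span_scale span_base) auto
  have yF: "y \<in> F" using u(2) F(1) unfolding y_def by (intro subspace_sum subspace_scale) auto
  have wF: "w \<in> F" using x yF F(1) by (simp add: w_def subspace_diff)
  have w0: "w \<noteq> 0" using x ysp by (auto simp: w_def)
  have wpos: "0 < dot n w w"
  proof -
    have "dot n w w \<noteq> 0" using dot_self_eq_0[of w n] w0 wF F(2) by blast
    then show ?thesis using dot_self_nonneg[of n w] by linarith
  qed
  have wort: "dot n w (u i) = 0" if "i < j" for i
    using orthonormal_combination[OF u(1) that, of "\<lambda>i. dot n x (u i)"] by (simp add: w_def y_def dot_diff_left)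
  define e where "e = (1 / sqrt (dot n w w)) *\<^sub>R w"
  define u1 where "u1 = u(j := e)"
  have eF: "e \<in> F" using wF F(1) by (simp add: e_def subspace_scale)
  have ee: "dot n e e = 1" using wpos by (simp add: e_def dot_scaleR_left dot_scaleR_right)
  have eu: "dot n e (u i) = 0" "dot n (u i) e = 0" if "i < j" for i
    using wort[OF that] by (simp_all add: e_def dot_scaleR_left dot_scaleR_right dot_sym[of n "u i"])
  have u1j: "u1 j = e" and u1i: "\<And>i. i < j \<Longrightarrow> u1 i = u i" by (simp_all add: u1_def)
  have uu: "dot n (u i) (u l) = (if i = l then 1 else 0)" if "i < j" "l < j" for i l
    using u(1) that by (simp add: orthonormal_def)
  have on1: "orthonormal n (Suc j) u1"
    unfolding orthonormal_def
  proof (intro conjI allI impI)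
    fix i assume "i < Suc j"
    then have i: "i = j \<or> i < j" by linarith
    then show "u1 i \<in> Rn n" using u(2)[of i] eF F(2) by (auto simp: u1j u1i)
    fix l assume "l < Suc j"
    then have "l = j \<or> l < j" by linarith
    with i show "dot n (u1 i) (u1 l) = (if i = l then 1 else 0)"
      using ee eu[of i] eu[of l] uu[of i l] by (elim disjE) (auto simp: u1j u1i)
  qed
  have "u1 i \<in> F" if "i < Suc j" for i
    using that u(2)[of i] eF by (cases "i = j") (simp_all add: u1j u1i)
  moreover have "m = d - Suc j" "Suc j \<le> d" using Suc.hyps(2) j by linarith+
  ultimately obtain u' where u': "orthonormal n d u'" "\<forall>i<d. u' i \<in> F" "\<forall>i<Suc j. u' i = u1 i"
    using Suc.hyps(1)[OF _ on1] by blast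
  have "\<forall>i<j. u' i = u i" using u'(3) u1i by simp
  with u'(1,2) show ?case by blast
qed

lemma orthonormal_in_Rn: "orthonormal n d u \<Longrightarrow> i < d \<Longrightarrow> u i \<in> Rn n"
  by (simp add: orthonormal_def)

lemma orthonormal_Rn_extend:
  assumes "orthonormal n j u" "j \<le> n"
  shows "\<exists>u'. orthonormal n n u' \<and> (\<forall>i<j. u' i = u i)"
proof -
  have "\<exists>u'. orthonormal n n u' \<and> (\<forall>i<n. u' i \<in> Rn n) \<and> (\<forall>i<j. u' i = u i)"
    by (rule orthonormal_extend[OF subspace_Rn order_refl dim_Rn assms(1) _ assms(2)])
      (rule orthonormal_in_Rn[OF assms(1)])
  then show ?thesis by blast
qed

lemma orthonormal_span_Rn:
  assumes "orthonormal n n u"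
  shows "span (u ` {..<n}) = Rn n"
  by (rule orthonormal_spans[OF subspace_Rn order_refl eq_refl[OF dim_Rn] assms orthonormal_in_Rn[OF assms]])

lemma grassmannian_adapted_basis:
  assumes "E \<in> grassmannian n k"
  obtains u where "orthonormal n n u" "E = span (u ` {..<k})" "k \<le> n"
proof -
  have E: "subspace E" "E \<subseteq> Rn n" "dim E = k" using assms by (simp_all add: grassmannian_def)
  have "orthonormal n 0 (\<lambda>_. 0)" by (simp add: orthonormal_def)
  from orthonormal_extend[OF E this] obtain u0
    where u0: "orthonormal n k u0" "\<forall>i<k. u0 i \<in> E" by (metis not_less_zero le0)
  have "card (u0 ` {..<k}) \<le> dim (Rn n)"
  proof (rule independent_card_le_dim_Rn[OF order_refl orthonormal_independent(2)[OF u0(1)]])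
    show "u0 ` {..<k} \<subseteq> span (Rn n)" using u0(2) E(2) span_base by blast
  qed
  then have k: "k \<le> n" unfolding card_orthonormal[OF u0(1)] dim_Rn .
  obtain u where u: "orthonormal n n u" "\<forall>i<k. u i = u0 i"
    using orthonormal_Rn_extend[OF u0(1) k] by blast
  have "u ` {..<k} = u0 ` {..<k}" using u(2) by (intro image_cong) simp_all
  moreover have "span (u0 ` {..<k}) = E"
    by (rule orthonormal_spans[OF E(1,2) _ u0(1)]) (use u0(2) E(3) in simp_all)
  ultimately have "E = span (u ` {..<k})" by metis
  then show ?thesis using that u(1) k by blast
qed

lemma span_in_grassmannian:
  assumes "orthonormal n k u"
  shows "span (u ` {..<k}) \<in> grassmannian n k"
proof -
  have "span (u ` {..<k}) \<subseteq> Rn n" using assms by (intro span_minimal subspace_Rn) (auto simp: orthonormal_def)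
  moreover have "dim (span (u ` {..<k})) = k"
    using dim_eq_card[of "u ` {..<k}" "span (u ` {..<k})"] orthonormal_independent(2)[OF assms] card_orthonormal[OF assms]
    by (simp add: span_span)
  ultimately show ?thesis by (simp add: grassmannian_def)
qed

text \<open>
  The coordinates with respect to \<open>u\<close>, as an orthogonal map that sends \<open>u i\<close> to the \<open>i\<close>-th unit
  vector. These are the only rotations that occur below.
\<close>

definition rot :: "nat \<Rightarrow> (nat \<Rightarrow> nat \<Rightarrow> real) \<Rightarrow> (nat \<Rightarrow> real) \<Rightarrow> nat \<Rightarrow> real"
  where "rot n u x = (\<lambda>i. if i < n then dot n x (u i) else 0)"

lemma rot_Rn: "rot n u x \<in> Rn n"
  by (simp add: rot_def Rn_def)

lemma linear_rot: "linear (rot n u)"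
  by (rule linearI) (auto simp: rot_def fun_eq_iff dot_add_left dot_scaleR_left)

lemma rot_diff: "rot n u (x - y) = rot n u x - rot n u y"
  using linear_rot by (rule linear_diff)

lemma dot_rot:
  assumes u: "orthonormal n n u" and x: "x \<in> Rn n"
  shows "dot n (rot n u x) (rot n u y) = dot n x y"
proof -
  have "dot n x y = dot n (\<Sum>i<n. dot n x (u i) *\<^sub>R u i) y"
    using orthonormal_expand[OF u] orthonormal_span_Rn[OF u] x by simp
  also have "\<dots> = (\<Sum>i<n. dot n x (u i) * dot n y (u i))"
    by (simp add: dot_sum_left dot_scaleR_left dot_sym[of n y])
  also have "\<dots> = dot n (rot n u x) (rot n u y)" unfolding dot_def[of n "rot n u x"] by (intro sum.cong refl) (simp add: rot_def)
  finally show ?thesis ..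
qed

lemma rot_orth_group: "orthonormal n n u \<Longrightarrow> rot n u \<in> orth_group n"
  by (auto simp: orth_group_def linear_rot rot_Rn dot_rot)

lemma rot_basis: "orthonormal n n u \<Longrightarrow> i < n \<Longrightarrow> rot n u (u i) = unit_vec i"
  by (auto simp: rot_def unit_vec_def orthonormal_def)

lemma rot_inverse:
  assumes u: "orthonormal n n u" and y: "y \<in> Rn n"
  shows "rot n u (\<Sum>i<n. y i *\<^sub>R u i) = y"
  using y by (auto simp: rot_def fun_eq_iff orthonormal_combination[OF u] Rn_def )

lemma rot_inverse_Rn: "orthonormal n n u \<Longrightarrow> (\<Sum>i<n. y i *\<^sub>R u i) \<in> Rn n"
  by (intro subspace_sum subspace_scale subspace_Rn) (auto simp: orthonormal_def)

lemma rot_surj: "orthonormal n n u \<Longrightarrow> y \<in> Rn n \<Longrightarrow> \<exists>w\<in>Rn n. rot n u w = y"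
  using rot_inverse rot_inverse_Rn by blast

lemma orthonormal_rot:
  assumes u: "orthonormal n n u" and v: "orthonormal n k v"
  shows "orthonormal n k (\<lambda>i. rot n u (v i))"
  using v by (auto simp: orthonormal_def rot_Rn dot_rot[OF u])

lemma rot_image_span: "rot n u ` span S = span (rot n u ` S)"
  using linear_rot by (rule linear_span_image[symmetric])

lemma rot_image_grassmannian:
  assumes u: "orthonormal n n u" and E: "E \<in> grassmannian n k"
  shows "rot n u ` E \<in> grassmannian n k"
proof -
  obtain v where v: "orthonormal n n v" "E = span (v ` {..<k})" "k \<le> n"
    using grassmannian_adapted_basis[OF E] .
  have "orthonormal n k v" using v(1,3) by (auto simp: orthonormal_def)
  from span_in_grassmannian[OF orthonormal_rot[OF u this]] show ?thesis
    by (simp add: v(2) rot_image_span image_image)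
qed

lemma orth_proj_eqI:
  assumes E: "subspace E" "E \<subseteq> Rn n" and y: "y \<in> E" "\<forall>z\<in>E. dot n (x - y) z = 0"
  shows "orth_proj n E x = y"
  unfolding orth_proj_def
proof (rule the_equality)
  fix y' assume y': "y' \<in> E \<and> (\<forall>z\<in>E. dot n (x - y') z = 0)"
  have d: "y' - y \<in> E" using y y' E by (simp add: subspace_diff)
  have "dot n (y' - y) (y' - y) = dot n (x - y) (y' - y) - dot n (x - y') (y' - y)"
    by (simp add: dot_diff_left)
  also have "\<dots> = 0" using y y' d by simp
  finally show "y' = y" using dot_self_eq_0[of "y' - y" n] d E by auto
qed (use y in simp)

lemma orthonormal_projection:
  assumes u: "orthonormal n k u"
  shows "(\<Sum>i<k. dot n x (u i) *\<^sub>R u i) \<in> span (u ` {..<k})" (is "?y \<in> _")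
    and "\<forall>z\<in>span (u ` {..<k}). dot n (x - (\<Sum>i<k. dot n x (u i) *\<^sub>R u i)) z = 0"
proof -
  show "?y \<in> span (u ` {..<k})" by (auto intro: span_sum span_scale span_base)
  have "subspace {z. dot n (x - ?y) z = 0}"
    by (auto simp: subspace_def dot_add_right dot_scaleR_right dot_sym[of n _ 0])
  moreover have "u ` {..<k} \<subseteq> {z. dot n (x - ?y) z = 0}"
    using orthonormal_combination[OF u, of _ "\<lambda>i. dot n x (u i)"] by (auto simp: dot_diff_left)
  ultimately show "\<forall>z\<in>span (u ` {..<k}). dot n (x - ?y) z = 0" using span_minimal by blast
qed

lemma orth_proj_span:
  assumes u: "orthonormal n k u"
  shows "orth_proj n (span (u ` {..<k})) x = (\<Sum>i<k. dot n x (u i) *\<^sub>R u i)"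
proof (rule orth_proj_eqI[OF subspace_span _ orthonormal_projection[OF u]])
  show "span (u ` {..<k}) \<subseteq> Rn n" using u by (intro span_minimal subspace_Rn) (auto simp: orthonormal_def)
qed

lemma orth_proj_spec:
  assumes "E \<in> grassmannian n k"
  shows "orth_proj n E x \<in> E" "\<forall>z\<in>E. dot n (x - orth_proj n E x) z = 0"
proof -
  obtain u where u: "orthonormal n n u" "E = span (u ` {..<k})" "k \<le> n"
    using grassmannian_adapted_basis[OF assms] .
  have uk: "orthonormal n k u" using u by (auto simp: orthonormal_def)
  show "orth_proj n E x \<in> E" "\<forall>z\<in>E. dot n (x - orth_proj n E x) z = 0"
    using orthonormal_projection[OF uk, of x] orth_proj_span[OF uk, of x] u(2) by simp_all
qed

lemma orth_proj_rot:
  assumes u: "orthonormal n n u" and E: "E \<in> grassmannian n k" and x: "x \<in> Rn n"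
  shows "orth_proj n (rot n u ` E) (rot n u x) = rot n u (orth_proj n E x)"
proof (rule orth_proj_eqI)
  have G: "rot n u ` E \<in> grassmannian n k" by (rule rot_image_grassmannian[OF u E])
  then show "subspace (rot n u ` E)" "rot n u ` E \<subseteq> Rn n" by (auto simp: grassmannian_def)
  have ER: "E \<subseteq> Rn n" using E by (simp add: grassmannian_def)
  have d: "x - orth_proj n E x \<in> Rn n"
    using orth_proj_spec(1)[OF E] ER x by (intro subspace_diff subspace_Rn) auto
  show "\<forall>z\<in>rot n u ` E. dot n (rot n u x - rot n u (orth_proj n E x)) z = 0"
    using orth_proj_spec(2)[OF E, of x] by (auto simp: dot_rot[OF u d] simp flip: rot_diff)
qed (use orth_proj_spec(1)[OF E] in simp)

text \<open>
  Identifies the matrix that carries the topology of the Grassmannian with the matrix that acts on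
  vectors; all measurability in \<open>E\<close> rests on this.
\<close>

lemma orth_proj_matrix:
  assumes E: "E \<in> grassmannian n k"
  shows "orth_proj n E x i = (\<Sum>j<n. proj_matrix n E i j * x j)"
proof (cases "i < n")
  case True
  obtain u where u: "orthonormal n n u" "E = span (u ` {..<k})" "k \<le> n"
    using grassmannian_adapted_basis[OF E] .
  have uk: "orthonormal n k u" using u by (auto simp: orthonormal_def)
  have "proj_matrix n E i j = (\<Sum>a<k. u a j * u a i)" if "j < n" for j
    using that True dot_unit_vec[OF that]
    by (simp add: proj_matrix_def u(2) orth_proj_span[OF uk] sum_fun_apply flip: unit_vec_def) (simp add: dot_sym[of n "unit_vec j"])
  then have "(\<Sum>j<n. proj_matrix n E i j * x j) = (\<Sum>j<n. \<Sum>a<k. u a j * u a i * x j)"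
    by (simp add: sum_distrib_right)
  also have "\<dots> = (\<Sum>a<k. \<Sum>j<n. u a j * u a i * x j)" by (rule sum.swap)
  also have "\<dots> = orth_proj n E x i"
    by (simp add: u(2) orth_proj_span[OF uk] dot_def sum_fun_apply sum_distrib_left mult_ac)
  finally show ?thesis ..
next
  case False
  then have "orth_proj n E x i = 0"
    using orth_proj_spec(1)[OF E, of x] E by (auto simp: grassmannian_def Rn_def)
  then show ?thesis using False by (simp add: proj_matrix_def)
qed

lemma dot_orth_proj_Rn:
  assumes "k \<le> n"
  shows "dot n (orth_proj n (Rn k) x) (orth_proj n (Rn k) x) = (\<Sum>i<k. (x i)\<^sup>2)"
proof -
  have "orth_proj n (Rn k) x = (\<Sum>i<k. dot n x (unit_vec i) *\<^sub>R unit_vec i)"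
    using orth_proj_span[OF orthonormal_unit_vec[OF assms]] by (simp add: span_unit_vec)
  also have "\<dots> = (\<Sum>i<k. x i *\<^sub>R unit_vec i)" using assms by (intro sum.cong) (auto simp: dot_unit_vec)
  also have "\<dots> = (\<lambda>i. if i < k then x i else 0)"
    by (auto simp: fun_eq_iff unit_vec_def sum_fun_apply if_distrib[of "(*) _"] cong: if_cong)
  finally have "dot n (orth_proj n (Rn k) x) (orth_proj n (Rn k) x) = (\<Sum>i<n. if i < k then (x i)\<^sup>2 else 0)"
    unfolding dot_def by (auto intro!: sum.cong simp: power2_eq_square)
  also have "\<dots> = (\<Sum>i\<in>{..<n} \<inter> {i. i < k}. (x i)\<^sup>2)" by (simp add: sum.inter_restrict[symmetric] sum.If_cases)
  also have "{..<n} \<inter> {i. i < k} = {..<k}" using assms by auto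
  finally show ?thesis .
qed

section \<open>Projections onto Haar distributed subspaces\<close>

definition nrm :: "nat \<Rightarrow> (nat \<Rightarrow> real) \<Rightarrow> real"
  where "nrm n x = sqrt (dot n x x)"

lemma nrm_eq: "nrm n x = sqrt (\<Sum>i<n. (x i)\<^sup>2)"
  by (simp add: nrm_def dot_def power2_eq_square)

lemma lp_norm_2: "lp_norm 2 n x = nrm n x"
  unfolding lp_norm_def nrm_eq abs_powr_2 by (intro powr_half_sqrt sum_nonneg zero_le_power2)

lemma nrm_nonneg [simp]: "0 \<le> nrm n x"
  by (simp add: nrm_def dot_self_nonneg)

lemma nrm_scaleR: "nrm n (c *\<^sub>R x) = \<bar>c\<bar> * nrm n x"
proof -
  have "dot n (c *\<^sub>R x) (c *\<^sub>R x) = c\<^sup>2 * dot n x x"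
    by (simp add: dot_scaleR_left dot_scaleR_right power2_eq_square)
  then show ?thesis by (simp add: nrm_def real_sqrt_mult)
qed

lemma nrm_pos:
  assumes "x \<in> Rn n" "x \<noteq> 0" shows "0 < nrm n x"
proof -
  have "dot n x x \<noteq> 0" using assms dot_self_eq_0 by blast
  then have "0 < dot n x x" using dot_self_nonneg[of n x] by linarith
  then show ?thesis by (simp add: nrm_def)
qed

lemma measurable_nrm [measurable (raw)]:
  "f \<in> borel_measurable M \<Longrightarrow> (\<lambda>x. nrm n (f x)) \<in> borel_measurable M"
  unfolding nrm_def by measurable

lemma space_grassmannian_borel [simp]: "space (grassmannian_borel n k) = grassmannian n k"
  by (simp add: grassmannian_borel_def space_measure_of_conv)

lemma grassmannian_open_sets: "{U. openin (grassmannian_topology n k) U} \<subseteq> Pow (grassmannian n k)"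
  by (auto simp: grassmannian_topology_def openin_pullback_topology)

lemma measurable_proj_matrix: "proj_matrix n \<in> borel_measurable (grassmannian_borel n k)"
proof (rule borel_measurableI)
  fix S :: "(nat \<Rightarrow> nat \<Rightarrow> real) set" assume "open S"
  then have "openin (grassmannian_topology n k) (proj_matrix n -` S \<inter> grassmannian n k)"
    by (auto simp: grassmannian_topology_def openin_pullback_topology)
  then show "proj_matrix n -` S \<inter> space (grassmannian_borel n k) \<in> sets (grassmannian_borel n k)"
    unfolding space_grassmannian_borel unfolding grassmannian_borel_def
    by (intro in_measure_of[OF grassmannian_open_sets]) simp
qed

lemma measurable_proj_matrix_entry [measurable]:
  "(\<lambda>E. proj_matrix n E i j) \<in> borel_measurable (grassmannian_borel n k)"
  by (rule measurable_product_then_coordinatewise[OF measurable_product_then_coordinatewise[OF measurable_proj_matrix]])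

text \<open>
  The Borel sets of the Grassmannian are pulled back along the projection matrix, so that it suffices
  to look at its entries.
\<close>

lemma measurable_grassmannianI:
  assumes "\<And>x. x \<in> space M \<Longrightarrow> f x \<in> grassmannian n k"
    and entry: "\<And>i j. i < n \<Longrightarrow> j < n \<Longrightarrow> (\<lambda>x. proj_matrix n (f x) i j) \<in> borel_measurable M"
  shows "f \<in> M \<rightarrow>\<^sub>M grassmannian_borel n k"
  unfolding grassmannian_borel_def
proof (rule measurable_measure_of[OF grassmannian_open_sets])
  show f: "f \<in> space M \<rightarrow> grassmannian n k" using assms(1) by auto
  have e: "(\<lambda>x. proj_matrix n (f x) i j) \<in> borel_measurable M" for i j
    using entry[of i j] by (cases "i < n \<and> j < n") (auto simp: proj_matrix_def)
  have m: "(\<lambda>x. proj_matrix n (f x)) \<in> borel_measurable M"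
    by (intro measurable_coordinatewise_then_product e)
  fix U assume "U \<in> {U. openin (grassmannian_topology n k) U}"
  then obtain S where S: "open S" "U = proj_matrix n -` S \<inter> grassmannian n k"
    by (auto simp: grassmannian_topology_def openin_pullback_topology)
  have "f -` U \<inter> space M = (\<lambda>x. proj_matrix n (f x)) -` S \<inter> space M"
    using f S(2) by auto
  also have "\<dots> \<in> sets M" using m S(1) by (intro measurable_sets[OF m]) auto
  finally show "f -` U \<inter> space M \<in> sets M" .
qed

lemma measurable_orth_proj [measurable]:
  "(\<lambda>p. orth_proj n (snd p) (fst p)) \<in> borel_measurable (borel \<Otimes>\<^sub>M grassmannian_borel n k)"
proof (rule measurable_coordinatewise_then_product)
  fix i
  have "(\<lambda>p. \<Sum>j<n. proj_matrix n (snd p) i j * fst p j) \<in> borel_measurable (borel \<Otimes>\<^sub>M grassmannian_borel n k)"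
    by measurable
  moreover have "orth_proj n (snd p) (fst p) i = (\<Sum>j<n. proj_matrix n (snd p) i j * fst p j)"
    if "p \<in> space (borel \<Otimes>\<^sub>M grassmannian_borel n k)" for p
    by (rule orth_proj_matrix[of _ n k]) (use that in \<open>simp add: space_pair_measure mem_Times_iff\<close>)
  ultimately show "(\<lambda>p. orth_proj n (snd p) (fst p) i) \<in> borel_measurable (borel \<Otimes>\<^sub>M grassmannian_borel n k)"
    by (rule iffD2[OF measurable_cong, rotated])
qed

lemma measurable_orth_proj_compose [measurable (raw)]:
  assumes "f \<in> borel_measurable M" "g \<in> M \<rightarrow>\<^sub>M grassmannian_borel n k"
  shows "(\<lambda>x. orth_proj n (g x) (f x)) \<in> borel_measurable M"
  using measurable_compose[OF measurable_Pair[OF assms] measurable_orth_proj] by simp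

lemma orth_proj_scaleR:
  assumes "E \<in> grassmannian n k" shows "orth_proj n E (c *\<^sub>R x) = c *\<^sub>R orth_proj n E x"
proof
  fix i
  show "orth_proj n E (c *\<^sub>R x) i = (c *\<^sub>R orth_proj n E x) i"
    unfolding scaleR_fun_apply orth_proj_matrix[OF assms] by (simp add: sum_distrib_left mult_ac)
qed

lemma orth_proj_Rn_mem:
  assumes "E \<in> grassmannian n k" shows "orth_proj n E x \<in> Rn n"
proof -
  have "E \<subseteq> Rn n" using assms by (simp add: grassmannian_def)
  then show ?thesis using orth_proj_spec(1)[OF assms] by (rule subsetD)
qed

text \<open>
  In the coordinates \<open>u\<close> the projection matrix of the rotated subspace consists of the inner products
  of \<open>orth_proj n E (u j)\<close> with \<open>u i\<close>, which depend measurably on \<open>E\<close>.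
\<close>

lemma measurable_rot_image:
  assumes u: "orthonormal n n u"
  shows "(\<lambda>E. rot n u ` E) \<in> grassmannian_borel n k \<rightarrow>\<^sub>M grassmannian_borel n k"
proof (rule measurable_grassmannianI)
  fix i j assume ij: "i < n" "j < n"
  have "(\<lambda>E. dot n (orth_proj n E (u j)) (u i)) \<in> borel_measurable (grassmannian_borel n k)"
    by measurable
  moreover have "proj_matrix n (rot n u ` E) i j = dot n (orth_proj n E (u j)) (u i)"
    if E: "E \<in> grassmannian n k" for E
  proof -
    have "proj_matrix n (rot n u ` E) i j = orth_proj n (rot n u ` E) (rot n u (u j)) i"
      using ij by (simp add: proj_matrix_def rot_basis[OF u] unit_vec_def)
    also have "\<dots> = rot n u (orth_proj n E (u j)) i"
      using orth_proj_rot[OF u E orthonormal_in_Rn[OF u ij(2)]] by simp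
    finally show ?thesis using ij by (simp add: rot_def)
  qed
  ultimately show "(\<lambda>E. proj_matrix n (rot n u ` E) i j) \<in> borel_measurable (grassmannian_borel n k)"
    by (subst measurable_cong[where g = "\<lambda>E. dot n (orth_proj n E (u j)) (u i)"]) simp_all
qed (use rot_image_grassmannian[OF u] in simp)

lemma nrm_rot: "orthonormal n n u \<Longrightarrow> x \<in> Rn n \<Longrightarrow> nrm n (rot n u x) = nrm n x"
  by (simp add: nrm_def dot_rot)

lemma rotate_to_axis:
  assumes x: "x \<in> Rn n" "x \<noteq> 0"
  obtains u where "orthonormal n n u" "rot n u x = nrm n x *\<^sub>R unit_vec 0"
proof -
  have pos: "0 < nrm n x" using nrm_pos[OF x] .
  have n: "1 \<le> n" using x by (cases n) (auto simp: Rn_def fun_eq_iff)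
  have sq: "dot n x x = nrm n x * nrm n x" by (simp add: nrm_def dot_self_nonneg)
  let ?e = "(1 / nrm n x) *\<^sub>R x"
  have "orthonormal n 1 (\<lambda>_. ?e)"
    using x pos sq by (auto simp: orthonormal_def dot_scaleR_left dot_scaleR_right intro: subspace_scale subspace_Rn)
  from orthonormal_Rn_extend[OF this n] obtain u where u: "orthonormal n n u" "u 0 = ?e" by auto
  have "rot n u x = rot n u (nrm n x *\<^sub>R u 0)" using pos u(2) by simp
  also have "\<dots> = nrm n x *\<^sub>R rot n u (u 0)" by (rule linear_scale[OF linear_rot])
  also have "\<dots> = nrm n x *\<^sub>R unit_vec 0" using rot_basis[OF u(1), of 0] n by simp
  finally show ?thesis using that u(1) by blast
qed

text \<open>
  Rotating \<open>x\<close> to a multiple of the first unit vector does not change the law of \<open>E\<close>. Hence the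
  fraction of the length of \<open>x\<close> that survives the projection has the same law for every \<open>x\<close>.
\<close>

lemma haar_projection_isotropic:
  assumes haar: "grassmannian_haar n k \<mu>" and x: "x \<in> Rn n" "x \<noteq> 0" and [measurable]: "C \<in> sets borel"
  shows "emeasure \<mu> {E \<in> space \<mu>. nrm n (orth_proj n E x) / nrm n x \<in> C}
    = emeasure \<mu> {E \<in> space \<mu>. nrm n (orth_proj n E (unit_vec 0)) \<in> C}"
proof -
  have sets_\<mu>[measurable_cong]: "sets \<mu> = sets (grassmannian_borel n k)" using haar by (simp add: grassmannian_haar_def)
  have space_\<mu>: "space \<mu> = grassmannian n k" using sets_eq_imp_space_eq[OF sets_\<mu>] by simp
  obtain u where u: "orthonormal n n u" "rot n u x = nrm n x *\<^sub>R unit_vec 0" using rotate_to_axis[OF x] .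
  have pos: "0 < nrm n x" using nrm_pos[OF x] .
  have [measurable]: "(\<lambda>E. rot n u ` E) \<in> \<mu> \<rightarrow>\<^sub>M grassmannian_borel n k"
    using measurable_rot_image[OF u(1)] by measurable
  let ?A = "{E \<in> grassmannian n k. nrm n (orth_proj n E (unit_vec 0)) \<in> C}"
  have "?A = {E \<in> space (grassmannian_borel n k). nrm n (orth_proj n E (unit_vec 0)) \<in> C}" by simp
  also have "\<dots> \<in> sets (grassmannian_borel n k)" by measurable
  finally have A: "?A \<in> sets (grassmannian_borel n k)" .
  have "distr \<mu> (grassmannian_borel n k) (\<lambda>E. rot n u ` E) = \<mu>"
    using haar rot_orth_group[OF u(1)] by (simp add: grassmannian_haar_def)
  then have "emeasure \<mu> ?A = emeasure (distr \<mu> (grassmannian_borel n k) (\<lambda>E. rot n u ` E)) ?A" by simp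
  also have "\<dots> = emeasure \<mu> ((\<lambda>E. rot n u ` E) -` ?A \<inter> space \<mu>)"
    by (rule emeasure_distr[OF _ A]) measurable
  also have "(\<lambda>E. rot n u ` E) -` ?A \<inter> space \<mu> = {E \<in> space \<mu>. nrm n (orth_proj n E x) / nrm n x \<in> C}"
  proof -
    have "nrm n (orth_proj n (rot n u ` E) (unit_vec 0)) = nrm n (orth_proj n E x) / nrm n x"
      if E: "E \<in> grassmannian n k" for E
    proof -
      have e: "unit_vec 0 = (1 / nrm n x) *\<^sub>R rot n u x" using u(2) pos by simp
      have "nrm n (orth_proj n (rot n u ` E) (unit_vec 0)) = nrm n (orth_proj n (rot n u ` E) (rot n u x)) / nrm n x"
        unfolding e using pos by (simp add: orth_proj_scaleR[OF rot_image_grassmannian[OF u(1) E]] nrm_scaleR)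
      then show ?thesis by (simp add: orth_proj_rot[OF u(1) E x(1)] nrm_rot[OF u(1) orth_proj_Rn_mem[OF E]])
    qed
    then show ?thesis using rot_image_grassmannian[OF u(1)] by (auto simp: space_\<mu>)
  qed
  finally show ?thesis by (simp add: space_\<mu>)
qed

lemma AE_lebesgue_Rn_nonzero:
  assumes "1 \<le> n" shows "AE x in lebesgue_Rn n. x \<noteq> 0"
proof -
  have [measurable]: "{x::nat \<Rightarrow> real. x 0 = 0} \<in> sets borel" by measurable
  let ?h = "\<lambda>i::nat. if i = 0 then indicator {0::real} else (\<lambda>_. 1 :: ennreal)"
  have [measurable]: "?h i \<in> borel_measurable borel" for i by (cases "i = 0") auto
  have "emeasure (lebesgue_Rn n) {x. x 0 = 0} = (\<integral>\<^sup>+x. indicator {x. x 0 = 0} x \<partial>lebesgue_Rn n)" by simp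
  also have "\<dots> = (\<integral>\<^sup>+x. (\<Prod>i<n. ?h i (x i)) \<partial>lebesgue_Rn n)"
  proof (intro nn_integral_cong)
    fix x :: "nat \<Rightarrow> real"
    have "(\<Prod>i<n. ?h i (x i)) = (\<Prod>i\<in>{0}. ?h i (x i))"
      using assms by (intro prod.mono_neutral_right) auto
    then show "indicator {x. x 0 = 0} x = (\<Prod>i<n. ?h i (x i))" by (simp add: indicator_def)
  qed
  also have "\<dots> = (\<Prod>i<n. \<integral>\<^sup>+t. ?h i t \<partial>lborel)" by (rule nn_integral_lebesgue_Rn_prod) measurable
  also have "\<dots> = 0" using assms by (intro prod_zero bexI[of _ 0]) auto
  finally have "AE x in lebesgue_Rn n. x \<notin> {x. x 0 = 0}" by (intro AE_not_in) auto
  then show ?thesis by eventually_elim auto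
qed

text \<open>
  The same principle with the roles exchanged: for a fixed subspace, a rotation that carries it to
  the first \<open>k\<close> coordinates preserves the Gaussian law of the vector.
\<close>

lemma gauss_projection_isotropic:
  assumes E: "E \<in> grassmannian n k" and [measurable]: "C \<in> sets borel"
  shows "(\<integral>\<^sup>+g. indicator C (nrm n (orth_proj n E g) / nrm n g) * gauss_density n g \<partial>lebesgue_Rn n)
    = (\<integral>\<^sup>+g. indicator C (sqrt (\<Sum>i<k. (g i)\<^sup>2) / sqrt (\<Sum>i<n. (g i)\<^sup>2)) * gauss_density n g \<partial>lebesgue_Rn n)"
proof -
  obtain u where u: "orthonormal n n u" "E = span (u ` {..<k})" "k \<le> n"
    using grassmannian_adapted_basis[OF E] .
  have [measurable]: "rot n u \<in> borel_measurable borel"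
    by (intro measurable_coordinatewise_then_product) (simp add: rot_def)
  have "rot n u ` E = span ((\<lambda>i. rot n u (u i)) ` {..<k})" by (simp add: u(2) rot_image_span image_image)
  also have "(\<lambda>i. rot n u (u i)) ` {..<k} = unit_vec ` {..<k}"
    using u(3) by (intro image_cong refl rot_basis[OF u(1)]) auto
  finally have TE: "rot n u ` E = Rn k" by (simp add: span_unit_vec)
  let ?f = "\<lambda>g. indicator C (sqrt (\<Sum>i<k. (g i)\<^sup>2) / sqrt (\<Sum>i<n. (g i)\<^sup>2)) * gauss_density n g"
  have "(\<integral>\<^sup>+g. indicator C (nrm n (orth_proj n E g) / nrm n g) * gauss_density n g \<partial>lebesgue_Rn n)
    = (\<integral>\<^sup>+g. ?f (rot n u g) \<partial>lebesgue_Rn n)"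
    using AE_lebesgue_Rn[of n]
  proof (intro nn_integral_cong_AE, eventually_elim)
    case (elim g)
    have "nrm n (orth_proj n E g) = nrm n (rot n u (orth_proj n E g))"
      by (simp add: nrm_rot[OF u(1) orth_proj_Rn_mem[OF E]])
    also have "\<dots> = nrm n (orth_proj n (Rn k) (rot n u g))"
      using orth_proj_rot[OF u(1) E elim(2)] TE by simp
    also have "\<dots> = sqrt (\<Sum>i<k. (rot n u g i)\<^sup>2)"
      by (simp add: nrm_def dot_orth_proj_Rn[OF u(3)])
    finally have 1: "nrm n (orth_proj n E g) = sqrt (\<Sum>i<k. (rot n u g i)\<^sup>2)" .
    have 2: "nrm n g = sqrt (\<Sum>i<n. (rot n u g i)\<^sup>2)"
      using nrm_rot[OF u(1) elim(2)] by (simp add: nrm_def dot_def power2_eq_square)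
    have 3: "gauss_density n g = gauss_density n (rot n u g)" using dot_rot[OF u(1) elim(2)] by (simp add: gauss_density_eq)
    show ?case unfolding 1 2 by (simp only: 3)
  qed
  also have "\<dots> = (\<integral>\<^sup>+g. ?f g \<partial>lebesgue_Rn n)"
    by (rule nn_integral_lebesgue_Rn_rotate[OF _ _ rot_diff rot_Rn rot_surj[OF u(1)] dot_rot[OF u(1)]]) measurable
  finally show ?thesis .
qed

text \<open>
  Average the fraction of the length over a random subspace and an independent Gaussian vector. If
  the vector is kept fixed, the law does not depend on it; if the subspace is kept fixed, it is that
  of the first \<open>k\<close> Gaussian coordinates. By Fubini the two laws agree, which yields the law of the
  fraction without constructing the Haar measure.
\<close>

lemma haar_projection_law:
  assumes haar: "grassmannian_haar n k \<mu>" and n: "1 \<le> n" and [measurable]: "C \<in> sets borel"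
  shows "emeasure \<mu> {E \<in> space \<mu>. nrm n (orth_proj n E (unit_vec 0)) \<in> C}
    = (\<integral>\<^sup>+g. indicator C (sqrt (\<Sum>i<k. (g i)\<^sup>2) / sqrt (\<Sum>i<n. (g i)\<^sup>2)) * gauss_density n g \<partial>lebesgue_Rn n)"
proof -
  have sets_\<mu>[measurable_cong]: "sets \<mu> = sets (grassmannian_borel n k)" using haar by (simp add: grassmannian_haar_def)
  have space_\<mu>: "space \<mu> = grassmannian n k" using sets_eq_imp_space_eq[OF sets_\<mu>] by simp
  have prob: "prob_space \<mu>" using haar by (simp add: grassmannian_haar_def)
  interpret prob_space \<mu> by (rule prob)
  interpret L: sigma_finite_measure "lebesgue_Rn n" by (rule sigma_finite_lebesgue_Rn)
  interpret pair_sigma_finite "lebesgue_Rn n" \<mu> ..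
  let ?F = "\<lambda>g E. indicator C (nrm n (orth_proj n E g) / nrm n g) * gauss_density n g"
  have [measurable]: "(\<lambda>p. orth_proj n (snd p) (fst p)) \<in> borel_measurable (lebesgue_Rn n \<Otimes>\<^sub>M \<mu>)"
    by (subst measurable_cong_sets[OF sets_pair_measure_cong[OF sets_lebesgue_Rn sets_\<mu>] refl]) (rule measurable_orth_proj)
  have meas: "(\<lambda>(g, E). ?F g E) \<in> borel_measurable (lebesgue_Rn n \<Otimes>\<^sub>M \<mu>)"
    unfolding case_prod_beta by measurable
  have meas1: "{E \<in> space \<mu>. nrm n (orth_proj n E g) / nrm n g \<in> C} \<in> sets \<mu>" for g
    by measurable
  let ?m = "emeasure \<mu> {E \<in> space \<mu>. nrm n (orth_proj n E (unit_vec 0)) \<in> C}"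
  have "?m = (\<integral>\<^sup>+g. ?m * gauss_density n g \<partial>lebesgue_Rn n)"
    by (subst nn_integral_cmult) (auto simp: nn_integral_gauss_density)
  also have "\<dots> = (\<integral>\<^sup>+g. (\<integral>\<^sup>+E. ?F g E \<partial>\<mu>) \<partial>lebesgue_Rn n)"
    using AE_lebesgue_Rn[of n] AE_lebesgue_Rn_nonzero[OF n]
  proof (intro nn_integral_cong_AE, eventually_elim)
    case (elim g)
    have "(\<integral>\<^sup>+E. ?F g E \<partial>\<mu>) = (\<integral>\<^sup>+E. indicator {E \<in> space \<mu>. nrm n (orth_proj n E g) / nrm n g \<in> C} E * gauss_density n g \<partial>\<mu>)"
      by (intro nn_integral_cong) (auto simp: indicator_def)
    also have "\<dots> = emeasure \<mu> {E \<in> space \<mu>. nrm n (orth_proj n E g) / nrm n g \<in> C} * gauss_density n g"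
      using meas1[of g] by (subst nn_integral_multc) auto
    finally show ?case using haar_projection_isotropic[OF haar elim(3,4), of C] by simp
  qed
  also have "\<dots> = (\<integral>\<^sup>+E. (\<integral>\<^sup>+g. ?F g E \<partial>lebesgue_Rn n) \<partial>\<mu>)"
    by (rule Fubini'[symmetric, OF meas])
  also have "\<dots> = (\<integral>\<^sup>+E. (\<integral>\<^sup>+g. indicator C (sqrt (\<Sum>i<k. (g i)\<^sup>2) / sqrt (\<Sum>i<n. (g i)\<^sup>2)) * gauss_density n g \<partial>lebesgue_Rn n) \<partial>\<mu>)"
    by (intro nn_integral_cong gauss_projection_isotropic) (auto simp: space_\<mu>)
  finally show ?thesis by (simp add: emeasure_space_1)
qed

lemma indep_rvs_distr_pair:
  assumes M: "prob_space M" and ind: "indep_rvs M S X T Y"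
  shows "distr M (S \<Otimes>\<^sub>M T) (\<lambda>\<omega>. (X \<omega>, Y \<omega>)) = distr M S X \<Otimes>\<^sub>M distr M T Y"
proof -
  interpret prob_space M by (rule M)
  have X[measurable]: "X \<in> M \<rightarrow>\<^sub>M S" and Y[measurable]: "Y \<in> M \<rightarrow>\<^sub>M T"
    and set: "indep_set (sigma_sets (space M) {X -` A \<inter> space M | A. A \<in> sets S})
      (sigma_sets (space M) {Y -` A \<inter> space M | A. A \<in> sets T})"
    using ind by (auto simp: indep_rvs_def)
  interpret PX: prob_space "distr M S X" by (rule prob_space_distr) fact
  interpret PY: prob_space "distr M T Y" by (rule prob_space_distr) fact
  show ?thesis
  proof (rule pair_measure_eqI[symmetric])
    fix A B assume AB: "A \<in> sets (distr M S X)" "B \<in> sets (distr M T Y)"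
    then have [measurable]: "A \<in> sets S" "B \<in> sets T" by auto
    have "prob ((X -` A \<inter> space M) \<inter> (Y -` B \<inter> space M)) = prob (X -` A \<inter> space M) * prob (Y -` B \<inter> space M)"
      using AB by (intro indep_setD[OF set] sigma_sets.Basic) auto
    then have "emeasure M ((X -` A \<inter> space M) \<inter> (Y -` B \<inter> space M))
      = emeasure M (X -` A \<inter> space M) * emeasure M (Y -` B \<inter> space M)"
      by (simp add: emeasure_eq_measure ennreal_mult)
    moreover have "(\<lambda>\<omega>. (X \<omega>, Y \<omega>)) -` (A \<times> B) \<inter> space M = (X -` A \<inter> space M) \<inter> (Y -` B \<inter> space M)" by auto
    ultimately show "emeasure (distr M S X) A * emeasure (distr M T Y) B
      = emeasure (distr M (S \<Otimes>\<^sub>M T) (\<lambda>\<omega>. (X \<omega>, Y \<omega>))) (A \<times> B)"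
      by (simp add: emeasure_distr)
  qed (simp_all add: PX.sigma_finite_measure_axioms PY.sigma_finite_measure_axioms cong: sets_pair_measure_cong)
qed

text \<open>
  Given \<open>X\<close>, the fraction of its length that survives has a law that does not depend on \<open>X\<close>;
  therefore it is independent of the length of \<open>X\<close>.
\<close>

lemma projection_joint_law:
  assumes M: "prob_space M" and ind: "indep_rvs M borel X (grassmannian_borel n k) E"
    and haar: "grassmannian_haar n k (distr M (grassmannian_borel n k) E)"
    and AE: "AE x in distr M borel X. x \<in> Rn n \<and> x \<noteq> 0"
    and [measurable]: "A \<in> sets borel" "C \<in> sets borel"
  shows "emeasure M {\<omega> \<in> space M. nrm n (X \<omega>) \<in> A \<and> nrm n (orth_proj n (E \<omega>) (X \<omega>)) / nrm n (X \<omega>) \<in> C}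
    = emeasure M {\<omega> \<in> space M. nrm n (X \<omega>) \<in> A} *
      emeasure (distr M (grassmannian_borel n k) E) {F \<in> grassmannian n k. nrm n (orth_proj n F (unit_vec 0)) \<in> C}"
proof -
  interpret prob_space M by (rule M)
  have X[measurable]: "X \<in> borel_measurable M" and E[measurable]: "E \<in> M \<rightarrow>\<^sub>M grassmannian_borel n k"
    using ind by (auto simp: indep_rvs_def)
  let ?\<mu> = "distr M (grassmannian_borel n k) E" and ?\<nu> = "distr M borel X"
  interpret PX: prob_space ?\<nu> by (rule prob_space_distr) fact
  interpret PE: prob_space ?\<mu> by (rule prob_space_distr) fact
  interpret pair_sigma_finite ?\<nu> ?\<mu> ..
  let ?S = "{p \<in> space (borel \<Otimes>\<^sub>M grassmannian_borel n k). nrm n (fst p) \<in> A \<and> nrm n (orth_proj n (snd p) (fst p)) / nrm n (fst p) \<in> C}"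
  have S[measurable]: "?S \<in> sets (borel \<Otimes>\<^sub>M grassmannian_borel n k)" by measurable
  let ?m = "emeasure ?\<mu> {F \<in> grassmannian n k. nrm n (orth_proj n F (unit_vec 0)) \<in> C}"
  have "{\<omega> \<in> space M. nrm n (X \<omega>) \<in> A \<and> nrm n (orth_proj n (E \<omega>) (X \<omega>)) / nrm n (X \<omega>) \<in> C}
    = (\<lambda>\<omega>. (X \<omega>, E \<omega>)) -` ?S \<inter> space M"
    using measurable_space[OF E] by (auto simp: space_pair_measure)
  then have "emeasure M {\<omega> \<in> space M. nrm n (X \<omega>) \<in> A \<and> nrm n (orth_proj n (E \<omega>) (X \<omega>)) / nrm n (X \<omega>) \<in> C}
    = emeasure (distr M (borel \<Otimes>\<^sub>M grassmannian_borel n k) (\<lambda>\<omega>. (X \<omega>, E \<omega>))) ?S"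
    by (simp add: emeasure_distr)
  also have "\<dots> = emeasure (?\<nu> \<Otimes>\<^sub>M ?\<mu>) ?S" by (simp add: indep_rvs_distr_pair[OF M ind])
  also have "\<dots> = (\<integral>\<^sup>+x. emeasure ?\<mu> (Pair x -` ?S) \<partial>?\<nu>)"
    by (rule PE.emeasure_pair_measure_alt) (simp cong: sets_pair_measure_cong)
  also have "\<dots> = (\<integral>\<^sup>+x. indicator {x. nrm n x \<in> A} x * ?m \<partial>?\<nu>)"
    using AE
  proof (intro nn_integral_cong_AE, eventually_elim)
    case (elim x)
    have "Pair x -` ?S = (if nrm n x \<in> A then {F \<in> space ?\<mu>. nrm n (orth_proj n F x) / nrm n x \<in> C} else {})"
      by (auto simp: space_pair_measure)
    then show ?case using haar_projection_isotropic[OF haar, of x C] elim by simp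
  qed
  also have "\<dots> = emeasure ?\<nu> {x. nrm n x \<in> A} * ?m"
    by (subst nn_integral_multc) auto
  also have "emeasure ?\<nu> {x. nrm n x \<in> A} = emeasure M {\<omega> \<in> space M. nrm n (X \<omega>) \<in> A}"
    by (subst emeasure_distr) (auto intro!: arg_cong[where f = "emeasure M"])
  finally show ?thesis .
qed

section \<open>Product laws and deviations of chi-square sums\<close>

definition is_density :: "(real \<Rightarrow> real) \<Rightarrow> bool"
  where "is_density f \<longleftrightarrow> f \<in> borel_measurable borel \<and> (\<forall>t. 0 \<le> f t) \<and> (\<integral>\<^sup>+t. ennreal (f t) \<partial>lborel) = 1"

definition prod_law :: "nat \<Rightarrow> (nat \<Rightarrow> real \<Rightarrow> real) \<Rightarrow> (nat \<Rightarrow> real) measure"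
  where "prod_law n f = density (lebesgue_Rn n) (\<lambda>x. \<Prod>i<n. ennreal (f i (x i)))"

lemma is_densityD:
  assumes "is_density f"
  shows "f \<in> borel_measurable borel" "0 \<le> f t" "(\<integral>\<^sup>+t. ennreal (f t) \<partial>lborel) = 1"
  using assms by (auto simp: is_density_def)

lemma sets_prod_law [simp, measurable_cong]: "sets (prod_law n f) = sets borel"
  and space_prod_law [simp]: "space (prod_law n f) = UNIV"
  by (simp_all add: prod_law_def)

lemma nn_integral_prod_law:
  fixes h :: "nat \<Rightarrow> real \<Rightarrow> ennreal"
  assumes f: "\<And>i. is_density (f i)" and [measurable]: "\<And>i. h i \<in> borel_measurable borel"
  shows "(\<integral>\<^sup>+x. (\<Prod>i<n. h i (x i)) \<partial>prod_law n f) = (\<Prod>i<n. \<integral>\<^sup>+t. ennreal (f i t) * h i t \<partial>lborel)"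
proof -
  note [measurable] = is_densityD(1)[OF f]
  have "(\<integral>\<^sup>+x. (\<Prod>i<n. h i (x i)) \<partial>prod_law n f) = (\<integral>\<^sup>+x. (\<Prod>i<n. ennreal (f i (x i))) * (\<Prod>i<n. h i (x i)) \<partial>lebesgue_Rn n)"
    unfolding prod_law_def by (rule nn_integral_density) measurable
  also have "\<dots> = (\<integral>\<^sup>+x. (\<Prod>i<n. ennreal (f i (x i)) * h i (x i)) \<partial>lebesgue_Rn n)"
    by (simp only: prod.distrib)
  also have "\<dots> = (\<Prod>i<n. \<integral>\<^sup>+t. ennreal (f i t) * h i t \<partial>lborel)"
    by (rule nn_integral_lebesgue_Rn_prod) measurable
  finally show ?thesis .
qed

lemma prob_space_prod_law:
  assumes "\<And>i. is_density (f i)" shows "prob_space (prod_law n f)"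
proof
  have "emeasure (prod_law n f) (space (prod_law n f)) = (\<integral>\<^sup>+x. (\<Prod>i<n. 1) \<partial>prod_law n f)" by simp
  also have "\<dots> = 1" by (subst nn_integral_prod_law[OF assms]) (simp_all add: is_densityD(3)[OF assms])
  finally show "emeasure (prod_law n f) (space (prod_law n f)) = 1" .
qed

text \<open>
  Chernoff's bound: a product function that dominates the indicator of \<open>A\<close> up to a constant has a
  product as its integral.
\<close>

lemma prod_law_le:
  assumes f: "\<And>i. is_density (f i)" and A: "A \<in> sets borel"
    and h[measurable]: "\<And>i. h i \<in> borel_measurable borel" and h0: "\<And>i t. 0 \<le> h i t"
    and dom: "\<And>x. x \<in> A \<Longrightarrow> 1 \<le> C * (\<Prod>i<n. h i (x i))"
    and b: "\<And>i. i < n \<Longrightarrow> (\<integral>\<^sup>+t. ennreal (f i t * h i t) \<partial>lborel) \<le> ennreal (b i)"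
    and C: "0 \<le> C" and b0: "\<And>i. i < n \<Longrightarrow> 0 \<le> b i"
  shows "measure (prod_law n f) A \<le> C * (\<Prod>i<n. b i)"
proof -
  interpret prob_space "prod_law n f" by (rule prob_space_prod_law[OF f])
  have "emeasure (prod_law n f) A = (\<integral>\<^sup>+x. indicator A x \<partial>prod_law n f)" using A by simp
  also have "\<dots> \<le> (\<integral>\<^sup>+x. ennreal C * (\<Prod>i<n. ennreal (h i (x i))) \<partial>prod_law n f)"
  proof (rule nn_integral_mono)
    fix x
    show "indicator A x \<le> ennreal C * (\<Prod>i<n. ennreal (h i (x i)))"
      using dom[of x] C h0 by (cases "x \<in> A") (simp_all add: prod_ennreal prod_nonneg flip: ennreal_mult)
  qed
  also have "\<dots> = ennreal C * (\<Prod>i<n. \<integral>\<^sup>+t. ennreal (f i t) * ennreal (h i t) \<partial>lborel)"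
    by (subst nn_integral_cmult, measurable) (simp only: nn_integral_prod_law[OF f, of "\<lambda>i t. ennreal (h i t)"] measurable_compose[OF h] measurable_ennreal)
  also have "\<dots> \<le> ennreal C * (\<Prod>i<n. ennreal (b i))"
    using b by (intro mult_left_mono prod_mono_ennreal) (auto simp: ennreal_mult is_densityD(2)[OF f] h0)
  also have "\<dots> = ennreal (C * (\<Prod>i<n. b i))"
  proof -
    have "(\<Prod>i<n. ennreal (b i)) = ennreal (\<Prod>i<n. b i)" by (rule prod_ennreal) (simp add: b0)
    moreover have "0 \<le> (\<Prod>i<n. b i)" by (rule prod_nonneg) (simp add: b0)
    ultimately show ?thesis using C by (simp add: ennreal_mult)
  qed
  finally have "ennreal (prob A) \<le> ennreal (C * (\<Prod>i<n. b i))" by (simp only: emeasure_eq_measure)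
  moreover have "0 \<le> (\<Prod>i<n. b i)" by (rule prod_nonneg) (simp add: b0)
  ultimately show ?thesis using C by (subst (asm) ennreal_le_iff) (rule mult_nonneg_nonneg)
qed

lemma prod_if_less:
  fixes k n :: nat and a :: "nat \<Rightarrow> 'b::comm_monoid_mult"
  shows "k \<le> n \<Longrightarrow> (\<Prod>i<n. if i < k then a i else 1) = (\<Prod>i<k. a i)"
proof -
  assume "k \<le> n"
  then have "{..<n} \<inter> {i. i < k} = {..<k}" by auto
  then show ?thesis by (simp add: prod.If_cases)
qed

lemma is_density_normal: "0 < \<sigma> \<Longrightarrow> is_density (normal_density 0 \<sigma>)"
  unfolding is_density_def
  by (subst nn_integral_eq_integral) (auto intro: integrable_normal_density)

text \<open>
  Exponential tilting of a centred Gaussian law by the square changes only its variance, here by the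
  factor \<open>r\<close>.
\<close>

lemma normal_density_tilt:
  assumes "0 < v" "0 < r"
  shows "normal_density 0 (sqrt v) x * exp ((1 - 1 / r) / (2 * v) * x\<^sup>2) = sqrt r * normal_density 0 (sqrt (v * r)) x"
proof -
  have e: "- x\<^sup>2 / (2 * v) + (1 - 1 / r) / (2 * v) * x\<^sup>2 = - x\<^sup>2 / (2 * (v * r))"
    using assms by (simp add: field_simps)
  have "exp (- x\<^sup>2 / (2 * v)) * exp ((1 - 1 / r) / (2 * v) * x\<^sup>2) = exp (- x\<^sup>2 / (2 * (v * r)))"
    unfolding exp_add[symmetric] e ..
  then show ?thesis using assms
    by (simp add: normal_density_def real_sqrt_mult power_mult_distrib mult.assoc)
qed

text \<open>
  The Cramer rate function of the square of a standard normal variable.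
\<close>

definition chi_rate :: "real \<Rightarrow> real"
  where "chi_rate r = (r - 1) / 2 - ln r / 2"

lemma chi_rate_pos: "0 < r \<Longrightarrow> r \<noteq> 1 \<Longrightarrow> 0 < chi_rate r"
  using ln_le_minus_one[of r] ln_eq_minus_one[of r] by (auto simp: chi_rate_def less_le)

text \<open>
  The sign of \<open>1 - 1 / r\<close> selects the tail, so that both tails are treated at once with the same
  tilt. Only the first \<open>k\<close> factors need to be Gaussian, with an arbitrary variance: in the lower
  bound below, the estimate is applied to a tilted law.
\<close>

lemma chi_square_chernoff:
  assumes f: "\<And>i. is_density (f i)" and fk: "\<And>i. i < k \<Longrightarrow> f i = normal_density 0 (sqrt v)"
    and v: "0 < v" and r: "0 < r" and k: "k \<le> n"
  shows "measure (prod_law n f) {x. 0 \<le> (1 - 1 / r) * ((\<Sum>i<k. (x i)\<^sup>2) - real k * (v * r))}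
    \<le> exp (- (real k * chi_rate r))"
proof -
  define \<alpha> where "\<alpha> = (1 - 1 / r) / (2 * v)"
  let ?A = "{x. 0 \<le> (1 - 1 / r) * ((\<Sum>i<k. (x i)\<^sup>2) - real k * (v * r))}"
  let ?h = "\<lambda>i t. if i < k then exp (\<alpha> * t\<^sup>2) else (1::real)"
  let ?b = "\<lambda>i. if i < k then sqrt r else 1"
  let ?C = "exp (- (\<alpha> * (real k * (v * r))))"
  have "measure (prod_law n f) ?A \<le> ?C * (\<Prod>i<n. ?b i)"
  proof (rule prod_law_le[OF f, where h = ?h])
    show "?A \<in> sets borel" by measurable
    show "1 \<le> ?C * (\<Prod>i<n. ?h i (x i))" if "x \<in> ?A" for x
    proof -
      have "(\<Prod>i<n. ?h i (x i)) = exp (\<Sum>i<k. \<alpha> * (x i)\<^sup>2)"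
        by (simp add: prod_if_less[OF k] exp_sum)
      then have "?C * (\<Prod>i<n. ?h i (x i)) = exp (- (\<alpha> * (real k * (v * r))) + (\<Sum>i<k. \<alpha> * (x i)\<^sup>2))"
        by (simp only: exp_add)
      also have "- (\<alpha> * (real k * (v * r))) + (\<Sum>i<k. \<alpha> * (x i)\<^sup>2) = \<alpha> * ((\<Sum>i<k. (x i)\<^sup>2) - real k * (v * r))"
        by (simp add: sum_distrib_left algebra_simps)
      also have "\<dots> = ((1 - 1 / r) * ((\<Sum>i<k. (x i)\<^sup>2) - real k * (v * r))) / (2 * v)"
        by (simp add: \<alpha>_def)
      finally show ?thesis using that v by simp
    qed
    show "(\<integral>\<^sup>+t. ennreal (f i t * ?h i t) \<partial>lborel) \<le> ennreal (?b i)" if "i < n" for i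
    proof (cases "i < k")
      case True
      have "(\<integral>\<^sup>+t. ennreal (f i t * ?h i t) \<partial>lborel) = (\<integral>\<^sup>+t. ennreal (sqrt r) * ennreal (normal_density 0 (sqrt (v * r)) t) \<partial>lborel)"
      proof (intro nn_integral_cong)
        fix t
        have "f i t * ?h i t = sqrt r * normal_density 0 (sqrt (v * r)) t"
          using True normal_density_tilt[OF v r, of t] by (simp only: fk \<alpha>_def if_True)
        then show "ennreal (f i t * ?h i t) = ennreal (sqrt r) * ennreal (normal_density 0 (sqrt (v * r)) t)"
          using r by (simp only: ennreal_mult normal_density_nonneg real_sqrt_ge_zero less_imp_le)
      qed
      also have "\<dots> = ennreal (sqrt r)"
        using is_densityD(3)[OF is_density_normal[of "sqrt (v * r)"]] v r by (subst nn_integral_cmult) auto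
      finally show ?thesis using True by simp
    qed (simp add: is_densityD(3)[OF f])
  qed (use r in auto)
  also have "(\<Prod>i<n. ?b i) = exp (real k * (ln r / 2))"
    using r by (simp add: prod_if_less[OF k] exp_of_nat_mult ln_sqrt[symmetric])
  also have "?C * exp (real k * (ln r / 2)) = exp (- (real k * chi_rate r))"
  proof -
    have "\<alpha> * (v * r) = (r - 1) / 2" using v r by (simp add: \<alpha>_def field_simps)
    then have "\<alpha> * (real k * (v * r)) = real k * ((r - 1) / 2)" by (metis mult.left_commute)
    then have "- (\<alpha> * (real k * (v * r))) + real k * (ln r / 2) = - (real k * chi_rate r)"
      by (simp add: chi_rate_def algebra_simps)
    then show ?thesis by (simp flip: exp_add)
  qed
  finally show ?thesis .
qed

lemma chi_square_upper_tail:
  assumes "\<And>i. is_density (f i)" "\<And>i. i < k \<Longrightarrow> f i = normal_density 0 (sqrt v)" "0 < v" "1 < r" "k \<le> n"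
  shows "measure (prod_law n f) {x. real k * (v * r) \<le> (\<Sum>i<k. (x i)\<^sup>2)} \<le> exp (- (real k * chi_rate r))"
proof -
  have "{x. 0 \<le> (1 - 1 / r) * ((\<Sum>i<k. (x i)\<^sup>2) - real k * (v * r))} = {x::nat \<Rightarrow> real. real k * (v * r) \<le> (\<Sum>i<k. (x i)\<^sup>2)}"
    using assms(4) by (auto simp: zero_le_mult_iff)
  then show ?thesis using chi_square_chernoff[of f k v r n] assms by simp
qed

lemma chi_square_lower_tail:
  assumes "\<And>i. is_density (f i)" "\<And>i. i < k \<Longrightarrow> f i = normal_density 0 (sqrt v)" "0 < v" "0 < r" "r < 1" "k \<le> n"
  shows "measure (prod_law n f) {x. (\<Sum>i<k. (x i)\<^sup>2) \<le> real k * (v * r)} \<le> exp (- (real k * chi_rate r))"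
proof -
  have "1 - 1 / r < 0" using assms(4,5) by (simp add: field_simps)
  then have "{x. 0 \<le> (1 - 1 / r) * ((\<Sum>i<k. (x i)\<^sup>2) - real k * (v * r))} = {x::nat \<Rightarrow> real. (\<Sum>i<k. (x i)\<^sup>2) \<le> real k * (v * r)}"
    by (auto simp: zero_le_mult_iff)
  then show ?thesis using chi_square_chernoff[of f k v r n] assms by simp
qed

definition gauss_law :: "nat \<Rightarrow> (nat \<Rightarrow> real) measure"
  where "gauss_law n = prod_law n (\<lambda>_. normal_density 0 1)"

lemma gauss_law_eq: "gauss_law n = density (lebesgue_Rn n) (gauss_density n)"
  by (simp add: gauss_law_def prod_law_def gauss_density_def[abs_def])

text \<open>
  Change of measure: if the first \<open>k\<close> variances are \<open>t\<close> instead of \<open>1\<close>, the sum of squares is close to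
  \<open>k t\<close> with probability at least \<open>1 / 2\<close>, and there the two densities differ by a factor of at most
  about \<open>exp (k chi_rate t)\<close>. The bound is uniform in \<open>n\<close>.
\<close>

lemma gauss_sum_lower:
  assumes t: "0 < t" and \<delta>: "0 < \<delta>" and c: "chi_rate t < c"
  shows "\<exists>K. \<forall>k\<ge>K. \<forall>n\<ge>k. exp (- (c * real k)) \<le> measure (gauss_law n) {x. \<bar>(\<Sum>i<k. (x i)\<^sup>2) - real k * t\<bar> < real k * \<delta>}"
proof -
  define \<theta> where "\<theta> = (1 - 1 / t) / 2"
  \<comment> \<open>The window is so narrow that the tilt varies on it by less than the excess of \<open>c\<close> over
    \<open>chi_rate t\<close>.\<close>
  define d where "d = min (min \<delta> (t / 2)) ((c - chi_rate t) / (2 * (\<bar>\<theta>\<bar> + 1)))"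
  have d: "0 < d" "d \<le> \<delta>" "d < t" using t \<delta> c by (auto simp: d_def)
  have "d * (\<bar>\<theta>\<bar> + 1) \<le> (c - chi_rate t) / (2 * (\<bar>\<theta>\<bar> + 1)) * (\<bar>\<theta>\<bar> + 1)"
    by (intro mult_right_mono) (auto simp: d_def)
  also have "\<dots> = (c - chi_rate t) / 2" by (simp add: field_simps)
  finally have d\<theta>: "chi_rate t + d * \<bar>\<theta>\<bar> < c" using d(1) c by (simp add: algebra_simps)
  define c1 where "c1 = chi_rate t + d * \<bar>\<theta>\<bar>"
  define r1 where "r1 = 1 + d / t"
  define r2 where "r2 = 1 - d / t"
  have r: "1 < r1" "0 < r2" "r2 < 1" using d t by (auto simp: r1_def r2_def)
  have cr: "0 < chi_rate r1" "0 < chi_rate r2" using r by (auto intro!: chi_rate_pos)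
  have lim: "((\<lambda>k. exp (- (real k * a))) \<longlongrightarrow> 0) sequentially" if "0 < a" for a
  proof -
    have "(\<lambda>k. (exp (- a)) ^ k) \<longlonglongrightarrow> 0" using that by (intro LIMSEQ_power_zero) auto
    moreover have "(exp (- a)) ^ k = exp (- (real k * a))" for k by (simp flip: exp_of_nat_mult)
    ultimately show ?thesis by simp
  qed
  have "\<forall>\<^sub>F k in sequentially. exp (- (real k * chi_rate r1)) < 1 / 4 \<and> exp (- (real k * chi_rate r2)) < 1 / 4
     \<and> exp (- (real k * (c - c1))) < 1 / 2"
    using cr d\<theta> by (intro eventually_conj order_tendstoD(2)[OF lim]) (auto simp: c1_def)
  then obtain K where K: "\<And>k. k \<ge> K \<Longrightarrow> exp (- (real k * chi_rate r1)) < 1 / 4 \<and> exp (- (real k * chi_rate r2)) < 1 / 4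
     \<and> exp (- (real k * (c - c1))) < 1 / 2"
    unfolding eventually_sequentially by blast
  show ?thesis
  proof (intro exI[of _ K] allI impI)
    fix k n assume kn: "K \<le> k" "k \<le> n"
    define f where "f i = (if i < k then normal_density 0 (sqrt t) else normal_density 0 1)" for i
    have f: "is_density (f i)" for i using t by (simp add: f_def is_density_normal)
    note [measurable] = is_densityD(1)[OF f]
    interpret F: prob_space "prod_law n f" by (rule prob_space_prod_law[OF f])
    interpret G: prob_space "gauss_law n" unfolding gauss_law_def by (rule prob_space_prod_law) (simp add: is_density_normal)
    let ?A = "{x::nat \<Rightarrow> real. \<bar>(\<Sum>i<k. (x i)\<^sup>2) - real k * t\<bar> < real k * d}"
    have [measurable]: "?A \<in> sets borel" by measurable
    have U: "measure (prod_law n f) {x. real k * (t * r1) \<le> (\<Sum>i<k. (x i)\<^sup>2)} \<le> exp (- (real k * chi_rate r1))"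
      using chi_square_upper_tail[of f k t r1 n] f kn r t by (simp add: f_def)
    have L: "measure (prod_law n f) {x. (\<Sum>i<k. (x i)\<^sup>2) \<le> real k * (t * r2)} \<le> exp (- (real k * chi_rate r2))"
      using chi_square_lower_tail[of f k t r2 n] f kn r t by (simp add: f_def)
    have rt: "t * r1 = t + d" "t * r2 = t - d" using t by (auto simp: r1_def r2_def field_simps)
    have sub: "UNIV - ?A \<subseteq> {x. real k * (t * r1) \<le> (\<Sum>i<k. (x i)\<^sup>2)} \<union> {x. (\<Sum>i<k. (x i)\<^sup>2) \<le> real k * (t * r2)}"
      unfolding rt by (auto simp: abs_if algebra_simps not_less split: if_splits)
    have "F.prob (UNIV - ?A) \<le> F.prob ({x. real k * (t * r1) \<le> (\<Sum>i<k. (x i)\<^sup>2)} \<union> {x. (\<Sum>i<k. (x i)\<^sup>2) \<le> real k * (t * r2)})"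
      by (rule F.finite_measure_mono[OF sub]) measurable
    also have "\<dots> \<le> F.prob {x. real k * (t * r1) \<le> (\<Sum>i<k. (x i)\<^sup>2)} + F.prob {x. (\<Sum>i<k. (x i)\<^sup>2) \<le> real k * (t * r2)}"
      by (rule measure_Un_le) measurable
    also have "\<dots> \<le> 1 / 2" using U L K[OF kn(1)] by linarith
    finally have half: "1 / 2 \<le> F.prob ?A" using F.prob_compl[of ?A] by simp
    have "ennreal (exp (- (real k * c1))) * emeasure (prod_law n f) ?A
      = (\<integral>\<^sup>+x. ennreal (exp (- (real k * c1))) * ((\<Prod>i<n. ennreal (f i (x i))) * indicator ?A x) \<partial>lebesgue_Rn n)"
      unfolding prod_law_def by (subst emeasure_density, measurable) (subst nn_integral_cmult, measurable)
    also have "\<dots> \<le> (\<integral>\<^sup>+x. (\<Prod>i<n. ennreal (normal_density 0 1 (x i))) * indicator ?A x \<partial>lebesgue_Rn n)"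
    proof (rule nn_integral_mono)
      fix x :: "nat \<Rightarrow> real"
      show "ennreal (exp (- (real k * c1))) * ((\<Prod>i<n. ennreal (f i (x i))) * indicator ?A x)
        \<le> (\<Prod>i<n. ennreal (normal_density 0 1 (x i))) * indicator ?A x"
      proof (cases "x \<in> ?A")
        case True
        let ?S = "\<Sum>i<k. (x i)\<^sup>2"
        have fi: "normal_density 0 1 (x i) = (if i < k then sqrt t * exp (- (\<theta> * (x i)\<^sup>2)) else 1) * f i (x i)" for i
          using normal_density_tilt[of 1 t "x i"] t
          by (auto simp: f_def \<theta>_def exp_minus field_simps)
        have "(\<Prod>i<n. normal_density 0 1 (x i)) = (\<Prod>i<k. sqrt t * exp (- (\<theta> * (x i)\<^sup>2))) * (\<Prod>i<n. f i (x i))"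
          unfolding fi prod.distrib prod_if_less[OF kn(2)] ..
        also have "(\<Prod>i<k. sqrt t * exp (- (\<theta> * (x i)\<^sup>2))) = exp (real k * (ln t / 2)) * exp (- (\<theta> * ?S))"
          using t by (simp add: prod.distrib exp_of_nat_mult ln_sqrt[symmetric] exp_sum[symmetric] sum_negf sum_distrib_left)
        also have "\<dots> = exp (real k * (ln t / 2) - \<theta> * ?S)" by (simp flip: exp_add)
        finally have eq: "(\<Prod>i<n. normal_density 0 1 (x i)) = exp (real k * (ln t / 2) - \<theta> * ?S) * (\<Prod>i<n. f i (x i))" .
        have "\<theta> * (?S - real k * t) \<le> \<bar>\<theta>\<bar> * \<bar>?S - real k * t\<bar>" by (metis abs_ge_self abs_mult)
        also have "\<dots> \<le> \<bar>\<theta>\<bar> * (real k * d)" using True by (intro mult_left_mono) auto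
        finally have "\<theta> * ?S \<le> real k * (\<theta> * t) + real k * (d * \<bar>\<theta>\<bar>)" by (simp add: algebra_simps)
        moreover have "\<theta> * t = (t - 1) / 2" using t by (simp add: \<theta>_def field_simps)
        moreover have "real k * c1 = real k * ((t - 1) / 2) - real k * (ln t / 2) + real k * (d * \<bar>\<theta>\<bar>)"
          by (simp add: c1_def chi_rate_def algebra_simps)
        ultimately have "- (real k * c1) \<le> real k * (ln t / 2) - \<theta> * ?S" by simp
        then have "exp (- (real k * c1)) * (\<Prod>i<n. f i (x i)) \<le> (\<Prod>i<n. normal_density 0 1 (x i))"
          unfolding eq by (intro mult_right_mono prod_nonneg) (auto simp: is_densityD(2)[OF f])
        then show ?thesis using True
          by (simp add: prod_ennreal is_densityD(2)[OF f] prod_nonneg ennreal_leI flip: ennreal_mult)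
      qed simp
    qed
    also have "\<dots> = emeasure (gauss_law n) ?A"
      unfolding gauss_law_def prod_law_def by (subst emeasure_density) measurable
    finally have le: "exp (- (real k * c1)) * F.prob ?A \<le> G.prob ?A"
      by (simp add: F.emeasure_eq_measure G.emeasure_eq_measure flip: ennreal_mult)
    have "exp (- (c * real k)) = exp (- (real k * (c - c1))) * exp (- (real k * c1))"
      by (simp flip: exp_add add: algebra_simps)
    also have "\<dots> \<le> F.prob ?A * exp (- (real k * c1))"
      using K[OF kn(1)] half by (intro mult_right_mono) auto
    also have "\<dots> \<le> G.prob ?A" using le by (simp add: mult.commute)
    also have "\<dots> \<le> G.prob {x. \<bar>(\<Sum>i<k. (x i)\<^sup>2) - real k * t\<bar> < real k * \<delta>}"
    proof (rule G.finite_measure_mono)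
      show "{x. \<bar>(\<Sum>i<k. (x i)\<^sup>2) - real k * t\<bar> < real k * \<delta>} \<in> sets (gauss_law n)"
        unfolding gauss_law_def by simp
      have "real k * d \<le> real k * \<delta>" using d by (intro mult_left_mono) auto
      then show "?A \<subseteq> {x. \<bar>(\<Sum>i<k. (x i)\<^sup>2) - real k * t\<bar> < real k * \<delta>}" by auto
    qed
    finally show "exp (- (c * real k)) \<le> G.prob {x. \<bar>(\<Sum>i<k. (x i)\<^sup>2) - real k * t\<bar> < real k * \<delta>}" .
  qed
qed

section \<open>Sums of squares of p-Gaussian variables\<close>

lemma exp_le_quadratic:
  fixes u :: real
  assumes "0 \<le> u" shows "exp u \<le> 1 + u + u\<^sup>2 / 2 * exp u"
proof -
  obtain t where t: "\<bar>t\<bar> \<le> \<bar>u\<bar>" "exp u = (\<Sum>m<2. u ^ m / fact m) + exp t / fact 2 * u ^ 2"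
    using Maclaurin_exp_le[of u 2] by blast
  have "exp t * u\<^sup>2 \<le> exp u * u\<^sup>2" using t(1) assms by (intro mult_right_mono) auto
  moreover have "exp u = 1 + u + exp t * u\<^sup>2 / 2" using t(2) by (simp add: numeral_2_eq_2)
  ultimately show ?thesis by (simp add: mult.commute)
qed

lemma exp_minus_le_quadratic:
  fixes u :: real
  assumes "0 \<le> u" shows "exp (- u) \<le> 1 - u + u\<^sup>2 / 2"
proof -
  have q: "1 + u + u\<^sup>2 / 2 \<le> exp u" by (rule exp_lower_Taylor_quadratic[OF assms])
  have "0 < 1 + u + u\<^sup>2 / 2" using assms by (auto intro: add_pos_nonneg)
  have "(1 - u + u\<^sup>2 / 2) * (1 + u + u\<^sup>2 / 2) = 1 + u ^ 4 / 4"
    by (simp add: field_simps power2_eq_square power4_eq_xxxx)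
  also have "\<dots> \<ge> 1" by simp
  finally have ge: "1 \<le> (1 - u + u\<^sup>2 / 2) * (1 + u + u\<^sup>2 / 2)" .
  have pos: "0 \<le> 1 - u + u\<^sup>2 / 2"
    using sum_power2_ge_zero[of "u - 1" 1] by (simp add: power2_eq_square algebra_simps)
  have "1 \<le> (1 - u + u\<^sup>2 / 2) * exp u" using ge mult_left_mono[OF q pos] by linarith
  then show ?thesis by (simp add: exp_minus field_simps)
qed

text \<open>
  For small \<open>\<theta>\<close> an exponential moment is governed by the mean, with an error of order \<open>\<theta>\<^sup>2\<close>. The
  function \<open>E\<close> is kept general in order to include truncated exponentials, and \<open>h\<close> in order to
  allow a remainder that is itself exponentially large.
\<close>

lemma mgf_quadratic:
  assumes f: "is_density f" and [measurable]: "g \<in> borel_measurable borel" "h \<in> borel_measurable borel" "E \<in> borel_measurable borel"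
    and nonneg: "\<And>t. 0 \<le> g t" "\<And>t. 0 \<le> h t" "\<And>t. 0 \<le> E t" and m: "0 \<le> m" and K: "0 \<le> K"
    and gm: "(\<integral>\<^sup>+t. ennreal (f t * g t) \<partial>lborel) = ennreal m"
    and hK: "(\<integral>\<^sup>+t. ennreal (f t * h t) \<partial>lborel) = ennreal K"
    and E: "\<And>t. E t \<le> 1 + \<theta> * g t + \<theta>\<^sup>2 * h t"
  shows "(\<integral>\<^sup>+t. ennreal (f t * E t) \<partial>lborel) \<le> ennreal (exp (\<theta> * m + \<theta>\<^sup>2 * K))"
proof -
  note fD = is_densityD[OF f]
  note [measurable] = fD(1)
  have 1: "has_bochner_integral lborel f 1"
    using fD by (intro has_bochner_integral_nn_integral) auto
  have 2: "has_bochner_integral lborel (\<lambda>t. f t * g t) m"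
    using fD(2) nonneg gm m by (intro has_bochner_integral_nn_integral) auto
  have 3: "has_bochner_integral lborel (\<lambda>t. f t * h t) K"
    using fD(2) nonneg hK K by (intro has_bochner_integral_nn_integral) auto
  have I: "has_bochner_integral lborel (\<lambda>t. f t + \<theta> * (f t * g t) + \<theta>\<^sup>2 * (f t * h t)) (1 + \<theta> * m + \<theta>\<^sup>2 * K)"
    by (intro has_bochner_integral_add has_bochner_integral_mult_right 1 2 3)
  have le: "f t * E t \<le> f t + \<theta> * (f t * g t) + \<theta>\<^sup>2 * (f t * h t)" for t
    using mult_left_mono[OF E[of t] fD(2)[of t]] by (simp add: algebra_simps)
  have "(\<integral>\<^sup>+t. ennreal (f t * E t) \<partial>lborel) \<le> (\<integral>\<^sup>+t. ennreal (f t + \<theta> * (f t * g t) + \<theta>\<^sup>2 * (f t * h t)) \<partial>lborel)"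
    by (intro nn_integral_mono ennreal_leI le)
  also have "\<dots> = ennreal (1 + \<theta> * m + \<theta>\<^sup>2 * K)"
    using I order_trans[OF mult_nonneg_nonneg[OF fD(2) nonneg(3)] le]
    by (subst nn_integral_eq_integral) (auto simp: has_bochner_integral_iff)
  also have "\<dots> \<le> ennreal (exp (\<theta> * m + \<theta>\<^sup>2 * K))"
    using exp_ge_add_one_self[of "\<theta> * m + \<theta>\<^sup>2 * K"] by (intro ennreal_leI) linarith
  finally show ?thesis .
qed

lemma is_density_pgauss: "0 < p \<Longrightarrow> is_density (pgauss p)"
  by (simp add: is_density_def pgauss_nonneg nn_integral_pgauss_1)

abbreviation pgauss_law :: "real \<Rightarrow> nat \<Rightarrow> (nat \<Rightarrow> real) measure"
  where "pgauss_law p n \<equiv> prod_law n (\<lambda>_. pgauss p)"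

lemma prob_space_pgauss_law: "0 < p \<Longrightarrow> prob_space (pgauss_law p n)"
  by (intro prob_space_prod_law is_density_pgauss)

definition fourth_moment :: "real \<Rightarrow> real \<Rightarrow> real"
  where "fourth_moment p s = gen_gamma p 4 s / gen_gamma p 0 (1 / p)"

lemma fourth_moment_pos: "0 < p \<Longrightarrow> 0 < s \<Longrightarrow> 0 < fourth_moment p s"
  by (simp add: fourth_moment_def gen_gamma_pos)

lemma nn_integral_fourth_moment:
  assumes p: "0 < p" and s: "0 < s"
  shows "(\<integral>\<^sup>+t. ennreal (pgauss p t * (t ^ 4 / 2 * exp ((1 / p - s) * \<bar>t\<bar> powr p))) \<partial>lborel) = ennreal (fourth_moment p s / 2)"
proof -
  have 4: "\<bar>t\<bar> powr 4 = t ^ 4" for t :: real by (cases "t = 0") simp_all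
  have "(\<integral>\<^sup>+t. ennreal (pgauss p t * (t ^ 4 / 2 * exp ((1 / p - s) * \<bar>t\<bar> powr p))) \<partial>lborel)
    = (\<integral>\<^sup>+t. ennreal (1 / 2) * ennreal (pgauss p t * (\<bar>t\<bar> powr 4 * exp ((1 / p - s) * \<bar>t\<bar> powr p))) \<partial>lborel)"
    using p by (intro nn_integral_cong, subst ennreal_mult[symmetric]) (auto simp: 4 pgauss_nonneg)
  also have "\<dots> = ennreal (1 / 2) * ennreal (fourth_moment p s)"
    using nn_integral_pgauss[OF p s, of 4] by (subst nn_integral_cmult) (simp_all add: fourth_moment_def)
  also have "\<dots> = ennreal (fourth_moment p s / 2)"
    using fourth_moment_pos[OF p s] by (subst ennreal_mult[symmetric]) auto
  finally show ?thesis .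
qed

lemma exp_mult_prod_exp: "exp a * (\<Prod>i<n. exp b) = exp (a + real n * b)" for a b :: real
  by (simp only: prod_constant card_lessThan exp_of_nat_mult[symmetric] exp_add)

lemma pgauss_mgf_negative:
  assumes p: "0 < p" and l: "0 \<le> l"
  shows "(\<integral>\<^sup>+t. ennreal (pgauss p t * exp (- (l * t\<^sup>2))) \<partial>lborel) \<le> ennreal (exp (- l * Mp2 p + l\<^sup>2 * (fourth_moment p (1 / p) / 2)))"
proof -
  have "(\<integral>\<^sup>+t. ennreal (pgauss p t * exp (- (l * t\<^sup>2))) \<partial>lborel) \<le> ennreal (exp (- l * Mp2 p + (- l)\<^sup>2 * (fourth_moment p (1 / p) / 2)))"
  proof (rule mgf_quadratic[OF is_density_pgauss[OF p], where g = "\<lambda>t. t\<^sup>2" and h = "\<lambda>t. t ^ 4 / 2 * exp ((1 / p - 1 / p) * \<bar>t\<bar> powr p)"])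
    show "exp (- (l * t\<^sup>2)) \<le> 1 + - l * t\<^sup>2 + (- l)\<^sup>2 * (t ^ 4 / 2 * exp ((1 / p - 1 / p) * \<bar>t\<bar> powr p))" for t
    proof -
      have "(l * t\<^sup>2)\<^sup>2 = l\<^sup>2 * t ^ 4" by (simp add: power_mult_distrib flip: power_mult)
      then show ?thesis using exp_minus_le_quadratic[of "l * t\<^sup>2"] l by simp
    qed
    show "0 \<le> fourth_moment p (1 / p) / 2" using fourth_moment_pos[of p "1 / p"] p by simp
  qed (use p Mp2_pos[OF p] nn_integral_pgauss_sq[OF p] nn_integral_fourth_moment[OF p, of "1 / p"] in auto)
  then show ?thesis by simp
qed

text \<open>
  Squares are nonnegative, hence negative exponential moments exist for every \<open>p\<close>, and lower
  deviations of their mean are exponentially unlikely in \<open>n\<close>.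
\<close>

lemma pgauss_sum_lower_tail:
  assumes p: "0 < p" and e: "0 < e"
  shows "\<exists>c>0. \<forall>n. measure (pgauss_law p n) {x. (\<Sum>i<n. (x i)\<^sup>2) \<le> real n * (Mp2 p - e)} \<le> exp (- (c * real n))"
proof -
  define K where "K = fourth_moment p (1 / p) / 2"
  have K: "0 < K" using fourth_moment_pos[of p "1 / p"] p by (simp add: K_def)
  \<comment> \<open>This slope minimizes the exponent \<open>- l * e + l\<^sup>2 * K\<close> per coordinate.\<close>
  define l where "l = e / (2 * K)"
  have l: "0 < l" using K e by (simp add: l_def)
  have "measure (pgauss_law p n) {x. (\<Sum>i<n. (x i)\<^sup>2) \<le> real n * (Mp2 p - e)} \<le> exp (- (l * e / 2 * real n))" for n
  proof -
    have "measure (pgauss_law p n) {x. (\<Sum>i<n. (x i)\<^sup>2) \<le> real n * (Mp2 p - e)}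
      \<le> exp (l * (real n * (Mp2 p - e))) * (\<Prod>i<n. exp (- l * Mp2 p + l\<^sup>2 * K))"
    proof (rule prod_law_le[where h = "\<lambda>i t. exp (- (l * t\<^sup>2))"])
      fix x :: "nat \<Rightarrow> real" assume x: "x \<in> {x. (\<Sum>i<n. (x i)\<^sup>2) \<le> real n * (Mp2 p - e)}"
      have "(\<Prod>i<n. exp (- (l * (x i)\<^sup>2))) = exp (- (l * (\<Sum>i<n. (x i)\<^sup>2)))"
        by (simp add: exp_sum[symmetric] sum_negf sum_distrib_left)
      moreover have "l * (\<Sum>i<n. (x i)\<^sup>2) \<le> l * (real n * (Mp2 p - e))" using x l by (intro mult_left_mono) auto
      ultimately show "1 \<le> exp (l * (real n * (Mp2 p - e))) * (\<Prod>i<n. exp (- (l * (x i)\<^sup>2)))"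
        by (simp flip: exp_add)
    qed (use p l pgauss_mgf_negative[OF p, of l] in \<open>auto simp: is_density_pgauss K_def\<close>)
    also have "\<dots> = exp (l * (real n * (Mp2 p - e)) + real n * (- l * Mp2 p + l\<^sup>2 * K))"
      by (rule exp_mult_prod_exp)
    also have "l * (real n * (Mp2 p - e)) + real n * (- l * Mp2 p + l\<^sup>2 * K) = - (l * e / 2 * real n)"
    proof -
      have "l\<^sup>2 * K = l * e / 2" using K by (simp add: l_def power2_eq_square field_simps)
      then show ?thesis by (simp add: algebra_simps)
    qed
    finally show ?thesis .
  qed
  moreover have "0 < l * e / 2" using l e by simp
  ultimately show ?thesis by blast
qed

text \<open>
  For \<open>p \<ge> 2\<close> the square of a \<open>p\<close>-Gaussian variable still has exponential moments, because
  \<open>t\<^sup>2 \<le> 1 + \<bar>t\<bar>^p\<close>.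
\<close>

lemma pgauss_sum_upper_tail_light:
  assumes p: "2 \<le> p" and e: "0 < e"
  shows "\<exists>c>0. \<forall>n. measure (pgauss_law p n) {x. real n * (Mp2 p + e) \<le> (\<Sum>i<n. (x i)\<^sup>2)} \<le> exp (- (c * real n))"
proof -
  have p0: "0 < p" using p by simp
  \<comment> \<open>One half of the exponent \<open>1 / p\<close> is spent on dominating \<open>exp (l * t\<^sup>2)\<close> in the remainder.\<close>
  define s where "s = 1 / (2 * p)"
  have s: "0 < s" "1 / p - s = s" using p by (auto simp: s_def field_simps)
  define K where "K = exp s * (fourth_moment p s / 2)"
  have K: "0 < K" using fourth_moment_pos[of p s] p s by (simp add: K_def)
  define l where "l = min s (e / (2 * K))"
  have l: "0 < l" "l \<le> s" "l * K \<le> e / 2" using K e s by (auto simp: l_def min_def field_simps)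
  have sq: "t\<^sup>2 \<le> 1 + \<bar>t\<bar> powr p" for t :: real
  proof (cases "\<bar>t\<bar> \<le> 1")
    case True
    then have "t\<^sup>2 \<le> 1" by (simp add: abs_square_le_1)
    then show ?thesis by (simp add: add_increasing2)
  next
    case False
    then have "\<bar>t\<bar> powr 2 \<le> \<bar>t\<bar> powr p" using p by (intro powr_mono) auto
    then show ?thesis using False by simp
  qed
  have mgf: "(\<integral>\<^sup>+t. ennreal (pgauss p t * exp (l * t\<^sup>2)) \<partial>lborel) \<le> ennreal (exp (l * Mp2 p + l\<^sup>2 * K))"
  proof (rule mgf_quadratic[OF is_density_pgauss[OF p0], where g = "\<lambda>t. t\<^sup>2" and h = "\<lambda>t. exp s * (t ^ 4 / 2 * exp ((1 / p - s) * \<bar>t\<bar> powr p))"])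
    show "exp (l * t\<^sup>2) \<le> 1 + l * t\<^sup>2 + l\<^sup>2 * (exp s * (t ^ 4 / 2 * exp ((1 / p - s) * \<bar>t\<bar> powr p)))" for t
    proof -
      have "l * t\<^sup>2 \<le> s * (1 + \<bar>t\<bar> powr p)" using l s sq[of t] by (intro mult_mono) auto
      then have "exp (l * t\<^sup>2) \<le> exp s * exp (s * \<bar>t\<bar> powr p)" by (simp flip: exp_add add: algebra_simps)
      then have "l\<^sup>2 * (t ^ 4 / 2) * exp (l * t\<^sup>2) \<le> l\<^sup>2 * (t ^ 4 / 2) * (exp s * exp (s * \<bar>t\<bar> powr p))"
        by (intro mult_left_mono) auto
      moreover have "(l * t\<^sup>2)\<^sup>2 / 2 * exp (l * t\<^sup>2) = l\<^sup>2 * (t ^ 4 / 2) * exp (l * t\<^sup>2)"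
        by (simp add: power_mult_distrib flip: power_mult)
      moreover have "l\<^sup>2 * (exp s * (t ^ 4 / 2 * exp ((1 / p - s) * \<bar>t\<bar> powr p))) = l\<^sup>2 * (t ^ 4 / 2) * (exp s * exp (s * \<bar>t\<bar> powr p))"
        unfolding s(2) by simp
      moreover have "0 \<le> l * t\<^sup>2" using l by simp
      ultimately show ?thesis using exp_le_quadratic[of "l * t\<^sup>2"] by linarith
    qed
    have "(\<integral>\<^sup>+t. ennreal (pgauss p t * (exp s * (t ^ 4 / 2 * exp ((1 / p - s) * \<bar>t\<bar> powr p)))) \<partial>lborel)
      = (\<integral>\<^sup>+t. ennreal (exp s) * ennreal (pgauss p t * (t ^ 4 / 2 * exp ((1 / p - s) * \<bar>t\<bar> powr p))) \<partial>lborel)"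
      using p0 by (intro nn_integral_cong) (simp add: pgauss_nonneg mult_ac flip: ennreal_mult)
    also have "\<dots> = ennreal K"
      using nn_integral_fourth_moment[OF p0 s(1)] fourth_moment_pos[OF p0 s(1)]
      by (subst nn_integral_cmult) (simp_all add: K_def flip: ennreal_mult)
    finally show "(\<integral>\<^sup>+t. ennreal (pgauss p t * (exp s * (t ^ 4 / 2 * exp ((1 / p - s) * \<bar>t\<bar> powr p)))) \<partial>lborel) = ennreal K" .
  qed (use K p0 Mp2_pos[OF p0] nn_integral_pgauss_sq[OF p0] in auto)
  have "measure (pgauss_law p n) {x. real n * (Mp2 p + e) \<le> (\<Sum>i<n. (x i)\<^sup>2)} \<le> exp (- (l * e / 2 * real n))" for n
  proof -
    have "measure (pgauss_law p n) {x. real n * (Mp2 p + e) \<le> (\<Sum>i<n. (x i)\<^sup>2)}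
      \<le> exp (- (l * (real n * (Mp2 p + e)))) * (\<Prod>i<n. exp (l * Mp2 p + l\<^sup>2 * K))"
    proof (rule prod_law_le[where h = "\<lambda>i t. exp (l * t\<^sup>2)"])
      fix x :: "nat \<Rightarrow> real" assume x: "x \<in> {x. real n * (Mp2 p + e) \<le> (\<Sum>i<n. (x i)\<^sup>2)}"
      have "(\<Prod>i<n. exp (l * (x i)\<^sup>2)) = exp (l * (\<Sum>i<n. (x i)\<^sup>2))"
        by (simp add: exp_sum[symmetric] sum_distrib_left)
      moreover have "l * (real n * (Mp2 p + e)) \<le> l * (\<Sum>i<n. (x i)\<^sup>2)" using x l by (intro mult_left_mono) auto
      ultimately show "1 \<le> exp (- (l * (real n * (Mp2 p + e)))) * (\<Prod>i<n. exp (l * (x i)\<^sup>2))"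
        by (simp flip: exp_add)
    qed (use p0 mgf in \<open>auto simp: is_density_pgauss\<close>)
    also have "\<dots> = exp (- (l * (real n * (Mp2 p + e))) + real n * (l * Mp2 p + l\<^sup>2 * K))"
      by (rule exp_mult_prod_exp)
    also have "\<dots> \<le> exp (- (l * e / 2 * real n))"
    proof -
      have "l\<^sup>2 * K \<le> l * (e / 2)" using l mult_left_mono[OF l(3), of l] by (simp add: power2_eq_square mult.assoc)
      then have "real n * (l\<^sup>2 * K) \<le> real n * (l * (e / 2))" by (rule mult_left_mono) simp
      then show ?thesis by (simp add: algebra_simps)
    qed
    finally show ?thesis .
  qed
  moreover have "0 < l * e / 2" using l e by simp
  ultimately show ?thesis by blast
qed

lemma speed_at_top: "0 < p \<Longrightarrow> filterlim (\<lambda>n. real n powr (p / 2)) at_top sequentially"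
  by real_asymp

text \<open>
  For \<open>p < 2\<close> the squares have stretched exponential tails. Either one of them exceeds \<open>n \<tau>\<close>, with
  the probability claimed up to the negligible factor \<open>n\<close>; or all of them are at most \<open>n \<tau>\<close>, and then
  an exponential moment of the truncated squares exists up to a slope of order \<open>n^(p/2 - 1)\<close>. This
  slope yields the same exponent, and since it tends to zero, its quadratic error is of lower order.
\<close>

lemma pgauss_sum_upper_tail_heavy:
  assumes p: "0 < p" "p < 2" and \<tau>: "0 < \<tau>"
  shows "exp_upper (\<lambda>n. real n powr (p / 2))
    (\<lambda>n. measure (pgauss_law p n) {x. real n * (Mp2 p + \<tau>) \<le> (\<Sum>i<n. (x i)\<^sup>2)}) (ereal (\<tau> powr (p / 2) / p))"
  unfolding exp_upper_def
proof (intro allI impI)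
  fix c assume "ereal c < ereal (\<tau> powr (p / 2) / p)"
  then have c: "c < \<tau> powr (p / 2) / p" by simp
  define R where "R = \<tau> powr (p / 2) / p"
  have R: "0 < R" using p \<tau> by (simp add: R_def)
  \<comment> \<open>A small part \<open>s\<close> of the exponent \<open>1 / p\<close> is sacrificed for integrability; the remaining part
    \<open>q = 1 / p - s\<close> still yields a constant \<open>c'\<close> with \<open>c < c'\<close>.\<close>
  define s where "s = min (1 / (2 * p)) ((R - c) / (2 * (R * p)))"
  have s: "0 < s" "s < 1 / p" "s * p * R \<le> (R - c) / 2"
  proof -
    have "0 < R - c" using c by (simp add: R_def)
    then show "0 < s" using p R by (simp add: s_def)
    have "s \<le> 1 / (2 * p)" by (simp add: s_def)
    also have "\<dots> < 1 / p" using p by (simp add: field_simps)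
    finally show "s < 1 / p" .
    have "s * (p * R) \<le> (R - c) / (2 * (R * p)) * (p * R)" using p R by (intro mult_right_mono) (auto simp: s_def)
    also have "\<dots> = (R - c) / 2" using p R by (simp add: field_simps)
    finally show "s * p * R \<le> (R - c) / 2" by (simp only: mult.assoc)
  qed
  define c' where "c' = (1 - s * p) * R"
  have c': "c < c'"
  proof -
    define x where "x = s * p * R"
    have "c' = R - x" by (simp add: c'_def x_def algebra_simps)
    moreover have "x \<le> (R - c) / 2" using s(3) by (simp only: x_def)
    moreover have "c < R" using c by (simp add: R_def)
    ultimately show ?thesis by (simp add: field_simps)
  qed
  define q where "q = 1 / p - s"
  have q: "0 < q" "q * \<tau> powr (p / 2) = c'" using s p by (auto simp: q_def c'_def R_def field_simps)
  define K where "K = fourth_moment p s / 2"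
  have K: "0 < K" using fourth_moment_pos[of p s] p s by (simp add: K_def)
  define \<kappa> where "\<kappa> = gen_gamma p 0 s / gen_gamma p 0 (1 / p)"
  have \<kappa>: "0 < \<kappa>" using p s by (simp add: \<kappa>_def gen_gamma_pos)
  have bound: "measure (pgauss_law p n) {x. real n * (Mp2 p + \<tau>) \<le> (\<Sum>i<n. (x i)\<^sup>2)}
    \<le> real n * \<kappa> * exp (- (c' * real n powr (p / 2))) + exp (- (c' * real n powr (p / 2)) + (q\<^sup>2 * \<tau> powr (p - 2) * K) * real n powr (p - 1))"
    if n: "n \<ge> 1" for n
  proof -
    define N where "N = real n * \<tau>"
    have N: "0 < N" using n \<tau> by (simp add: N_def)
    have Np: "q * N powr (p / 2) = c' * real n powr (p / 2)" using q(2) \<tau> by (simp add: N_def powr_mult)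
    \<comment> \<open>The largest slope with \<open>l * t\<^sup>2 \<le> q * \<bar>t\<bar> powr p\<close> for all \<open>t\<^sup>2 \<le> N\<close>; equality at \<open>t\<^sup>2 = N\<close> gives
      the exponent \<open>l * N = c' * n powr (p / 2)\<close>.\<close>
    define l where "l = q * N powr (p / 2 - 1)"
    have l: "0 < l" using q N by (simp add: l_def)
    have lt: "l * t\<^sup>2 \<le> q * \<bar>t\<bar> powr p" if "t\<^sup>2 \<le> N" for t
    proof (cases "t = 0")
      case False
      then have t: "0 < t\<^sup>2" by simp
      have "N powr (p / 2 - 1) \<le> (t\<^sup>2) powr (p / 2 - 1)" using that t p by (intro powr_mono2') auto
      then have "N powr (p / 2 - 1) * t\<^sup>2 \<le> (t\<^sup>2) powr (p / 2 - 1) * t\<^sup>2" by (intro mult_right_mono) auto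
      also have "\<dots> = (t\<^sup>2) powr (p / 2)" using powr_add[of "t\<^sup>2" "p / 2 - 1" 1] t by simp
      also have "\<dots> = \<bar>t\<bar> powr p" by (rule square_powr_half)
      finally show ?thesis using q(1) by (simp add: l_def mult.assoc)
    qed (use q in simp)
    let ?E = "\<lambda>t. if t\<^sup>2 \<le> N then exp (l * t\<^sup>2) else 1"
    have mgf: "(\<integral>\<^sup>+t. ennreal (pgauss p t * ?E t) \<partial>lborel) \<le> ennreal (exp (l * Mp2 p + l\<^sup>2 * K))"
    proof (rule mgf_quadratic[OF is_density_pgauss[OF p(1)], where g = "\<lambda>t. t\<^sup>2" and h = "\<lambda>t. t ^ 4 / 2 * exp ((1 / p - s) * \<bar>t\<bar> powr p)"])
      show "?E t \<le> 1 + l * t\<^sup>2 + l\<^sup>2 * (t ^ 4 / 2 * exp ((1 / p - s) * \<bar>t\<bar> powr p))" for t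
      proof (cases "t\<^sup>2 \<le> N")
        case True
        have "l\<^sup>2 * (t ^ 4 / 2) * exp (l * t\<^sup>2) \<le> l\<^sup>2 * (t ^ 4 / 2) * exp (q * \<bar>t\<bar> powr p)"
          using lt[OF True] by (intro mult_left_mono) auto
        moreover have "(l * t\<^sup>2)\<^sup>2 / 2 * exp (l * t\<^sup>2) = l\<^sup>2 * (t ^ 4 / 2) * exp (l * t\<^sup>2)"
          by (simp add: power_mult_distrib flip: power_mult)
        moreover have "l\<^sup>2 * (t ^ 4 / 2 * exp ((1 / p - s) * \<bar>t\<bar> powr p)) = l\<^sup>2 * (t ^ 4 / 2) * exp (q * \<bar>t\<bar> powr p)"
          unfolding q_def by simp
        moreover have "0 \<le> l * t\<^sup>2" using l by simp
        ultimately have "exp (l * t\<^sup>2) \<le> 1 + l * t\<^sup>2 + l\<^sup>2 * (t ^ 4 / 2 * exp ((1 / p - s) * \<bar>t\<bar> powr p))"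
          using exp_le_quadratic[of "l * t\<^sup>2"] by linarith
        then show ?thesis using True by simp
      next
        case False
        have "0 \<le> l * t\<^sup>2 + l\<^sup>2 * (t ^ 4 / 2 * exp ((1 / p - s) * \<bar>t\<bar> powr p))"
          using l by (intro add_nonneg_nonneg mult_nonneg_nonneg) auto
        then show ?thesis using False by simp
      qed
    qed (use K p s Mp2_pos[OF p(1)] nn_integral_pgauss_sq[OF p(1)] nn_integral_fourth_moment[OF p(1) s(1)] in \<open>auto simp: K_def\<close>)
    interpret prob_space "pgauss_law p n" by (rule prob_space_pgauss_law[OF p(1)])
    \<comment> \<open>One big jump, against a truncated sum without any.\<close>
    let ?J = "\<lambda>j. {x::nat \<Rightarrow> real. N < (x j)\<^sup>2}"
    let ?T = "{x::nat \<Rightarrow> real. real n * (Mp2 p + \<tau>) \<le> (\<Sum>i<n. if (x i)\<^sup>2 \<le> N then (x i)\<^sup>2 else 0)}"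
    have jump: "prob (?J j) \<le> \<kappa> * exp (- (c' * real n powr (p / 2)))" if j: "j < n" for j
    proof -
      let ?h = "\<lambda>i t. if i = j then indicat_real {t. N < t\<^sup>2} t else 1"
      let ?b = "\<lambda>i. if i = j then \<kappa> * exp (- (c' * real n powr (p / 2))) else 1"
      have "prob (?J j) \<le> 1 * (\<Prod>i<n. ?b i)"
      proof (rule prod_law_le[where h = ?h])
        fix x assume "x \<in> ?J j"
        then have "(\<Prod>i<n. ?h i (x i)) = (\<Prod>i<n. 1)" by (intro prod.cong) auto
        then show "1 \<le> 1 * (\<Prod>i<n. ?h i (x i))" by simp
      next
        fix i assume "i < n"
        show "(\<integral>\<^sup>+t. ennreal (pgauss p t * ?h i t) \<partial>lborel) \<le> ennreal (?b i)"
        proof (cases "i = j")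
          case True
          have "(\<integral>\<^sup>+t. ennreal (pgauss p t * ?h i t) \<partial>lborel)
            \<le> (\<integral>\<^sup>+t. ennreal (exp (- (c' * real n powr (p / 2)))) * ennreal (pgauss p t * (\<bar>t\<bar> powr 0 * exp ((1 / p - s) * \<bar>t\<bar> powr p))) \<partial>lborel)"
          proof (rule nn_integral_mono)
            fix t
            show "ennreal (pgauss p t * ?h i t) \<le> ennreal (exp (- (c' * real n powr (p / 2)))) * ennreal (pgauss p t * (\<bar>t\<bar> powr 0 * exp ((1 / p - s) * \<bar>t\<bar> powr p)))"
            proof (cases "N < t\<^sup>2")
              case True
              then have t0: "t \<noteq> 0" using N by auto
              have "N powr (p / 2) \<le> (t\<^sup>2) powr (p / 2)" using True N p by (intro powr_mono2) auto
              also have "\<dots> = \<bar>t\<bar> powr p" by (rule square_powr_half)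
              finally have "c' * real n powr (p / 2) \<le> q * \<bar>t\<bar> powr p" using q(1) by (simp flip: Np)
              then have "1 \<le> exp (- (c' * real n powr (p / 2))) * exp (q * \<bar>t\<bar> powr p)" by (simp flip: exp_add)
              then have "pgauss p t * 1 \<le> pgauss p t * (exp (- (c' * real n powr (p / 2))) * exp (q * \<bar>t\<bar> powr p))"
                by (rule mult_left_mono) (rule pgauss_nonneg[OF p(1)])
              then show ?thesis using True t0 \<open>i = j\<close> pgauss_nonneg[OF p(1), of t]
                by (simp add: q_def mult_ac ennreal_leI flip: ennreal_mult)
            qed (use \<open>i = j\<close> in simp)
          qed
          also have "\<dots> = ennreal (exp (- (c' * real n powr (p / 2)))) * ennreal \<kappa>"
            using nn_integral_pgauss[OF p(1) s(1), of 0] by (subst nn_integral_cmult) (simp_all add: \<kappa>_def)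
          also have "\<dots> = ennreal (?b i)" using \<kappa> True by (simp add: mult.commute flip: ennreal_mult)
          finally show ?thesis .
        next
          case False
          then show ?thesis using nn_integral_pgauss_1[OF p(1)] by simp
        qed
      qed (use p \<kappa> in \<open>auto simp: is_density_pgauss\<close>)
      also have "(\<Prod>i<n. ?b i) = \<kappa> * exp (- (c' * real n powr (p / 2)))" using j by simp
      finally show ?thesis by simp
    qed
    have trunc: "prob ?T \<le> exp (- (l * (real n * (Mp2 p + \<tau>)))) * (\<Prod>i<n. exp (l * Mp2 p + l\<^sup>2 * K))"
    proof (rule prod_law_le[where h = "\<lambda>i. ?E"])
      fix x assume x: "x \<in> ?T"
      have "(\<Prod>i<n. ?E (x i)) = (\<Prod>i<n. exp (l * (if (x i)\<^sup>2 \<le> N then (x i)\<^sup>2 else 0)))"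
        by (intro prod.cong) auto
      also have "\<dots> = exp (l * (\<Sum>i<n. if (x i)\<^sup>2 \<le> N then (x i)\<^sup>2 else 0))"
        by (simp add: exp_sum[symmetric] sum_distrib_left)
      finally have "(\<Prod>i<n. ?E (x i)) = exp (l * (\<Sum>i<n. if (x i)\<^sup>2 \<le> N then (x i)\<^sup>2 else 0))" .
      moreover have "l * (real n * (Mp2 p + \<tau>)) \<le> l * (\<Sum>i<n. if (x i)\<^sup>2 \<le> N then (x i)\<^sup>2 else 0)"
        using x l by (intro mult_left_mono) auto
      ultimately show "1 \<le> exp (- (l * (real n * (Mp2 p + \<tau>)))) * (\<Prod>i<n. ?E (x i))"
        by (simp flip: exp_add)
    qed (use p mgf in \<open>auto simp: is_density_pgauss\<close>)
    have "exp (- (l * (real n * (Mp2 p + \<tau>)))) * (\<Prod>i<n. exp (l * Mp2 p + l\<^sup>2 * K))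
      = exp (- (l * (real n * (Mp2 p + \<tau>))) + real n * (l * Mp2 p + l\<^sup>2 * K))"
      by (rule exp_mult_prod_exp)
    also have "- (l * (real n * (Mp2 p + \<tau>))) + real n * (l * Mp2 p + l\<^sup>2 * K) = - (l * N) + real n * l\<^sup>2 * K"
      by (simp add: N_def algebra_simps)
    also have "l * N = c' * real n powr (p / 2)"
      using powr_add[of N "p / 2 - 1" 1] N Np by (simp add: l_def mult.assoc)
    also have "real n * l\<^sup>2 * K = (q\<^sup>2 * \<tau> powr (p - 2) * K) * real n powr (p - 1)"
    proof -
      have "l\<^sup>2 = q\<^sup>2 * N powr (p - 2)"
        using powr_add[of N "p / 2 - 1" "p / 2 - 1"] by (simp add: l_def power2_eq_square mult_ac)
      also have "N powr (p - 2) = real n powr (p - 2) * \<tau> powr (p - 2)" using \<tau> by (simp add: N_def powr_mult)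
      finally have "real n * l\<^sup>2 * K = (q\<^sup>2 * \<tau> powr (p - 2) * K) * (real n powr 1 * real n powr (p - 2))" using n by simp
      also have "real n powr 1 * real n powr (p - 2) = real n powr (p - 1)"
        using powr_add[of "real n" 1 "p - 2"] by simp
      finally show ?thesis .
    qed
    finally have trunc': "prob ?T \<le> exp (- (c' * real n powr (p / 2)) + (q\<^sup>2 * \<tau> powr (p - 2) * K) * real n powr (p - 1))"
      using trunc by simp
    have "prob {x. real n * (Mp2 p + \<tau>) \<le> (\<Sum>i<n. (x i)\<^sup>2)} \<le> prob ((\<Union>j<n. ?J j) \<union> ?T)"
    proof (rule finite_measure_mono)
      show "{x. real n * (Mp2 p + \<tau>) \<le> (\<Sum>i<n. (x i)\<^sup>2)} \<subseteq> (\<Union>j<n. ?J j) \<union> ?T"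
      proof
        fix x :: "nat \<Rightarrow> real" assume x: "x \<in> {x. real n * (Mp2 p + \<tau>) \<le> (\<Sum>i<n. (x i)\<^sup>2)}"
        show "x \<in> (\<Union>j<n. ?J j) \<union> ?T"
        proof (cases "\<exists>j<n. N < (x j)\<^sup>2")
          case False
          then have "(x i)\<^sup>2 \<le> N" if "i < n" for i using that by (meson not_less)
          then have "(\<Sum>i<n. if (x i)\<^sup>2 \<le> N then (x i)\<^sup>2 else 0) = (\<Sum>i<n. (x i)\<^sup>2)"
            by (intro sum.cong) simp_all
          then show ?thesis using x by simp
        qed auto
      qed
      show "(\<Union>j<n. ?J j) \<union> ?T \<in> events" unfolding sets_prod_law by measurable
    qed
    also have "\<dots> \<le> prob (\<Union>j<n. ?J j) + prob ?T"
      by (rule measure_Un_le; unfold sets_prod_law; measurable)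
    also have "prob (\<Union>j<n. ?J j) \<le> (\<Sum>j<n. prob (?J j))"
      by (rule measure_UNION_le) (simp, unfold sets_prod_law, measurable)
    also have "\<dots> \<le> (\<Sum>j<n. \<kappa> * exp (- (c' * real n powr (p / 2))))" by (intro sum_mono jump) simp
    finally show ?thesis using trunc' by simp
  qed
  define D where "D = c' - c"
  have D: "0 < D" using c' by (simp add: D_def)
  define L where "L = q\<^sup>2 * \<tau> powr (p - 2) * K"
  have L: "0 < L" using q K \<tau> by (simp add: L_def)
  have lim1: "((\<lambda>n. real n * \<kappa> * exp (- (D * real n powr (p / 2)))) \<longlongrightarrow> 0) sequentially"
    using p D \<kappa> by real_asymp
  \<comment> \<open>The quadratic error has order \<open>p - 1\<close>, which is less than \<open>p / 2\<close> precisely when \<open>p < 2\<close>.\<close>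
  have lim2: "((\<lambda>n. exp (L * real n powr (p - 1) - D * real n powr (p / 2))) \<longlongrightarrow> 0) sequentially"
    using p D L by real_asymp
  have "\<forall>\<^sub>F n in sequentially. real n * \<kappa> * exp (- (D * real n powr (p / 2))) < 1 / 2"
    by (rule order_tendstoD(2)[OF lim1]) simp
  moreover have "\<forall>\<^sub>F n in sequentially. exp (L * real n powr (p - 1) - D * real n powr (p / 2)) < 1 / 2"
    by (rule order_tendstoD(2)[OF lim2]) simp
  ultimately show "\<forall>\<^sub>F n in sequentially. measure (pgauss_law p n) {x. real n * (Mp2 p + \<tau>) \<le> (\<Sum>i<n. (x i)\<^sup>2)} \<le> exp (- (c * real n powr (p / 2)))"
    using eventually_ge_at_top[of 1]
  proof eventually_elim
    case (elim n)
    let ?s = "real n powr (p / 2)"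
    have e: "exp (- (c' * ?s)) = exp (- (D * ?s)) * exp (- (c * ?s))" by (simp flip: exp_add add: D_def algebra_simps)
    have "real n * \<kappa> * exp (- (c' * ?s)) = (real n * \<kappa> * exp (- (D * ?s))) * exp (- (c * ?s))" by (simp add: e)
    also have "\<dots> \<le> 1 / 2 * exp (- (c * ?s))" using elim by (intro mult_right_mono) auto
    finally have 1: "real n * \<kappa> * exp (- (c' * ?s)) \<le> 1 / 2 * exp (- (c * ?s))" .
    have "exp (- (c' * ?s) + L * real n powr (p - 1)) = exp (L * real n powr (p - 1) - D * ?s) * exp (- (c * ?s))"
      by (simp flip: exp_add add: D_def algebra_simps)
    also have "\<dots> \<le> 1 / 2 * exp (- (c * ?s))" using elim by (intro mult_right_mono) auto
    finally show ?case using 1 bound[of n] elim by (simp add: L_def)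
  qed
qed

text \<open>
  The strategy that is optimal for \<open>p < 2\<close>: one coordinate alone produces the excess \<open>n \<tau>\<close>, while the
  others contribute their mean.
\<close>

lemma pgauss_sum_big_jump:
  assumes p: "0 < p" and \<tau>: "0 \<le> \<tau>"
  shows "exp_lower (\<lambda>n. real n powr (p / 2))
    (\<lambda>n. measure (pgauss_law p n) {x. real n * (Mp2 p + \<tau>) < (\<Sum>i<n. (x i)\<^sup>2)}) (ereal (\<tau> powr (p / 2) / p))"
  unfolding exp_lower_def
proof (intro allI impI)
  fix c assume "ereal (\<tau> powr (p / 2) / p) < ereal c"
  then have c: "\<tau> powr (p / 2) / p < c" by simp
  have "((\<lambda>e. (\<tau> + e) powr (p / 2) / p) \<longlongrightarrow> (\<tau> + 0) powr (p / 2) / p) (at_right 0)"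
    using p \<tau> by (intro tendsto_intros tendsto_powr') (auto simp: eventually_at_right_less intro: eventually_mono[OF eventually_at_right_less])
  then have "\<forall>\<^sub>F e in at_right 0. (\<tau> + e) powr (p / 2) / p < c" using c by (intro order_tendstoD(2)) auto
  moreover have "\<forall>\<^sub>F e::real in at_right 0. 0 < e" by (rule eventually_at_right_less)
  ultimately have "\<forall>\<^sub>F e in at_right 0. (\<tau> + e) powr (p / 2) / p < c \<and> 0 < e" by (rule eventually_conj)
  then have "\<exists>e. (\<tau> + e) powr (p / 2) / p < c \<and> 0 < e" by (rule eventually_happens'[rotated]) simp
  then obtain e where e: "0 < e" "(\<tau> + e) powr (p / 2) / p < c" by blast
  \<comment> \<open>The jump overshoots by \<open>n * e\<close>, so that the other coordinates may fall short of their mean by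
    this amount.\<close>
  define a where "a = \<tau> + e"
  have a: "0 < a" using e \<tau> by (simp add: a_def)
  define Z where "Z = gen_gamma p 0 (1 / p)"
  have Z: "0 < Z" using p by (simp add: Z_def gen_gamma_pos)
  define K where "K = fourth_moment p (1 / p) / 2"
  have K: "0 < K" using fourth_moment_pos[of p "1 / p"] p by (simp add: K_def)
  \<comment> \<open>This slope minimizes the exponent \<open>- l * e + l\<^sup>2 * K\<close> per coordinate.\<close>
  define l where "l = e / (2 * K)"
  have l: "0 < l" "l * K = e / 2" using K e by (auto simp: l_def)
  have bound: "exp (- (1 / p * (sqrt (real n * a) + 1) powr p)) / Z * (1 - exp (l * Mp2 p - l * e / 2 * real n))
      \<le> measure (pgauss_law p n) {x. real n * (Mp2 p + \<tau>) < (\<Sum>i<n. (x i)\<^sup>2)}" if n: "n \<ge> 1" for n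
  proof -
    interpret prob_space "pgauss_law p n" by (rule prob_space_pgauss_law[OF p])
    define u where "u = sqrt (real n * a)"
    have u: "0 \<le> u" "u\<^sup>2 = real n * a" using a by (auto simp: u_def)
    let ?A = "{x::nat \<Rightarrow> real. u < x 0}"
    let ?L = "{x::nat \<Rightarrow> real. u < x 0 \<and> (\<Sum>i\<in>{1..<n}. (x i)\<^sup>2) \<le> real n * (Mp2 p - e)}"
    define P where "P = (\<integral>\<^sup>+t. ennreal (pgauss p t) * indicator {u<..} t \<partial>lborel)"
    have P1: "P \<le> 1"
    proof -
      have "P \<le> (\<integral>\<^sup>+t. ennreal (pgauss p t) \<partial>lborel)" unfolding P_def by (intro nn_integral_mono) (simp add: indicator_def)
      then show ?thesis using nn_integral_pgauss_1[OF p] by simp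
    qed
    then have Pfin: "P \<noteq> \<infinity>" by (auto simp: top_unique)
    define r where "r = enn2real P"
    have Pr: "P = ennreal r" using Pfin by (simp add: r_def top.not_eq_extremum ennreal_enn2real)
    have r0: "0 \<le> r" by (simp add: r_def)
    have split: "(\<Prod>i<n. g i) = g 0 * (\<Prod>i\<in>{1..<n}. g i)" for g :: "nat \<Rightarrow> 'b::comm_monoid_mult"
    proof -
      have "{..<n} = insert 0 {1..<n}" using n by auto
      then show ?thesis by simp
    qed
    have "emeasure (pgauss_law p n) ?A = (\<integral>\<^sup>+x. (\<Prod>i<n. (if i = 0 then indicator {u<..} else (\<lambda>_. 1)) (x i)) \<partial>pgauss_law p n)"
    proof -
      have "emeasure (pgauss_law p n) ?A = (\<integral>\<^sup>+x. indicator ?A x \<partial>pgauss_law p n)"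
        by (rule nn_integral_indicator[symmetric]) (unfold sets_prod_law, measurable)
      also have "\<dots> = (\<integral>\<^sup>+x. (\<Prod>i<n. (if i = 0 then indicator {u<..} else (\<lambda>_. 1)) (x i)) \<partial>pgauss_law p n)"
        by (intro nn_integral_cong) (simp add: split indicator_def)
      finally show ?thesis .
    qed
    also have "\<dots> = (\<Prod>i<n. \<integral>\<^sup>+t. ennreal (pgauss p t) * (if i = 0 then indicator {u<..} else (\<lambda>_. 1)) t \<partial>lborel)"
      by (rule nn_integral_prod_law) (auto simp: is_density_pgauss[OF p])
    also have "\<dots> = P" by (simp add: split P_def nn_integral_pgauss_1[OF p])
    finally have PA: "prob ?A = r" using r0 by (simp add: emeasure_eq_measure Pr)
    have PL: "prob ?L \<le> r * exp (l * Mp2 p - l * e / 2 * real n)"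
    proof -
      let ?h = "\<lambda>i t. if i = 0 then indicat_real {u<..} t else exp (- (l * t\<^sup>2))"
      let ?b = "\<lambda>i::nat. if i = 0 then r else exp (- l * Mp2 p + l\<^sup>2 * K)"
      have "prob ?L \<le> exp (l * (real n * (Mp2 p - e))) * (\<Prod>i<n. ?b i)"
      proof (rule prod_law_le[where h = ?h])
        fix x assume x: "x \<in> ?L"
        have "(\<Prod>i<n. ?h i (x i)) = (\<Prod>i\<in>{1..<n}. exp (- (l * (x i)\<^sup>2)))" using x by (simp add: split)
        also have "\<dots> = exp (- (l * (\<Sum>i\<in>{1..<n}. (x i)\<^sup>2)))"
          by (simp add: exp_sum[symmetric] sum_negf sum_distrib_left)
        finally have "(\<Prod>i<n. ?h i (x i)) = exp (- (l * (\<Sum>i\<in>{1..<n}. (x i)\<^sup>2)))" .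
        moreover have "l * (\<Sum>i\<in>{1..<n}. (x i)\<^sup>2) \<le> l * (real n * (Mp2 p - e))" using x l by (intro mult_left_mono) auto
        ultimately show "1 \<le> exp (l * (real n * (Mp2 p - e))) * (\<Prod>i<n. ?h i (x i))"
          by (simp flip: exp_add)
      next
        fix i assume "i < n"
        show "(\<integral>\<^sup>+t. ennreal (pgauss p t * ?h i t) \<partial>lborel) \<le> ennreal (?b i)"
        proof (cases "i = 0")
          case True
          have "(\<integral>\<^sup>+t. ennreal (pgauss p t * ?h i t) \<partial>lborel) = P"
            unfolding P_def using True by (intro nn_integral_cong) (simp add: indicator_def)
          then show ?thesis using True Pr by simp
        next
          case False
          then show ?thesis using pgauss_mgf_negative[OF p, of l] l by (simp add: K_def)
        qed
        show "0 \<le> ?b i" using r0 by simp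
      qed (auto simp: is_density_pgauss[OF p], measurable)
      also have "\<dots> = r * exp (l * (real n * (Mp2 p - e)) + real (n - 1) * (- l * Mp2 p + l\<^sup>2 * K))"
        by (simp add: split exp_add exp_of_nat_mult mult_ac)
      also have "\<dots> \<le> r * exp (l * Mp2 p - l * e / 2 * real n)"
      proof -
        have lK: "l\<^sup>2 * K = l * e / 2" using l(2) by (simp add: power2_eq_square)
        have "l * (real n * (Mp2 p - e)) + real (n - 1) * (- l * Mp2 p + l\<^sup>2 * K)
          = l * Mp2 p - l * e / 2 * real n - l * e / 2"
          unfolding lK using n by (simp add: of_nat_diff field_simps)
        also have "\<dots> \<le> l * Mp2 p - l * e / 2 * real n" using l(1) e(1) by simp
        finally show ?thesis using r0 by (intro mult_left_mono) auto
      qed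
      finally show ?thesis .
    qed
    \<comment> \<open>On an interval of length \<open>1\<close> beyond \<open>u\<close> the density is at least its value at \<open>u + 1\<close>.\<close>
    have rge: "exp (- (1 / p * (u + 1) powr p)) / Z \<le> r"
    proof -
      have "ennreal (exp (- (1 / p * (u + 1) powr p)) / Z) = (\<integral>\<^sup>+t. ennreal (exp (- (1 / p * (u + 1) powr p)) / Z) * indicator {u<..u + 1} t \<partial>lborel)"
        by (subst nn_integral_cmult_indicator) auto
      also have "\<dots> \<le> P"
        unfolding P_def
      proof (rule nn_integral_mono)
        fix t
        show "ennreal (exp (- (1 / p * (u + 1) powr p)) / Z) * indicator {u<..u + 1} t \<le> ennreal (pgauss p t) * indicator {u<..} t"
        proof (cases "t \<in> {u<..u + 1}")
          case True
          then have "\<bar>t\<bar> powr p \<le> (u + 1) powr p" using u p by (intro powr_mono2) auto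
          then have "exp (- (1 / p * (u + 1) powr p)) / Z \<le> pgauss p t"
            using p Z by (auto simp: pgauss_def Z_def intro!: divide_right_mono divide_left_mono)
          then show ?thesis using True by (simp add: ennreal_leI)
        qed simp
      qed
      finally show ?thesis using Pr r0 by simp
    qed
    have "prob ?A \<le> prob ({x. real n * (Mp2 p + \<tau>) < (\<Sum>i<n. (x i)\<^sup>2)} \<union> ?L)"
    proof (rule finite_measure_mono)
      show "?A \<subseteq> {x. real n * (Mp2 p + \<tau>) < (\<Sum>i<n. (x i)\<^sup>2)} \<union> ?L"
      proof
        fix x :: "nat \<Rightarrow> real" assume x: "x \<in> ?A"
        show "x \<in> {x. real n * (Mp2 p + \<tau>) < (\<Sum>i<n. (x i)\<^sup>2)} \<union> ?L"
        proof (cases "(\<Sum>i\<in>{1..<n}. (x i)\<^sup>2) \<le> real n * (Mp2 p - e)")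
          case False
          have "{..<n} = insert 0 {1..<n}" using n by auto
          then have "(\<Sum>i<n. (x i)\<^sup>2) = (x 0)\<^sup>2 + (\<Sum>i\<in>{1..<n}. (x i)\<^sup>2)" by simp
          moreover have "u\<^sup>2 < (x 0)\<^sup>2" using x u by (intro power_strict_mono) auto
          ultimately show ?thesis using False u(2) by (simp add: a_def algebra_simps)
        qed (use x in simp)
      qed
      show "{x. real n * (Mp2 p + \<tau>) < (\<Sum>i<n. (x i)\<^sup>2)} \<union> ?L \<in> events" unfolding sets_prod_law by measurable
    qed
    also have "\<dots> \<le> prob {x. real n * (Mp2 p + \<tau>) < (\<Sum>i<n. (x i)\<^sup>2)} + prob ?L"
      by (rule measure_Un_le; unfold sets_prod_law; measurable)
    finally have ge: "r * (1 - exp (l * Mp2 p - l * e / 2 * real n)) \<le> prob {x. real n * (Mp2 p + \<tau>) < (\<Sum>i<n. (x i)\<^sup>2)}"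
      using PA PL by (simp add: algebra_simps)
    show ?thesis
    proof (cases "exp (l * Mp2 p - l * e / 2 * real n) \<le> 1")
      case True
      then have "exp (- (1 / p * (u + 1) powr p)) / Z * (1 - exp (l * Mp2 p - l * e / 2 * real n)) \<le> r * (1 - exp (l * Mp2 p - l * e / 2 * real n))"
        using rge by (intro mult_right_mono) auto
      then show ?thesis using ge by (simp add: u_def)
    next
      case False
      then have "exp (- (1 / p * (u + 1) powr p)) / Z * (1 - exp (l * Mp2 p - l * e / 2 * real n)) \<le> 0"
        using Z by (intro mult_nonneg_nonpos) auto
      also have "0 \<le> prob {x. real n * (Mp2 p + \<tau>) < (\<Sum>i<n. (x i)\<^sup>2)}" by simp
      finally show ?thesis by (simp add: u_def)
    qed
  qed
  have l1: "((\<lambda>n. exp (l * Mp2 p - l * e / 2 * real n)) \<longlongrightarrow> 0) sequentially"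
    using l e by real_asymp
  define g where "g = (c - a powr (p / 2) / p) / 2"
  have g: "0 < g" "a powr (p / 2) / p + g < c" using e(2) by (auto simp: g_def a_def field_simps)
  have "((\<lambda>n. (sqrt (real n * a) + 1) powr p / real n powr (p / 2)) \<longlongrightarrow> (a powr (1 / 2)) powr p) sequentially"
    using p a by real_asymp
  then have "((\<lambda>n. (sqrt (real n * a) + 1) powr p / real n powr (p / 2)) \<longlongrightarrow> a powr (p / 2)) sequentially"
    by (simp add: powr_powr)
  then have "((\<lambda>n. (sqrt (real n * a) + 1) powr p / real n powr (p / 2) / p) \<longlongrightarrow> a powr (p / 2) / p) sequentially"
    using p by (intro tendsto_intros) auto
  then have l2: "\<forall>\<^sub>F n in sequentially. (sqrt (real n * a) + 1) powr p / real n powr (p / 2) / p < a powr (p / 2) / p + g"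
    using g by (intro order_tendstoD(2)) auto
  have "\<forall>\<^sub>F n in sequentially. 2 * Z * exp (- (c * real n powr (p / 2))) \<le> exp (- ((a powr (p / 2) / p + g) * real n powr (p / 2)))"
    using eventually_mult_exp_le[OF speed_at_top[OF p] g(2), of "2 * Z"] Z by simp
  then show "\<forall>\<^sub>F n in sequentially. exp (- (c * real n powr (p / 2))) \<le> measure (pgauss_law p n) {x. real n * (Mp2 p + \<tau>) < (\<Sum>i<n. (x i)\<^sup>2)}"
    using l2 order_tendstoD(2)[OF l1, of "1 / 2", simplified] eventually_ge_at_top[of 1]
  proof eventually_elim
    case (elim n)
    let ?s = "real n powr (p / 2)" and ?S = "(sqrt (real n * a) + 1) powr p"
    have "?s > 0" using elim by simp
    then have "1 / p * ?S \<le> (a powr (p / 2) / p + g) * ?s" using elim p by (simp add: field_simps)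
    then have "exp (- ((a powr (p / 2) / p + g) * ?s)) \<le> exp (- (1 / p * ?S))" by simp
    then have "2 * Z * exp (- (c * ?s)) \<le> exp (- (1 / p * ?S))" using elim by linarith
    then have "exp (- (c * ?s)) \<le> exp (- (1 / p * ?S)) / Z * (1 / 2)" using Z by (simp add: field_simps)
    also have "\<dots> \<le> exp (- (1 / p * ?S)) / Z * (1 - exp (l * Mp2 p - l * e / 2 * real n))"
      using elim Z by (intro mult_left_mono) auto
    also have "\<dots> \<le> measure (pgauss_law p n) {x. real n * (Mp2 p + \<tau>) < (\<Sum>i<n. (x i)\<^sup>2)}"
      using bound elim by simp
    finally show ?case .
  qed
qed

section \<open>The p-Gaussian law as a mixture of uniform laws\<close>

definition power_sum :: "real \<Rightarrow> nat \<Rightarrow> (nat \<Rightarrow> real) \<Rightarrow> real"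
  where "power_sum p n x = (\<Sum>i<n. \<bar>x i\<bar> powr p)"

lemma power_sum_nonneg: "0 \<le> power_sum p n x"
  by (simp add: power_sum_def sum_nonneg)

lemma measurable_power_sum [measurable]: "power_sum p n \<in> borel_measurable borel"
  unfolding power_sum_def[abs_def] by measurable

lemma lp_ball_eq:
  assumes p: "0 < p" shows "lp_ball p n = {x \<in> Rn n. power_sum p n x \<le> 1}"
proof -
  have "lp_norm p n x \<le> 1 \<longleftrightarrow> power_sum p n x \<le> 1" for x
  proof -
    have "power_sum p n x powr (1 / p) \<le> 1 \<longleftrightarrow> power_sum p n x \<le> 1"
      using powr_mono2[of "1 / p" 1 "power_sum p n x"] powr_less_mono2[of "1 / p" 1 "power_sum p n x"]
        powr_mono2[of "1 / p" "power_sum p n x" 1] power_sum_nonneg[of p n x] p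
      by (cases "power_sum p n x \<le> 1") auto
    then show ?thesis by (simp add: lp_norm_def power_sum_def)
  qed
  then show ?thesis by (auto simp: lp_ball_def)
qed

lemma sets_lp_ball [measurable]: "0 < p \<Longrightarrow> lp_ball p n \<in> sets borel"
  unfolding lp_ball_eq by measurable

lemma power_sum_scaleR:
  assumes "0 < r" shows "power_sum p n (r *\<^sub>R x) = r powr p * power_sum p n x"
  using assms by (simp add: power_sum_def scaleR_fun_def abs_mult powr_mult sum_distrib_left)

lemma measurable_scaleR_fun [measurable (raw)]:
  fixes g :: "'a \<Rightarrow> nat \<Rightarrow> real"
  assumes [measurable]: "f \<in> borel_measurable M" "g \<in> borel_measurable M"
  shows "(\<lambda>x. f x *\<^sub>R g x) \<in> borel_measurable M"
  by (rule measurable_coordinatewise_then_product) (simp add: scaleR_fun_def)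

text \<open>
  Writes \<open>exp (- N / p)\<close> as a superposition of the indicators of \<open>N \<le> t\<close>, i.e. the \<open>p\<close>-Gaussian
  density as a superposition of indicators of \<open>\<ell>\<^sub>p\<close> balls.
\<close>

lemma layer_cake_exp:
  fixes p N :: real
  assumes p: "0 < p"
  shows "(\<integral>\<^sup>+t. ennreal (1 / p * exp (- t / p)) * indicator {N..} t \<partial>lborel) = ennreal (exp (- N / p))"
proof -
  have "(\<integral>\<^sup>+t\<in>{N..}. ennreal (1 / p * exp (- t / p)) \<partial>lborel) = ennreal (0 - (- exp (- N / p)))"
  proof (rule nn_integral_FTC_atLeast)
    show "((\<lambda>t. - exp (- t / p)) \<longlongrightarrow> 0) at_top" using p by real_asymp
    show "((\<lambda>t. - exp (- t / p)) has_real_derivative 1 / p * exp (- x / p)) (at x)" for x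
      using p by (auto intro!: derivative_eq_intros)
  qed (use p in auto)
  then show ?thesis by simp
qed

definition pgauss_norm :: "real \<Rightarrow> real"
  where "pgauss_norm p = gen_gamma p 0 (1 / p)"

lemma pgauss_norm_pos: "0 < p \<Longrightarrow> 0 < pgauss_norm p"
  by (simp add: pgauss_norm_def gen_gamma_pos)

lemma pgauss_prod:
  assumes p: "0 < p"
  shows "(\<Prod>i<n. ennreal (pgauss p (x i))) = ennreal ((1 / pgauss_norm p) ^ n * exp (- power_sum p n x / p))"
proof -
  have "(\<Prod>i<n. ennreal (pgauss p (x i))) = ennreal (\<Prod>i<n. pgauss p (x i))"
    by (intro prod_ennreal pgauss_nonneg p)
  also have "(\<Prod>i<n. pgauss p (x i)) = (\<Prod>i<n. (1 / pgauss_norm p) * exp (- (1 / p * \<bar>x i\<bar> powr p)))"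
    by (simp add: pgauss_def pgauss_norm_def)
  also have "\<dots> = (1 / pgauss_norm p) ^ n * exp (\<Sum>i<n. - (1 / p * \<bar>x i\<bar> powr p))"
    by (simp only: prod.distrib prod_constant card_lessThan exp_sum[OF finite_lessThan])
  also have "(\<Sum>i<n. - (1 / p * \<bar>x i\<bar> powr p)) = - power_sum p n x / p"
    by (simp add: power_sum_def sum_negf sum_divide_distrib)
  finally show ?thesis .
qed

text \<open>
  That the uniform distribution is a probability measure amounts to the ball having positive finite
  volume.
\<close>

locale uniform_ball =
  fixes p :: real and n :: nat
  assumes p: "0 < p" and prob: "prob_space (uniform_on_lp_ball p n)"
begin

abbreviation \<nu> :: "(nat \<Rightarrow> real) measure" where "\<nu> \<equiv> uniform_on_lp_ball p n"

definition vol :: real where "vol = measure (lebesgue_Rn n) (lp_ball p n)"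

lemma sets_\<nu> [simp, measurable_cong]: "sets \<nu> = sets borel"
  and space_\<nu> [simp]: "space \<nu> = UNIV"
  by (simp_all add: uniform_on_lp_ball_def)

lemma lp_ball_meas [measurable]: "lp_ball p n \<in> sets borel"
  using p by (rule sets_lp_ball)

lemma emeasure_\<nu>: "A \<in> sets borel \<Longrightarrow> emeasure \<nu> A = emeasure (lebesgue_Rn n) (lp_ball p n \<inter> A) / emeasure (lebesgue_Rn n) (lp_ball p n)"
  unfolding uniform_on_lp_ball_def by (intro emeasure_uniform_measure) auto

lemma vol: "emeasure (lebesgue_Rn n) (lp_ball p n) = ennreal vol" "0 < vol"
proof -
  let ?b = "emeasure (lebesgue_Rn n) (lp_ball p n)"
  have 1: "?b / ?b = 1" using prob_space.emeasure_space_1[OF prob] emeasure_\<nu>[of UNIV] by simp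
  have b: "?b \<noteq> 0" "?b \<noteq> top" using 1 by (auto simp: divide_ennreal_def)
  then show e: "?b = ennreal vol" by (simp add: vol_def measure_def top.not_eq_extremum ennreal_enn2real)
  show "0 < vol" using b(1) unfolding e by (simp add: ennreal_eq_0_iff not_le)
qed

lemma AE_\<nu>_Rn: "AE x in \<nu>. x \<in> Rn n"
proof -
  have "emeasure \<nu> (- Rn n) = 0"
  proof -
    have "lp_ball p n \<inter> - Rn n = {}" by (auto simp: lp_ball_def)
    moreover have "- Rn n \<in> sets borel" by (intro borel_comp) measurable
    ultimately show ?thesis by (simp add: emeasure_\<nu>)
  qed
  moreover have "- Rn n \<in> sets \<nu>" unfolding sets_\<nu> by (intro borel_comp) measurable
  ultimately show ?thesis by (intro AE_I[of _ _ "- Rn n"]) auto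
qed

lemma AE_\<nu>_nonzero: "AE x in lebesgue_Rn n. P x \<Longrightarrow> AE x in \<nu>. P x"
  unfolding uniform_on_lp_ball_def uniform_measure_def
  by (subst AE_density) auto

text \<open>
  The density of the Gamma law with shape \<open>n / p + 1\<close> and scale \<open>p\<close>. Its constant is written with the
  volume of the ball; that it is normalized, and hence Dirichlet's formula for that volume, is a
  consequence of the mixture formula.
\<close>

definition mix_density :: "real \<Rightarrow> real"
  where "mix_density t = indicator {0<..} t * (vol * (1 / pgauss_norm p) ^ n / p * t powr (real n / p) * exp (- t / p))"

definition mix :: "real measure"
  where "mix = density lborel (\<lambda>t. ennreal (mix_density t))"

lemma mix_density_measurable [measurable]: "mix_density \<in> borel_measurable borel"
  unfolding mix_density_def[abs_def] by measurable

lemma mix_density_nonneg: "0 \<le> mix_density t"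
  using vol(2) p pgauss_norm_pos[OF p] by (simp add: mix_density_def)

lemma sets_mix [simp, measurable_cong]: "sets mix = sets borel" and space_mix [simp]: "space mix = UNIV"
  by (simp_all add: mix_def)

lemma scaled_ball:
  assumes t: "0 < t" and [measurable]: "A \<in> sets borel"
  shows "(\<integral>\<^sup>+x. indicator {..t} (power_sum p n x) * indicator A x \<partial>lebesgue_Rn n)
    = ennreal (vol * t powr (real n / p)) * emeasure \<nu> {x. t powr (1 / p) *\<^sub>R x \<in> A}"
proof -
  define r where "r = t powr (1 / p)"
  have r: "0 < r" "r powr p = t" using t p by (auto simp: r_def powr_powr)
  let ?f = "\<lambda>x. indicator {..t} (power_sum p n x) * indicator A x :: ennreal"
  let ?B = "{x. r *\<^sub>R x \<in> A}"
  have B[measurable]: "?B \<in> sets borel"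
  proof -
    have "?B = {x \<in> space borel. r *\<^sub>R x \<in> A}" by simp
    also have "\<dots> \<in> sets borel" by measurable
    finally show ?thesis .
  qed
  have "(\<integral>\<^sup>+x. ?f (r *\<^sub>R x) \<partial>lebesgue_Rn n) = (\<integral>\<^sup>+x. indicator (lp_ball p n \<inter> ?B) x \<partial>lebesgue_Rn n)"
    using AE_lebesgue_Rn[of n]
  proof (intro nn_integral_cong_AE, eventually_elim)
    case (elim x)
    have "power_sum p n (r *\<^sub>R x) \<le> t \<longleftrightarrow> power_sum p n x \<le> 1"
      using t by (simp add: power_sum_scaleR[OF r(1)] r(2))
    then show ?case using elim by (auto simp: lp_ball_eq[OF p] indicator_def)
  qed
  also have "\<dots> = emeasure (lebesgue_Rn n) (lp_ball p n \<inter> ?B)" by (rule nn_integral_indicator) simp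
  also have "\<dots> = ennreal vol * emeasure \<nu> ?B"
    using vol by (simp add: emeasure_\<nu> mult.commute[of "ennreal vol"] ennreal_divide_times ennreal_divide_self)
  finally have eq: "(\<integral>\<^sup>+x. ?f (r *\<^sub>R x) \<partial>lebesgue_Rn n) = ennreal vol * emeasure \<nu> ?B" .
  have "(\<integral>\<^sup>+x. ?f (r *\<^sub>R x) \<partial>lebesgue_Rn n) = ennreal ((1 / r) ^ n) * (\<integral>\<^sup>+x. ?f x \<partial>lebesgue_Rn n)"
    by (rule nn_integral_lebesgue_Rn_scale[OF _ r(1)]) measurable
  then have "(\<integral>\<^sup>+x. ?f x \<partial>lebesgue_Rn n) = ennreal (r ^ n) * (\<integral>\<^sup>+x. ?f (r *\<^sub>R x) \<partial>lebesgue_Rn n)"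
    using r(1) by (simp add: power_one_over field_simps flip: mult.assoc ennreal_mult)
  also have "\<dots> = ennreal (r ^ n) * ennreal vol * emeasure \<nu> ?B" by (simp only: eq mult.assoc)
  also have "ennreal (r ^ n) * ennreal vol = ennreal (vol * t powr (real n / p))"
  proof -
    have "r ^ n = t powr (real n / p)" using t by (simp add: r_def powr_powr flip: powr_realpow)
    then show ?thesis using vol(2) by (simp add: mult.commute flip: ennreal_mult)
  qed
  finally show ?thesis unfolding r_def .
qed

lemma measurable_emeasure_scaled [measurable]:
  assumes A[measurable]: "A \<in> sets borel"
  shows "(\<lambda>t. emeasure \<nu> {x. t powr (1 / p) *\<^sub>R x \<in> A}) \<in> borel_measurable borel"
proof -
  interpret N: prob_space \<nu> by (rule prob)
  let ?Q = "{q \<in> space (borel \<Otimes>\<^sub>M \<nu>). fst q powr (1 / p) *\<^sub>R snd q \<in> A}"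
  have Q: "?Q \<in> sets (borel \<Otimes>\<^sub>M \<nu>)" by measurable
  have "(\<lambda>t. emeasure \<nu> (Pair t -` ?Q)) \<in> borel_measurable (borel :: real measure)"
    by (rule N.measurable_emeasure_Pair[OF Q])
  then show ?thesis by (simp add: space_pair_measure)
qed

text \<open>
  Superposing the dilated balls with the weights of the layer cake formula, a \<open>p\<close>-Gaussian vector
  has the same law as \<open>\<tau>^(1/p) X\<close> with \<open>X\<close> uniform on the ball and an independent \<open>\<tau>\<close> of law
  \<open>mix\<close>. As \<open>\<tau>\<close> is close to \<open>n\<close> up to an error that is exponentially small in \<open>n\<close>, the uniform law
  inherits all deviations of the product law that occur at smaller speeds.
\<close>

lemma pgauss_law_mixture:
  assumes A[measurable]: "A \<in> sets borel"
  shows "emeasure (pgauss_law p n) A = (\<integral>\<^sup>+t. emeasure \<nu> {x. t powr (1 / p) *\<^sub>R x \<in> A} \<partial>mix)"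
proof -
  interpret L: sigma_finite_measure "lebesgue_Rn n" by (rule sigma_finite_lebesgue_Rn)
  interpret pair_sigma_finite "lebesgue_Rn n" lborel ..
  define c where "c = (1 / pgauss_norm p) ^ n"
  have c: "0 \<le> c" using pgauss_norm_pos[OF p] by (simp add: c_def)
  let ?e = "\<lambda>t. ennreal (1 / p * exp (- t / p))"
  let ?F = "\<lambda>x t. ennreal c * (?e t * (indicator {..t} (power_sum p n x) * indicator A x))"
  have [measurable]: "(\<lambda>q. indicator {..snd q} (power_sum p n (fst q)) :: ennreal) \<in> borel_measurable (lebesgue_Rn n \<Otimes>\<^sub>M lborel)"
  proof -
    have "(\<lambda>q. indicator {..snd q} (power_sum p n (fst q)) :: ennreal) = (\<lambda>q. if power_sum p n (fst q) \<le> snd q then 1 else 0)"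
      by (auto simp: indicator_def fun_eq_iff)
    then show ?thesis by simp
  qed
  have F: "(\<lambda>(x, t). ?F x t) \<in> borel_measurable (lebesgue_Rn n \<Otimes>\<^sub>M lborel)"
    unfolding case_prod_beta by measurable
  have "emeasure (pgauss_law p n) A = (\<integral>\<^sup>+x. (\<Prod>i<n. ennreal (pgauss p (x i))) * indicator A x \<partial>lebesgue_Rn n)"
    unfolding prod_law_def by (subst emeasure_density) measurable
  also have "\<dots> = (\<integral>\<^sup>+x. (\<integral>\<^sup>+t. ?F x t \<partial>lborel) \<partial>lebesgue_Rn n)"
  proof (intro nn_integral_cong)
    fix x
    have "(\<integral>\<^sup>+t. ?F x t \<partial>lborel) = (\<integral>\<^sup>+t. (ennreal c * indicator A x) * (?e t * indicator {power_sum p n x..} t) \<partial>lborel)"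
      by (intro nn_integral_cong) (auto simp: indicator_def)
    also have "\<dots> = (ennreal c * indicator A x) * ennreal (exp (- power_sum p n x / p))"
    proof -
      have "(\<lambda>t. ?e t * indicator {power_sum p n x..} t) \<in> borel_measurable lborel"
        by (intro borel_measurable_times_ennreal borel_measurable_indicator) auto
      then show ?thesis by (simp only: nn_integral_cmult layer_cake_exp[OF p])
    qed
    finally show "(\<Prod>i<n. ennreal (pgauss p (x i))) * indicator A x = (\<integral>\<^sup>+t. ?F x t \<partial>lborel)"
      using c by (simp add: pgauss_prod[OF p] ennreal_mult mult_ac flip: c_def)
  qed
  also have "\<dots> = (\<integral>\<^sup>+t. (\<integral>\<^sup>+x. ?F x t \<partial>lebesgue_Rn n) \<partial>lborel)"
    by (rule Fubini'[symmetric, OF F])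
  also have "\<dots> = (\<integral>\<^sup>+t. ennreal (mix_density t) * emeasure \<nu> {x. t powr (1 / p) *\<^sub>R x \<in> A} \<partial>lborel)"
    using AE_lborel_singleton[of "0::real"]
  proof (intro nn_integral_cong_AE, eventually_elim)
    case (elim t)
    have I: "(\<integral>\<^sup>+x. ?F x t \<partial>lebesgue_Rn n) = ennreal c * (?e t * (\<integral>\<^sup>+x. indicator {..t} (power_sum p n x) * indicator A x \<partial>lebesgue_Rn n))"
      by (subst nn_integral_cmult, measurable) (subst nn_integral_cmult, measurable)
    show ?case
    proof (cases "0 < t")
      case True
      have "ennreal c * (?e t * ennreal (vol * t powr (real n / p))) = ennreal (mix_density t)"
        using True c p vol(2) by (simp add: mix_density_def c_def mult_ac flip: ennreal_mult)
      then show ?thesis unfolding I scaled_ball[OF True A] by (metis mult.assoc)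
    next
      case False
      then have "t < 0" using elim by simp
      then have "indicator {..t} (power_sum p n x) = (0::ennreal)" for x
        using power_sum_nonneg[of p n x] by (simp add: indicator_def)
      then show ?thesis unfolding I using False by (simp add: mix_density_def)
    qed
  qed
  also have "\<dots> = (\<integral>\<^sup>+t. emeasure \<nu> {x. t powr (1 / p) *\<^sub>R x \<in> A} \<partial>mix)"
  proof -
    have "(\<lambda>t. ennreal (mix_density t)) \<in> borel_measurable lborel" by simp
    moreover have "(\<lambda>t. emeasure \<nu> {x. t powr (1 / p) *\<^sub>R x \<in> A}) \<in> borel_measurable lborel"
      using measurable_emeasure_scaled[OF A] by simp
    ultimately show ?thesis unfolding mix_def by (rule nn_integral_density[symmetric])
  qed
  finally show ?thesis .
qed

lemma prob_space_mix: "prob_space mix"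
proof
  interpret N: prob_space \<nu> by (rule prob)
  interpret G: prob_space "pgauss_law p n" by (rule prob_space_pgauss_law[OF p])
  have "1 = emeasure (pgauss_law p n) UNIV" using G.emeasure_space_1 by simp
  also have "\<dots> = (\<integral>\<^sup>+t. emeasure \<nu> {x. t powr (1 / p) *\<^sub>R x \<in> UNIV} \<partial>mix)"
    by (rule pgauss_law_mixture) simp
  also have "\<dots> = emeasure mix (space mix)" using N.emeasure_space_1 by simp
  finally show "emeasure mix (space mix) = 1" ..
qed

lemma AE_mix_pos: "AE t in mix. 0 < t"
  unfolding mix_def by (subst AE_density) (auto simp: mix_density_def indicator_def)

text \<open>
  The independence of \<open>\<tau>\<close> and \<open>X\<close>, in the form of the two inequalities that compare the uniform law
  with the product law.
\<close>

lemma mixture_lower: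
  assumes A: "A \<in> sets borel" and U: "U \<in> sets borel" and T: "T \<in> sets borel"
    and imp: "\<And>t x. 0 < t \<Longrightarrow> t \<in> T \<Longrightarrow> x \<in> U \<Longrightarrow> t powr (1 / p) *\<^sub>R x \<in> A"
  shows "measure \<nu> U * measure mix T \<le> measure (pgauss_law p n) A"
proof -
  interpret N: prob_space \<nu> by (rule prob)
  interpret G: prob_space "pgauss_law p n" by (rule prob_space_pgauss_law[OF p])
  interpret X: prob_space mix by (rule prob_space_mix)
  have sc: "{x. t powr (1 / p) *\<^sub>R x \<in> A} \<in> sets \<nu>" for t
  proof -
    have "{x. t powr (1 / p) *\<^sub>R x \<in> A} = {x \<in> space borel. t powr (1 / p) *\<^sub>R x \<in> A}" by simp
    also have "\<dots> \<in> sets borel" using A by measurable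
    finally show ?thesis by simp
  qed
  have "emeasure \<nu> U * emeasure mix T = (\<integral>\<^sup>+t. emeasure \<nu> U * indicator T t \<partial>mix)"
    using T by (subst nn_integral_cmult_indicator) auto
  also have "\<dots> \<le> (\<integral>\<^sup>+t. emeasure \<nu> {x. t powr (1 / p) *\<^sub>R x \<in> A} \<partial>mix)"
    using AE_mix_pos
  proof (intro nn_integral_mono_AE, eventually_elim)
    case (elim t)
    show ?case
    proof (cases "t \<in> T")
      case True
      then have "U \<subseteq> {x. t powr (1 / p) *\<^sub>R x \<in> A}" using imp elim by blast
      then show ?thesis using True sc by (simp add: emeasure_mono)
    qed simp
  qed
  also have "\<dots> = emeasure (pgauss_law p n) A" by (rule pgauss_law_mixture[OF A, symmetric])
  finally show ?thesis
    by (simp add: N.emeasure_eq_measure G.emeasure_eq_measure X.emeasure_eq_measure flip: ennreal_mult)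
qed

lemma mixture_upper:
  assumes A: "A \<in> sets borel" and U: "U \<in> sets borel" and T: "T \<in> sets borel"
    and imp: "\<And>t x. 0 < t \<Longrightarrow> t \<notin> T \<Longrightarrow> t powr (1 / p) *\<^sub>R x \<in> A \<Longrightarrow> x \<in> U"
  shows "measure (pgauss_law p n) A \<le> measure \<nu> U + measure mix T"
proof -
  interpret N: prob_space \<nu> by (rule prob)
  interpret G: prob_space "pgauss_law p n" by (rule prob_space_pgauss_law[OF p])
  interpret X: prob_space mix by (rule prob_space_mix)
  have "emeasure (pgauss_law p n) A = (\<integral>\<^sup>+t. emeasure \<nu> {x. t powr (1 / p) *\<^sub>R x \<in> A} \<partial>mix)"
    by (rule pgauss_law_mixture[OF A])
  also have "\<dots> \<le> (\<integral>\<^sup>+t. emeasure \<nu> U + indicator T t \<partial>mix)"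
    using AE_mix_pos
  proof (intro nn_integral_mono_AE, eventually_elim)
    case (elim t)
    show ?case
    proof (cases "t \<in> T")
      case True
      then show ?thesis using N.emeasure_le_1 by (simp add: add_increasing)
    next
      case False
      then have "{x. t powr (1 / p) *\<^sub>R x \<in> A} \<subseteq> U" using imp elim by blast
      then show ?thesis using False U by (simp add: emeasure_mono)
    qed
  qed
  also have "\<dots> = emeasure \<nu> U + emeasure mix T"
  proof -
    have T': "T \<in> sets mix" using T by simp
    have "(\<integral>\<^sup>+t. emeasure \<nu> U + indicator T t \<partial>mix) = (\<integral>\<^sup>+t. emeasure \<nu> U \<partial>mix) + (\<integral>\<^sup>+t. indicator T t \<partial>mix)"
      by (intro nn_integral_add borel_measurable_const borel_measurable_indicator T')
    then show ?thesis using X.emeasure_space_1 T' by simp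
  qed
  finally show ?thesis
    by (simp add: N.emeasure_eq_measure G.emeasure_eq_measure X.emeasure_eq_measure flip: ennreal_plus)
qed

text \<open>
  An exponential tilt of a Gamma density is a dilation of it, so that its exponential moments follow
  from its normalization.
\<close>

lemma nn_integral_mix_exp:
  assumes c: "0 < c"
  shows "(\<integral>\<^sup>+t. ennreal (mix_density t * exp ((1 - c) * t / p)) \<partial>lborel) = ennreal (c powr (- (real n / p + 1)))"
proof -
  interpret X: prob_space mix by (rule prob_space_mix)
  have "1 = (\<integral>\<^sup>+t. ennreal (mix_density t) \<partial>lborel)"
    using X.emeasure_space_1 unfolding mix_def by (subst (asm) emeasure_density) auto
  also have "\<dots> = ennreal c * (\<integral>\<^sup>+t. ennreal (mix_density (0 + c * t)) \<partial>lborel)"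
    using c nn_integral_real_affine[of "\<lambda>t. ennreal (mix_density t)" c 0] by simp
  also have "(\<integral>\<^sup>+t. ennreal (mix_density (0 + c * t)) \<partial>lborel)
    = (\<integral>\<^sup>+t. ennreal (c powr (real n / p)) * ennreal (mix_density t * exp ((1 - c) * t / p)) \<partial>lborel)"
  proof (intro nn_integral_cong)
    fix t
    have "mix_density (0 + c * t) = c powr (real n / p) * (mix_density t * exp ((1 - c) * t / p))"
    proof (cases "0 < t")
      case True
      have "- t / p + (1 - c) * t / p = - (c * t) / p" by (simp add: left_diff_distrib diff_divide_distrib)
      then have "exp (- t / p) * exp ((1 - c) * t / p) = exp (- (c * t) / p)" by (simp only: exp_add[symmetric])
      then show ?thesis using True c by (simp add: mix_density_def powr_mult mult_ac)
    next
      case False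
      then have "\<not> 0 < c * t" using c by (simp add: zero_less_mult_iff)
      then show ?thesis using False by (simp add: mix_density_def)
    qed
    then show "ennreal (mix_density (0 + c * t)) = ennreal (c powr (real n / p)) * ennreal (mix_density t * exp ((1 - c) * t / p))"
      using mix_density_nonneg[of t] by (simp flip: ennreal_mult)
  qed
  also have "\<dots> = ennreal (c powr (real n / p)) * (\<integral>\<^sup>+t. ennreal (mix_density t * exp ((1 - c) * t / p)) \<partial>lborel)"
    by (subst nn_integral_cmult) auto
  finally have e: "1 = ennreal (c powr (real n / p + 1)) * (\<integral>\<^sup>+t. ennreal (mix_density t * exp ((1 - c) * t / p)) \<partial>lborel)"
    using c by (simp add: powr_add mult_ac flip: mult.assoc ennreal_mult)
  have "(\<integral>\<^sup>+t. ennreal (mix_density t * exp ((1 - c) * t / p)) \<partial>lborel)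
    = ennreal (c powr (- (real n / p + 1))) * (ennreal (c powr (real n / p + 1)) * (\<integral>\<^sup>+t. ennreal (mix_density t * exp ((1 - c) * t / p)) \<partial>lborel))"
    using c by (simp flip: mult.assoc ennreal_mult powr_add)
  also have "\<dots> = ennreal (c powr (- (real n / p + 1)))" unfolding e[symmetric] by simp
  finally show ?thesis .
qed

text \<open>
  Chernoff's bound for the Gamma law, which has, up to the factor \<open>2 / p\<close>, the rate function of the
  chi-square law; again the sign of \<open>1 - 1 / r\<close> selects the tail.
\<close>

lemma mix_tail:
  assumes r: "0 < r"
  shows "measure mix {t. 0 \<le> (1 - 1 / r) * (t - real n * r)} \<le> r * exp (- (2 / p * chi_rate r * real n))"
proof -
  interpret X: prob_space mix by (rule prob_space_mix)
  let ?A = "{t. 0 \<le> (1 - 1 / r) * (t - real n * r)}"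
  have [measurable]: "?A \<in> sets borel" by measurable
  let ?C = "exp (- ((1 - 1 / r) * (real n * r) / p))"
  have "emeasure mix ?A = (\<integral>\<^sup>+t. ennreal (mix_density t) * indicator ?A t \<partial>lborel)"
    unfolding mix_def by (subst emeasure_density) auto
  also have "\<dots> \<le> (\<integral>\<^sup>+t. ennreal ?C * ennreal (mix_density t * exp ((1 - 1 / r) * t / p)) \<partial>lborel)"
  proof (rule nn_integral_mono)
    fix t
    show "ennreal (mix_density t) * indicator ?A t \<le> ennreal ?C * ennreal (mix_density t * exp ((1 - 1 / r) * t / p))"
    proof (cases "t \<in> ?A")
      case True
      have "?C * exp ((1 - 1 / r) * t / p) = exp ((1 - 1 / r) * (t - real n * r) / p)"
        by (simp flip: exp_add add: diff_divide_distrib right_diff_distrib)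
      also have "1 \<le> \<dots>" using True p by simp
      finally have "mix_density t * 1 \<le> mix_density t * (?C * exp ((1 - 1 / r) * t / p))"
        using mix_density_nonneg by (intro mult_left_mono) auto
      then have "ennreal (mix_density t) \<le> ennreal (?C * (mix_density t * exp ((1 - 1 / r) * t / p)))"
        by (intro ennreal_leI) (simp add: mult_ac)
      then show ?thesis using True mix_density_nonneg[of t] by (simp add: ennreal_mult)
    qed simp
  qed
  also have "\<dots> = ennreal ?C * ennreal ((1 / r) powr (- (real n / p + 1)))"
    using nn_integral_mix_exp[of "1 / r"] r by (subst nn_integral_cmult) auto
  also have "\<dots> = ennreal (?C * (1 / r) powr (- (real n / p + 1)))" by (simp flip: ennreal_mult)
  finally have "measure mix ?A \<le> ?C * (1 / r) powr (- (real n / p + 1))" by (simp add: X.emeasure_eq_measure)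
  also have "(1 / r) powr (- (real n / p + 1)) = r * exp (real n / p * ln r)"
  proof -
    have "(1 / r) powr (- (real n / p + 1)) = r powr (real n / p + 1)"
      using r by (simp only: powr_minus_divide powr_divide powr_one_eq_one) simp
    also have "\<dots> = r powr (real n / p) * r" using r by (simp add: powr_add)
    finally show ?thesis using r by (simp add: powr_def[of r "real n / p"])
  qed
  also have "?C * (r * exp (real n / p * ln r)) = r * exp (- (2 / p * chi_rate r * real n))"
  proof -
    have e: "- ((1 - 1 / r) * (real n * r) / p) + real n / p * ln r = - (2 / p * chi_rate r * real n)"
    proof -
      have "(1 - 1 / r) * (real n * r) = real n * (r - 1)" using r by (simp add: field_simps)
      then show ?thesis using p by (simp add: chi_rate_def field_simps)
    qed
    show ?thesis unfolding e[symmetric] exp_add by simp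
  qed
  finally show ?thesis .
qed

lemma mix_upper_tail: "1 < r \<Longrightarrow> measure mix {real n * r..} \<le> r * exp (- (2 / p * chi_rate r * real n))"
proof -
  assume r: "1 < r"
  then have "{t. 0 \<le> (1 - 1 / r) * (t - real n * r)} = {real n * r..}" by (auto simp: zero_le_mult_iff)
  then show ?thesis using mix_tail[of r] r by simp
qed

lemma mix_lower_tail: "0 < r \<Longrightarrow> r < 1 \<Longrightarrow> measure mix {..real n * r} \<le> r * exp (- (2 / p * chi_rate r * real n))"
proof -
  assume r: "0 < r" "r < 1"
  then have "1 - 1 / r < 0" by (simp add: field_simps)
  then have "{t. 0 \<le> (1 - 1 / r) * (t - real n * r)} = {..real n * r}" by (auto simp: zero_le_mult_iff)
  then show ?thesis using mix_tail[of r] r by simp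
qed

end

section \<open>The radius of a uniform vector in the ball\<close>

text \<open>
  The length of a point of the ball, scaled such that it concentrates at \<open>sqrt (Mp2 p)\<close>.
\<close>

definition radius :: "real \<Rightarrow> nat \<Rightarrow> (nat \<Rightarrow> real) \<Rightarrow> real"
  where "radius p n x = real n powr (1 / p - 1 / 2) * nrm n x"

lemma radius_nonneg: "0 \<le> radius p n x"
  by (simp add: radius_def)

lemma measurable_radius [measurable]: "radius p n \<in> borel_measurable borel"
  unfolding radius_def[abs_def] by measurable

lemma radius_sq:
  assumes "1 \<le> n" shows "real n * (radius p n x)\<^sup>2 = real n powr (2 / p) * (\<Sum>i<n. (x i)\<^sup>2)"
proof -
  have "(real n powr (1 / p - 1 / 2))\<^sup>2 = real n powr (2 / p - 1)"
    using assms by (simp add: power2_eq_square flip: powr_add)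
  moreover have "real n * real n powr (2 / p - 1) = real n powr (2 / p)"
    using powr_add[of "real n" 1 "2 / p - 1"] assms by simp
  moreover have "(nrm n x)\<^sup>2 = (\<Sum>i<n. (x i)\<^sup>2)" by (simp add: nrm_eq sum_nonneg)
  ultimately show ?thesis by (simp add: radius_def power_mult_distrib flip: mult.assoc)
qed

lemma sum_sq_scaled:
  assumes "0 < t" shows "(\<Sum>i<n. ((t powr (1 / p) *\<^sub>R x) i)\<^sup>2) = t powr (2 / p) * (\<Sum>i<n. (x i)\<^sup>2)"
proof -
  have "(t powr (1 / p))\<^sup>2 = t powr (2 / p)" by (simp add: power2_eq_square flip: powr_add)
  then show ?thesis by (simp add: scaleR_fun_def power_mult_distrib sum_distrib_left)
qed

context uniform_ball
begin

lemma radius_event: "A \<in> sets borel \<Longrightarrow> {x. radius p n x \<in> A} \<in> sets \<nu>"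
  using measurable_sets[OF measurable_radius, of A p n] by (simp add: vimage_def)

text \<open>
  A dilation by at least \<open>(n r)^(1/p)\<close> carries a vector of large radius to one with a large sum of
  squares. The next two lemmas are the analogues for small radii and for the converse estimate.
\<close>

lemma radius_le_gauss:
  assumes n: "1 \<le> n" and v: "0 \<le> v" and r: "0 < r"
  shows "measure \<nu> {x. v \<le> radius p n x} * measure mix {real n * r..}
    \<le> measure (pgauss_law p n) {x. real n * (v\<^sup>2 * r powr (2 / p)) \<le> (\<Sum>i<n. (x i)\<^sup>2)}"
proof (rule mixture_lower)
  fix t x assume t: "0 < t" "t \<in> {real n * r..}" and x: "x \<in> {x. v \<le> radius p n x}"
  have "real n * (v\<^sup>2 * r powr (2 / p)) \<le> real n * ((radius p n x)\<^sup>2 * r powr (2 / p))"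
    using x v by (intro mult_left_mono mult_right_mono power_mono) auto
  also have "\<dots> = (real n * r) powr (2 / p) * (\<Sum>i<n. (x i)\<^sup>2)"
    using radius_sq[OF n, of p x] r by (simp add: powr_mult mult_ac)
  also have "\<dots> \<le> t powr (2 / p) * (\<Sum>i<n. (x i)\<^sup>2)"
    using t r p by (intro mult_right_mono powr_mono2 sum_nonneg) auto
  finally show "t powr (1 / p) *\<^sub>R x \<in> {x. real n * (v\<^sup>2 * r powr (2 / p)) \<le> (\<Sum>i<n. (x i)\<^sup>2)}"
    by (simp only: mem_Collect_eq sum_sq_scaled[OF t(1)])
qed measurable

lemma radius_ge_gauss:
  assumes n: "1 \<le> n" and v: "0 \<le> v" and r: "0 < r"
  shows "measure \<nu> {x. radius p n x \<le> v} * measure mix {..real n * r}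
    \<le> measure (pgauss_law p n) {x. (\<Sum>i<n. (x i)\<^sup>2) \<le> real n * (v\<^sup>2 * r powr (2 / p))}"
proof (rule mixture_lower)
  fix t x assume t: "0 < t" "t \<in> {..real n * r}" and x: "x \<in> {x. radius p n x \<le> v}"
  have "t powr (2 / p) * (\<Sum>i<n. (x i)\<^sup>2) \<le> (real n * r) powr (2 / p) * (\<Sum>i<n. (x i)\<^sup>2)"
    using t r p by (intro mult_right_mono powr_mono2 sum_nonneg) auto
  also have "\<dots> = real n * ((radius p n x)\<^sup>2 * r powr (2 / p))"
    using radius_sq[OF n, of p x] r by (simp add: powr_mult mult_ac)
  also have "\<dots> \<le> real n * (v\<^sup>2 * r powr (2 / p))"
    using x by (intro mult_left_mono mult_right_mono power_mono radius_nonneg) auto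
  finally show "t powr (1 / p) *\<^sub>R x \<in> {x. (\<Sum>i<n. (x i)\<^sup>2) \<le> real n * (v\<^sup>2 * r powr (2 / p))}"
    by (simp only: mem_Collect_eq sum_sq_scaled[OF t(1)])
qed measurable

lemma gauss_le_radius:
  assumes n: "1 \<le> n" and v: "0 \<le> v" and r: "0 < r"
  shows "measure (pgauss_law p n) {x. real n * (v\<^sup>2 * r powr (2 / p)) < (\<Sum>i<n. (x i)\<^sup>2)}
    \<le> measure \<nu> {x. v < radius p n x} + measure mix {real n * r..}"
proof (rule mixture_upper)
  fix t x assume t: "0 < t" "t \<notin> {real n * r..}"
    and x: "t powr (1 / p) *\<^sub>R x \<in> {x. real n * (v\<^sup>2 * r powr (2 / p)) < (\<Sum>i<n. (x i)\<^sup>2)}"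
  have "real n * (v\<^sup>2 * r powr (2 / p)) < t powr (2 / p) * (\<Sum>i<n. (x i)\<^sup>2)"
    using x by (simp only: mem_Collect_eq sum_sq_scaled[OF t(1)])
  also have "\<dots> \<le> (real n * r) powr (2 / p) * (\<Sum>i<n. (x i)\<^sup>2)"
    using t r p by (intro mult_right_mono powr_mono2 sum_nonneg) auto
  also have "\<dots> = real n * ((radius p n x)\<^sup>2 * r powr (2 / p))"
    using radius_sq[OF n, of p x] r by (simp add: powr_mult mult_ac)
  finally have "v\<^sup>2 < (radius p n x)\<^sup>2" using n r by simp
  then show "x \<in> {x. v < radius p n x}" using power2_less_imp_less[OF _ radius_nonneg] by simp
qed measurable

lemma mix_above: "0 < r \<Longrightarrow> r < 1 \<Longrightarrow> 1 - exp (- (2 / p * chi_rate r * real n)) \<le> measure mix {real n * r..}"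
proof -
  assume r: "0 < r" "r < 1"
  interpret X: prob_space mix by (rule prob_space_mix)
  have "r * exp (- (2 / p * chi_rate r * real n)) \<le> 1 * exp (- (2 / p * chi_rate r * real n))"
    using r by (intro mult_right_mono) auto
  then have "1 - exp (- (2 / p * chi_rate r * real n)) \<le> 1 - measure mix {..real n * r}"
    using mix_lower_tail[OF r] by linarith
  also have "\<dots> = measure mix (space mix - {..real n * r})" by (rule X.prob_compl[symmetric]) simp
  also have "\<dots> \<le> measure mix {real n * r..}" by (intro X.finite_measure_mono) auto
  finally show ?thesis .
qed

lemma mix_below: "1 < r \<Longrightarrow> 1 - r * exp (- (2 / p * chi_rate r * real n)) \<le> measure mix {..real n * r}"
proof -
  assume r: "1 < r"
  interpret X: prob_space mix by (rule prob_space_mix)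
  have "1 - r * exp (- (2 / p * chi_rate r * real n)) \<le> 1 - measure mix {real n * r..}"
    using mix_upper_tail[OF r] by simp
  also have "\<dots> = measure mix (space mix - {real n * r..})" by (rule X.prob_compl[symmetric]) simp
  also have "\<dots> \<le> measure mix {..real n * r}" by (intro X.finite_measure_mono) auto
  finally show ?thesis .
qed

end

text \<open>
  The rate of the radius as a function of its square; it is the cost of one coordinate that accounts
  for the excess over \<open>Mp2 p\<close>.
\<close>

definition heavy_rate :: "real \<Rightarrow> real \<Rightarrow> real"
  where "heavy_rate p y = 1 / p * (y - Mp2 p) powr (p / 2)"

context
  fixes p :: real
  assumes p: "0 < p" and all_prob: "\<forall>n\<ge>1. prob_space (uniform_on_lp_ball p n)"
begin

lemma uniform_ballI: "1 \<le> n \<Longrightarrow> uniform_ball p n"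
  using p all_prob by (simp add: uniform_ball_def)

text \<open>
  The mixing variable exceeds \<open>n r\<close> with probability at least \<open>1 / 2\<close> when \<open>r < 1\<close>, so passing from
  the ball to the product law costs at most a factor of \<open>2\<close>.
\<close>

lemma radius_upper_compare:
  assumes v: "0 \<le> v" and r: "0 < r" "r < 1"
  shows "\<forall>\<^sub>F n in sequentially. measure (uniform_on_lp_ball p n) {x. v \<le> radius p n x}
    \<le> 2 * measure (pgauss_law p n) {x. real n * (v\<^sup>2 * r powr (2 / p)) \<le> (\<Sum>i<n. (x i)\<^sup>2)}"
proof -
  have "0 < 2 / p * chi_rate r" using p r chi_rate_pos[of r] by simp
  then have "\<forall>\<^sub>F n in sequentially. 1 * exp (- (2 / p * chi_rate r * real n)) < 1 / 2"
    by (rule eventually_exp_small) simp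
  then show ?thesis using eventually_ge_at_top[of 1]
  proof eventually_elim
    case (elim n)
    interpret uniform_ball p n using elim by (intro uniform_ballI)
    have "1 / 2 \<le> measure mix {real n * r..}" using mix_above[OF r] elim by simp
    then have "measure \<nu> {x. v \<le> radius p n x} * (1 / 2) \<le> measure \<nu> {x. v \<le> radius p n x} * measure mix {real n * r..}"
      by (intro mult_left_mono) auto
    also have "\<dots> \<le> measure (pgauss_law p n) {x. real n * (v\<^sup>2 * r powr (2 / p)) \<le> (\<Sum>i<n. (x i)\<^sup>2)}"
      using elim v r by (intro radius_le_gauss) auto
    finally show ?case by simp
  qed
qed

lemma radius_lower_compare:
  assumes v: "0 \<le> v" and r: "1 < r"
  shows "\<forall>\<^sub>F n in sequentially. measure (uniform_on_lp_ball p n) {x. radius p n x \<le> v}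
    \<le> 2 * measure (pgauss_law p n) {x. (\<Sum>i<n. (x i)\<^sup>2) \<le> real n * (v\<^sup>2 * r powr (2 / p))}"
proof -
  have "0 < 2 / p * chi_rate r" using p r chi_rate_pos[of r] by simp
  then have "\<forall>\<^sub>F n in sequentially. r * exp (- (2 / p * chi_rate r * real n)) < 1 / 2"
    by (rule eventually_exp_small) simp
  then show ?thesis using eventually_ge_at_top[of 1]
  proof eventually_elim
    case (elim n)
    interpret uniform_ball p n using elim by (intro uniform_ballI)
    have "1 / 2 \<le> measure mix {..real n * r}" using mix_below[OF r] elim by simp
    then have "measure \<nu> {x. radius p n x \<le> v} * (1 / 2) \<le> measure \<nu> {x. radius p n x \<le> v} * measure mix {..real n * r}"
      by (intro mult_left_mono) auto
    also have "\<dots> \<le> measure (pgauss_law p n) {x. (\<Sum>i<n. (x i)\<^sup>2) \<le> real n * (v\<^sup>2 * r powr (2 / p))}"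
      using elim v r by (intro radius_ge_gauss) auto
    finally show ?case by simp
  qed
qed

lemma tendsto_dilate: "((\<lambda>r. v\<^sup>2 * r powr (2 / p)) \<longlongrightarrow> v\<^sup>2) (at 1 within S)"
proof -
  have "((\<lambda>r. v\<^sup>2 * r powr (2 / p)) \<longlongrightarrow> v\<^sup>2 * 1 powr (2 / p)) (at 1 within S)"
    by (intro tendsto_intros) auto
  then show ?thesis by simp
qed

text \<open>
  An open condition at \<open>v\<^sup>2\<close> persists after multiplication by \<open>r^(2/p)\<close> with \<open>r\<close> close to \<open>1\<close>. The
  slack in \<open>r\<close> pays for the fluctuations of the mixing variable \<open>\<tau>\<close>.
\<close>

lemma dilate_up:
  assumes ev: "\<And>f. (f \<longlongrightarrow> v\<^sup>2) (at_right 1) \<Longrightarrow> \<forall>\<^sub>F r in at_right (1::real). Q (f r)"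
  obtains r where "1 < r" "Q (v\<^sup>2 * r powr (2 / p))"
proof -
  have "\<forall>\<^sub>F r in at_right (1::real). Q (v\<^sup>2 * r powr (2 / p)) \<and> 1 < r"
    by (intro eventually_conj ev tendsto_dilate eventually_at_right_less)
  then have "\<exists>r. Q (v\<^sup>2 * r powr (2 / p)) \<and> 1 < r" by (rule eventually_happens'[rotated]) simp
  then show ?thesis using that by blast
qed

lemma dilate_down:
  assumes ev: "\<And>f. (f \<longlongrightarrow> v\<^sup>2) (at_left 1) \<Longrightarrow> \<forall>\<^sub>F r in at_left (1::real). Q (f r)"
  obtains r where "0 < r" "r < 1" "Q (v\<^sup>2 * r powr (2 / p))"
proof -
  have "\<forall>\<^sub>F r in at_left (1::real). r \<in> {0<..<1}" by (rule eventually_at_leftI[of 0]) auto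
  then have "\<forall>\<^sub>F r in at_left (1::real). Q (v\<^sup>2 * r powr (2 / p)) \<and> r \<in> {0<..<1}"
    by (intro eventually_conj ev tendsto_dilate)
  then have "\<exists>r. Q (v\<^sup>2 * r powr (2 / p)) \<and> r \<in> {0<..<1}" by (rule eventually_happens'[rotated]) simp
  then show ?thesis using that by auto
qed

lemma Mp2_pos_p: "0 < Mp2 p" by (rule Mp2_pos[OF p])

lemma radius_lower_tail:
  assumes v: "v < sqrt (Mp2 p)"
  shows "\<exists>c>0. exp_upper real (\<lambda>n. measure (uniform_on_lp_ball p n) {x. radius p n x \<in> {..v}}) (ereal c)"
proof -
  define v' where "v' = max v 0"
  have v': "0 \<le> v'" "v \<le> v'" "v' < sqrt (Mp2 p)" using v Mp2_pos_p by (auto simp: v'_def)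
  have "v'\<^sup>2 < (sqrt (Mp2 p))\<^sup>2" using v' by (intro power_strict_mono) auto
  then have lt: "v'\<^sup>2 < Mp2 p" using Mp2_pos_p by simp
  obtain r where r: "1 < r" "v'\<^sup>2 * r powr (2 / p) < Mp2 p"
    by (rule dilate_up[of v' "\<lambda>y. y < Mp2 p"]) (use lt in \<open>auto intro: order_tendstoD(2)\<close>)
  define e where "e = Mp2 p - v'\<^sup>2 * r powr (2 / p)"
  have e: "0 < e" "Mp2 p - e = v'\<^sup>2 * r powr (2 / p)" using r by (simp_all add: e_def)
  obtain c where c: "0 < c" "\<And>n. measure (pgauss_law p n) {x. (\<Sum>i<n. (x i)\<^sup>2) \<le> real n * (Mp2 p - e)} \<le> exp (- (c * real n))"
    using pgauss_sum_lower_tail[OF p e(1)] by blast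
  have "exp_upper real (\<lambda>n. measure (uniform_on_lp_ball p n) {x. radius p n x \<in> {..v}}) (ereal c)"
  proof (rule exp_upperI_bound[OF filterlim_real_sequentially])
    show "\<forall>\<^sub>F n in sequentially. measure (uniform_on_lp_ball p n) {x. radius p n x \<in> {..v}} \<le> 2 * exp (- (c * real n))"
      using radius_lower_compare[OF v'(1) r(1)] eventually_ge_at_top[of 1]
    proof eventually_elim
      case (elim n)
      interpret uniform_ball p n using elim by (intro uniform_ballI)
      interpret prob_space \<nu> by (rule prob)
      have "measure \<nu> {x. radius p n x \<in> {..v}} \<le> measure \<nu> {x. radius p n x \<le> v'}"
        using v'(2) by (intro finite_measure_mono) auto
      then show ?case using elim c(2)[of n] unfolding e(2) by linarith
    qed
  qed simp
  then show ?thesis using c(1) by blast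
qed

lemma radius_upper_tail_light:
  assumes p2: "2 \<le> p" and v: "sqrt (Mp2 p) < v"
  shows "\<exists>c>0. exp_upper real (\<lambda>n. measure (uniform_on_lp_ball p n) {x. radius p n x \<in> {v..}}) (ereal c)"
proof -
  have v0: "0 \<le> v" using v Mp2_pos_p real_sqrt_ge_zero[of "Mp2 p"] by linarith
  have "(sqrt (Mp2 p))\<^sup>2 < v\<^sup>2" using v Mp2_pos_p by (intro power_strict_mono) auto
  then have lt: "Mp2 p < v\<^sup>2" using Mp2_pos_p by simp
  obtain r where r: "0 < r" "r < 1" "Mp2 p < v\<^sup>2 * r powr (2 / p)"
    by (rule dilate_down[of v "\<lambda>y. Mp2 p < y"]) (use lt in \<open>auto intro: order_tendstoD(1)\<close>)
  define e where "e = v\<^sup>2 * r powr (2 / p) - Mp2 p"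
  have e: "0 < e" "Mp2 p + e = v\<^sup>2 * r powr (2 / p)" using r by (simp_all add: e_def)
  obtain c where c: "0 < c" "\<And>n. measure (pgauss_law p n) {x. real n * (Mp2 p + e) \<le> (\<Sum>i<n. (x i)\<^sup>2)} \<le> exp (- (c * real n))"
    using pgauss_sum_upper_tail_light[OF p2 e(1)] by blast
  have "exp_upper real (\<lambda>n. measure (uniform_on_lp_ball p n) {x. radius p n x \<in> {v..}}) (ereal c)"
  proof (rule exp_upperI_bound[OF filterlim_real_sequentially])
    show "\<forall>\<^sub>F n in sequentially. measure (uniform_on_lp_ball p n) {x. radius p n x \<in> {v..}} \<le> 2 * exp (- (c * real n))"
      using radius_upper_compare[OF v0 r(1,2)]
    proof eventually_elim
      case (elim n)
      then show ?case using c(2)[of n] unfolding e(2) by simp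
    qed
  qed simp
  then show ?thesis using c(1) by blast
qed

lemma tendsto_heavy_rate:
  assumes "(f \<longlongrightarrow> y) F" "Mp2 p < y" shows "((\<lambda>r. heavy_rate p (f r)) \<longlongrightarrow> heavy_rate p y) F"
  unfolding heavy_rate_def using assms by (intro tendsto_intros) auto

lemma radius_upper_tail_heavy:
  assumes p2: "p < 2" and v: "sqrt (Mp2 p) < v"
  shows "exp_upper (\<lambda>n. real n powr (p / 2)) (\<lambda>n. measure (uniform_on_lp_ball p n) {x. radius p n x \<in> {v..}}) (ereal (heavy_rate p (v\<^sup>2)))"
  unfolding exp_upper_def
proof (intro allI impI)
  fix c assume "ereal c < ereal (heavy_rate p (v\<^sup>2))"
  then have c: "c < heavy_rate p (v\<^sup>2)" by simp
  have v0: "0 \<le> v" using v Mp2_pos_p real_sqrt_ge_zero[of "Mp2 p"] by linarith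
  have "(sqrt (Mp2 p))\<^sup>2 < v\<^sup>2" using v Mp2_pos_p by (intro power_strict_mono) auto
  then have lt: "Mp2 p < v\<^sup>2" using Mp2_pos_p by simp
  obtain r where r: "0 < r" "r < 1" "Mp2 p < v\<^sup>2 * r powr (2 / p) \<and> c < heavy_rate p (v\<^sup>2 * r powr (2 / p))"
    by (rule dilate_down[of v "\<lambda>y. Mp2 p < y \<and> c < heavy_rate p y"])
      (use lt c in \<open>auto intro!: eventually_conj intro: order_tendstoD(1) order_tendstoD(1)[OF tendsto_heavy_rate]\<close>)
  define e where "e = v\<^sup>2 * r powr (2 / p) - Mp2 p"
  have e: "0 < e" "Mp2 p + e = v\<^sup>2 * r powr (2 / p)" using r by (simp_all add: e_def)
  have "exp_upper (\<lambda>n. real n powr (p / 2)) (\<lambda>n. 2 * measure (pgauss_law p n) {x. real n * (Mp2 p + e) \<le> (\<Sum>i<n. (x i)\<^sup>2)}) (ereal (e powr (p / 2) / p))"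
    by (intro exp_upper_scale speed_at_top pgauss_sum_upper_tail_heavy p p2 e) auto
  moreover have "ereal c < ereal (e powr (p / 2) / p)" using r(3) by (simp add: heavy_rate_def e_def)
  ultimately have "\<forall>\<^sub>F n in sequentially. 2 * measure (pgauss_law p n) {x. real n * (Mp2 p + e) \<le> (\<Sum>i<n. (x i)\<^sup>2)} \<le> exp (- (c * real n powr (p / 2)))"
    by (rule exp_upperD)
  with radius_upper_compare[OF v0 r(1,2)]
  show "\<forall>\<^sub>F n in sequentially. measure (uniform_on_lp_ball p n) {x. radius p n x \<in> {v..}} \<le> exp (- (c * real n powr (p / 2)))"
    unfolding e(2) by eventually_elim simp
qed

text \<open>
  The big jump of the product law is inherited by the radius except for two events of strictly
  larger rate: an untypical mixing variable, and a radius beyond \<open>v + e\<close>.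
\<close>

lemma radius_at_heavy:
  assumes p2: "p < 2" and v: "sqrt (Mp2 p) \<le> v" and e: "0 < e"
  shows "exp_lower (\<lambda>n. real n powr (p / 2)) (\<lambda>n. measure (uniform_on_lp_ball p n) {x. radius p n x \<in> ball v e}) (ereal (heavy_rate p (v\<^sup>2)))"
  unfolding exp_lower_def
proof (intro allI impI)
  fix c assume "ereal (heavy_rate p (v\<^sup>2)) < ereal c"
  then have c: "heavy_rate p (v\<^sup>2) < c" by simp
  have v0: "0 < v" using v Mp2_pos_p real_sqrt_gt_zero[of "Mp2 p"] by linarith
  have "(sqrt (Mp2 p))\<^sup>2 \<le> v\<^sup>2" using v Mp2_pos_p by (intro power_mono) auto
  then have M: "Mp2 p \<le> v\<^sup>2" using Mp2_pos_p by simp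
  \<comment> \<open>the right limit at \<open>v\<close> also covers the boundary point, where the rate vanishes\<close>
  have "((\<lambda>w. 1 / p * (w\<^sup>2 - Mp2 p) powr (p / 2)) \<longlongrightarrow> 1 / p * (v\<^sup>2 - Mp2 p) powr (p / 2)) (at_right v)"
  proof (intro tendsto_mult tendsto_const tendsto_powr')
    show "((\<lambda>w. w\<^sup>2 - Mp2 p) \<longlongrightarrow> v\<^sup>2 - Mp2 p) (at_right v)" by (intro tendsto_intros)
    have "\<forall>\<^sub>F w in at_right v. v < w" by (rule eventually_at_right_less)
    then have "\<forall>\<^sub>F w in at_right v. 0 \<le> w\<^sup>2 - Mp2 p"
    proof eventually_elim
      case (elim w)
      then have "v\<^sup>2 \<le> w\<^sup>2" using v0 by (intro power_mono) auto
      then show ?case using M by simp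
    qed
    then show "v\<^sup>2 - Mp2 p \<noteq> 0 \<or> (0 < p / 2 \<and> (\<forall>\<^sub>F w in at_right v. 0 \<le> w\<^sup>2 - Mp2 p))" using p by simp
  qed
  then have "\<forall>\<^sub>F w in at_right v. heavy_rate p (w\<^sup>2) < c"
    using c unfolding heavy_rate_def by (intro order_tendstoD(2)) auto
  moreover have "\<forall>\<^sub>F w in at_right v. w \<in> {v<..<v + e}" by (rule eventually_at_rightI[of _ "v + e"]) (use e in auto)
  ultimately have "\<forall>\<^sub>F w in at_right v. heavy_rate p (w\<^sup>2) < c \<and> w \<in> {v<..<v + e}" by (rule eventually_conj)
  then have "\<exists>w. heavy_rate p (w\<^sup>2) < c \<and> w \<in> {v<..<v + e}" by (rule eventually_happens'[rotated]) simp
  then obtain w where w: "heavy_rate p (w\<^sup>2) < c" "v < w" "w < v + e" by auto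
  have w0: "0 \<le> w" using v0 w by simp
  have "v\<^sup>2 < w\<^sup>2" "w\<^sup>2 < (v + e)\<^sup>2" using v0 w by (auto intro!: power_strict_mono)
  then have Mw: "Mp2 p < w\<^sup>2" "w\<^sup>2 < (v + e)\<^sup>2" using M by auto
  obtain r where r: "1 < r" "(Mp2 p < w\<^sup>2 * r powr (2 / p) \<and> w\<^sup>2 * r powr (2 / p) < (v + e)\<^sup>2) \<and> heavy_rate p (w\<^sup>2 * r powr (2 / p)) < c"
    by (rule dilate_up[of w "\<lambda>y. (Mp2 p < y \<and> y < (v + e)\<^sup>2) \<and> heavy_rate p y < c"])
      (use Mw w(1) in \<open>auto intro!: eventually_conj intro: order_tendstoD order_tendstoD(2)[OF tendsto_heavy_rate]\<close>)
  define \<tau> where "\<tau> = w\<^sup>2 * r powr (2 / p) - Mp2 p"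
  have \<tau>: "0 \<le> \<tau>" "Mp2 p + \<tau> = w\<^sup>2 * r powr (2 / p)" "\<tau> powr (p / 2) / p < c" using r by (simp_all add: \<tau>_def heavy_rate_def)
  have ve: "sqrt (Mp2 p) < v + e" using v e by simp
  have big: "\<tau> powr (p / 2) / p < heavy_rate p ((v + e)\<^sup>2)"
  proof -
    have "\<tau> powr (p / 2) < ((v + e)\<^sup>2 - Mp2 p) powr (p / 2)" using r \<tau> p by (intro powr_less_mono2) (auto simp: \<tau>_def)
    then show ?thesis using p by (simp add: heavy_rate_def divide_strict_right_mono)
  qed
  let ?s = "\<lambda>n. real n powr (p / 2)"
  define K where "K = 2 / p * chi_rate r"
  have K: "0 < K" using p r chi_rate_pos[of r] by (simp add: K_def)
  have m1: "exp_upper real (\<lambda>n. r * exp (- (K * real n))) (ereal K)"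
    using r by (intro exp_upperI_bound[OF filterlim_real_sequentially, of r]) auto
  have m2: "(\<lambda>n. real n powr (p / 2)) \<in> o(real)" using p p2 by real_asymp
  have mix: "exp_upper ?s (\<lambda>n. r * exp (- (K * real n))) (ereal (heavy_rate p ((v + e)\<^sup>2)))"
    by (rule exp_upper_faster[OF filterlim_real_sequentially m1 _ m2]) (simp add: K)
  have "exp_upper ?s (\<lambda>n. r * exp (- (K * real n)) + measure (uniform_on_lp_ball p n) {x. radius p n x \<in> {v + e..}}) (ereal (heavy_rate p ((v + e)\<^sup>2)))"
    by (rule exp_upper_add[OF speed_at_top[OF p] mix radius_upper_tail_heavy[OF p2 ve]])
  then have "exp_lower ?s (\<lambda>n. measure (pgauss_law p n) {x. real n * (Mp2 p + \<tau>) < (\<Sum>i<n. (x i)\<^sup>2)}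
      - (r * exp (- (K * real n)) + measure (uniform_on_lp_ball p n) {x. radius p n x \<in> {v + e..}})) (ereal (\<tau> powr (p / 2) / p))"
    by (rule exp_lower_diff[OF speed_at_top[OF p] pgauss_sum_big_jump[OF p \<tau>(1)]]) (simp add: big)
  from exp_lowerD[OF this, of c] \<tau>(3)
  have "\<forall>\<^sub>F n in sequentially. exp (- (c * ?s n)) \<le> measure (pgauss_law p n) {x. real n * (Mp2 p + \<tau>) < (\<Sum>i<n. (x i)\<^sup>2)}
      - (r * exp (- (K * real n)) + measure (uniform_on_lp_ball p n) {x. radius p n x \<in> {v + e..}})" by simp
  then show "\<forall>\<^sub>F n in sequentially. exp (- (c * ?s n)) \<le> measure (uniform_on_lp_ball p n) {x. radius p n x \<in> ball v e}"
    using eventually_ge_at_top[of 1]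
  proof eventually_elim
    case (elim n)
    interpret uniform_ball p n using elim by (intro uniform_ballI)
    interpret prob_space \<nu> by (rule prob)
    have "measure (pgauss_law p n) {x. real n * (Mp2 p + \<tau>) < (\<Sum>i<n. (x i)\<^sup>2)}
      \<le> measure \<nu> {x. w < radius p n x} + measure mix {real n * r..}"
      unfolding \<tau>(2) using elim w0 r by (intro gauss_le_radius) auto
    also have "measure mix {real n * r..} \<le> r * exp (- (K * real n))"
      using mix_upper_tail[OF r(1)] by (simp add: K_def)
    also have "measure \<nu> {x. w < radius p n x} \<le> measure \<nu> ({x. radius p n x \<in> ball v e} \<union> {x. radius p n x \<in> {v + e..}})"
    proof (rule finite_measure_mono)
      show "{x. w < radius p n x} \<subseteq> {x. radius p n x \<in> ball v e} \<union> {x. radius p n x \<in> {v + e..}}"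
        using w by (auto simp: dist_real_def)
    qed (intro sets.Un radius_event, simp_all)
    also have "\<dots> \<le> measure \<nu> {x. radius p n x \<in> ball v e} + measure \<nu> {x. radius p n x \<in> {v + e..}}"
      by (intro measure_Un_le radius_event) simp_all
    finally show ?case using elim by linarith
  qed
qed

end

section \<open>The direction factor\<close>

text \<open>
  The direction factor of a Gaussian vector: the ratio of the quadratic mean of its first \<open>k\<close>
  coordinates to that of all coordinates.
\<close>

definition ratio :: "nat \<Rightarrow> nat \<Rightarrow> (nat \<Rightarrow> real) \<Rightarrow> real"
  where "ratio n k g = sqrt (real n / real k) * (sqrt (\<Sum>i<k. (g i)\<^sup>2) / sqrt (\<Sum>i<n. (g i)\<^sup>2))"

lemma ratio_eq: "ratio n k g = sqrt (((\<Sum>i<k. (g i)\<^sup>2) / real k) / ((\<Sum>i<n. (g i)\<^sup>2) / real n))"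
  by (simp add: ratio_def real_sqrt_divide real_sqrt_mult mult.commute)

lemma measurable_ratio [measurable]: "ratio n k \<in> borel_measurable borel"
  unfolding ratio_def[abs_def] by measurable

lemma sets_gauss_law [simp, measurable_cong]: "sets (gauss_law n) = sets borel"
  and space_gauss_law [simp]: "space (gauss_law n) = UNIV"
  by (simp_all add: gauss_law_def)

lemma prob_space_gauss_law: "prob_space (gauss_law n)"
  unfolding gauss_law_def by (intro prob_space_prod_law is_density_normal) simp

lemma gauss_upper_tail:
  "1 < r \<Longrightarrow> k \<le> n \<Longrightarrow> measure (gauss_law n) {x. real k * r \<le> (\<Sum>i<k. (x i)\<^sup>2)} \<le> exp (- (chi_rate r * real k))"
  using chi_square_upper_tail[of "\<lambda>_. normal_density 0 1" k 1 r n] is_density_normal[of 1]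
  by (simp add: gauss_law_def mult.commute)

lemma gauss_lower_tail:
  "0 < r \<Longrightarrow> r < 1 \<Longrightarrow> k \<le> n \<Longrightarrow> measure (gauss_law n) {x. (\<Sum>i<k. (x i)\<^sup>2) \<le> real k * r} \<le> exp (- (chi_rate r * real k))"
  using chi_square_lower_tail[of "\<lambda>_. normal_density 0 1" k 1 r n] is_density_normal[of 1]
  by (simp add: gauss_law_def mult.commute)

lemma chi_rate_ge: "0 < t \<Longrightarrow> t / 4 - 1 / 2 \<le> chi_rate t"
proof -
  assume t: "0 < t"
  have "ln t = ln (t / 2) + ln 2" using t by (simp add: ln_div)
  also have "\<dots> \<le> (t / 2 - 1) + 1" using t ln_le_minus_one[of "t / 2"] ln_2_less_1 by linarith
  finally show ?thesis by (simp add: chi_rate_def field_simps)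
qed

lemma chi_rate_ge_ln: "0 < u \<Longrightarrow> - 1 / 2 - ln u \<le> chi_rate (u\<^sup>2)"
  by (simp add: chi_rate_def ln_realpow)

lemma chi_rate_sq: "0 < u \<Longrightarrow> chi_rate (u\<^sup>2) = (u\<^sup>2 - 1) / 2 - ln u"
  by (simp add: chi_rate_def ln_realpow)

lemma tendsto_chi_rate: "(f \<longlongrightarrow> a) F \<Longrightarrow> 0 < a \<Longrightarrow> ((\<lambda>x. chi_rate (f x)) \<longlongrightarrow> chi_rate a) F"
  unfolding chi_rate_def by (intro tendsto_intros) auto

text \<open>
  Up to deviations of the denominator, the square of the ratio is a mean of \<open>k\<close> squared normal
  variables, which explains the square in the argument.
\<close>

definition ratio_rate :: "real \<Rightarrow> ereal"
  where "ratio_rate u = (if 0 < u then ereal (chi_rate (u\<^sup>2)) else \<infinity>)"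

lemma ratio_event: "A \<in> sets borel \<Longrightarrow> {g. ratio n j g \<in> A} \<in> sets (gauss_law n)"
  using measurable_sets[OF measurable_ratio, of A n j] by (simp add: vimage_def)

context
  fixes k :: "nat \<Rightarrow> nat"
  assumes all_k: "\<forall>n\<ge>1. 1 \<le> k n \<and> k n \<le> n"
    and k_lim: "filterlim (\<lambda>n. real (k n)) at_top sequentially"
    and k_small: "(\<lambda>n. real (k n)) \<in> o(\<lambda>n. real n)"
begin

lemma k_le: "1 \<le> n \<Longrightarrow> 1 \<le> k n \<and> k n \<le> n"
  using all_k by simp

text \<open>
  Deviations of the sum over all \<open>n\<close> coordinates have the speed \<open>n\<close>; this makes the denominator of
  the ratio deterministic at the speed \<open>k n\<close>.
\<close>

lemma exp_n_negligible:
  assumes c: "0 < c" shows "exp_upper (\<lambda>n. real (k n)) (\<lambda>n. exp (- (c * real n))) r"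
proof (rule exp_upper_faster[OF _ _ _ k_small])
  show "exp_upper real (\<lambda>n. exp (- (c * real n))) (ereal c)"
    by (rule exp_upperI_bound[OF filterlim_real_sequentially, of 1]) auto
qed (use c filterlim_real_sequentially in auto)

lemma ratio_upper_tail:
  assumes u: "1 < u"
  shows "exp_upper (\<lambda>n. real (k n)) (\<lambda>n. measure (gauss_law n) {g. ratio n (k n) g \<in> {u..}}) (ratio_rate u)"
  unfolding exp_upper_def
proof (intro allI impI)
  fix c assume "ereal c < ratio_rate u"
  then have c: "c < chi_rate (u\<^sup>2)" using u by (simp add: ratio_rate_def)
  have u2: "1 < u\<^sup>2" using u by simp
  have "((\<lambda>r. u\<^sup>2 * r) \<longlongrightarrow> u\<^sup>2 * 1) (at_left 1)" by (intro tendsto_intros)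
  then have lim: "((\<lambda>r. u\<^sup>2 * r) \<longlongrightarrow> u\<^sup>2) (at_left 1)" by simp
  have "\<forall>\<^sub>F r in at_left 1. c < chi_rate (u\<^sup>2 * r) \<and> 1 < u\<^sup>2 * r \<and> r \<in> {0<..<1}"
    using u2 c by (intro eventually_conj order_tendstoD(1)[OF tendsto_chi_rate[OF lim]] order_tendstoD(1)[OF lim] eventually_at_leftI[of 0]) auto
  then have "\<exists>r. c < chi_rate (u\<^sup>2 * r) \<and> 1 < u\<^sup>2 * r \<and> r \<in> {0<..<1}" by (rule eventually_happens'[rotated]) simp
  then obtain r where r: "c < chi_rate (u\<^sup>2 * r)" "1 < u\<^sup>2 * r" "0 < r" "r < 1" by auto
  have "exp_upper (\<lambda>n. real (k n)) (\<lambda>n. exp (- (chi_rate (u\<^sup>2 * r) * real (k n))) + exp (- (chi_rate r * real n))) (ereal (chi_rate (u\<^sup>2 * r)))"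
    using r chi_rate_pos[of r]
    by (intro exp_upper_add k_lim exp_n_negligible exp_upperI_bound[OF k_lim, of 1]) auto
  from exp_upperD[OF this, of c] r(1)
  have "\<forall>\<^sub>F n in sequentially. exp (- (chi_rate (u\<^sup>2 * r) * real (k n))) + exp (- (chi_rate r * real n)) \<le> exp (- (c * real (k n)))" by simp
  then show "\<forall>\<^sub>F n in sequentially. measure (gauss_law n) {g. ratio n (k n) g \<in> {u..}} \<le> exp (- (c * real (k n)))"
    using eventually_ge_at_top[of 1]
  proof eventually_elim
    case (elim n)
    interpret prob_space "gauss_law n" by (rule prob_space_gauss_law)
    have k: "1 \<le> k n" "k n \<le> n" using k_le elim by auto
    let ?A = "{g::nat \<Rightarrow> real. real (k n) * (u\<^sup>2 * r) \<le> (\<Sum>i<k n. (g i)\<^sup>2)}"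
    let ?B = "{g::nat \<Rightarrow> real. (\<Sum>i<n. (g i)\<^sup>2) \<le> real n * r}"
    have "measure (gauss_law n) {g. ratio n (k n) g \<in> {u..}} \<le> measure (gauss_law n) (?A \<union> ?B)"
    proof (rule finite_measure_mono)
      show "{g. ratio n (k n) g \<in> {u..}} \<subseteq> ?A \<union> ?B"
      proof
        fix g assume g: "g \<in> {g. ratio n (k n) g \<in> {u..}}"
        show "g \<in> ?A \<union> ?B"
        proof (cases "(\<Sum>i<n. (g i)\<^sup>2) \<le> real n * r")
          case False
          define a where "a = (\<Sum>i<k n. (g i)\<^sup>2) / real (k n)"
          define b where "b = (\<Sum>i<n. (g i)\<^sup>2) / real n"
          have b: "r < b" using False elim by (simp add: b_def field_simps)
          have a: "0 \<le> a" by (simp add: a_def sum_nonneg)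
          have "u \<le> sqrt (a / b)" using g by (simp add: ratio_eq a_def b_def)
          then have "u\<^sup>2 \<le> (sqrt (a / b))\<^sup>2" using u by (intro power_mono) auto
          then have "u\<^sup>2 \<le> a / b" using a b r by simp
          then have "u\<^sup>2 * b \<le> a" using b r by (simp add: field_simps)
          moreover have "u\<^sup>2 * r \<le> u\<^sup>2 * b" using b by (intro mult_left_mono) auto
          ultimately have "u\<^sup>2 * r \<le> a" by simp
          then show ?thesis using k by (simp add: a_def field_simps)
        qed simp
      qed
    qed measurable
    also have "\<dots> \<le> measure (gauss_law n) ?A + measure (gauss_law n) ?B" by (rule measure_Un_le) measurable
    also have "\<dots> \<le> exp (- (chi_rate (u\<^sup>2 * r) * real (k n))) + exp (- (chi_rate r * real n))"
      using r k by (intro add_mono gauss_upper_tail gauss_lower_tail) auto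
    finally show ?case using elim by linarith
  qed
qed

lemma ratio_lower_tail_pos:
  assumes u: "0 < u" "u < 1"
  shows "exp_upper (\<lambda>n. real (k n)) (\<lambda>n. measure (gauss_law n) {g. ratio n (k n) g \<in> {..u}}) (ratio_rate u)"
  unfolding exp_upper_def
proof (intro allI impI)
  fix c assume "ereal c < ratio_rate u"
  then have c: "c < chi_rate (u\<^sup>2)" using u by (simp add: ratio_rate_def)
  have u2: "0 < u\<^sup>2" "u\<^sup>2 < 1" using u by (auto simp: power_less_one_iff)
  have "((\<lambda>r. u\<^sup>2 * r) \<longlongrightarrow> u\<^sup>2 * 1) (at_right 1)" by (intro tendsto_intros)
  then have lim: "((\<lambda>r. u\<^sup>2 * r) \<longlongrightarrow> u\<^sup>2) (at_right 1)" by simp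
  have "\<forall>\<^sub>F r in at_right 1. c < chi_rate (u\<^sup>2 * r) \<and> u\<^sup>2 * r < 1 \<and> 1 < r"
    using u2 c by (intro eventually_conj order_tendstoD(1)[OF tendsto_chi_rate[OF lim]] order_tendstoD(2)[OF lim] eventually_at_right_less) auto
  then have "\<exists>r. c < chi_rate (u\<^sup>2 * r) \<and> u\<^sup>2 * r < 1 \<and> 1 < r" by (rule eventually_happens'[rotated]) simp
  then obtain r where r: "c < chi_rate (u\<^sup>2 * r)" "u\<^sup>2 * r < 1" "1 < r" by auto
  have "exp_upper (\<lambda>n. real (k n)) (\<lambda>n. exp (- (chi_rate (u\<^sup>2 * r) * real (k n))) + exp (- (chi_rate r * real n))) (ereal (chi_rate (u\<^sup>2 * r)))"
    using r chi_rate_pos[of r]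
    by (intro exp_upper_add k_lim exp_n_negligible exp_upperI_bound[OF k_lim, of 1]) auto
  from exp_upperD[OF this, of c] r(1)
  have "\<forall>\<^sub>F n in sequentially. exp (- (chi_rate (u\<^sup>2 * r) * real (k n))) + exp (- (chi_rate r * real n)) \<le> exp (- (c * real (k n)))" by simp
  then show "\<forall>\<^sub>F n in sequentially. measure (gauss_law n) {g. ratio n (k n) g \<in> {..u}} \<le> exp (- (c * real (k n)))"
    using eventually_ge_at_top[of 1]
  proof eventually_elim
    case (elim n)
    interpret prob_space "gauss_law n" by (rule prob_space_gauss_law)
    have k: "1 \<le> k n" "k n \<le> n" using k_le elim by auto
    let ?A = "{g::nat \<Rightarrow> real. (\<Sum>i<k n. (g i)\<^sup>2) \<le> real (k n) * (u\<^sup>2 * r)}"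
    let ?B = "{g::nat \<Rightarrow> real. real n * r \<le> (\<Sum>i<n. (g i)\<^sup>2)}"
    have "measure (gauss_law n) {g. ratio n (k n) g \<in> {..u}} \<le> measure (gauss_law n) (?A \<union> ?B)"
    proof (rule finite_measure_mono)
      show "{g. ratio n (k n) g \<in> {..u}} \<subseteq> ?A \<union> ?B"
      proof
        fix g assume g: "g \<in> {g. ratio n (k n) g \<in> {..u}}"
        show "g \<in> ?A \<union> ?B"
        proof (cases "real n * r \<le> (\<Sum>i<n. (g i)\<^sup>2)")
          case False
          define a where "a = (\<Sum>i<k n. (g i)\<^sup>2) / real (k n)"
          define b where "b = (\<Sum>i<n. (g i)\<^sup>2) / real n"
          have b: "0 \<le> b" "b < r" using False elim by (simp_all add: b_def field_simps sum_nonneg)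
          have a: "0 \<le> a" by (simp add: a_def sum_nonneg)
          have "a \<le> u\<^sup>2 * r"
          proof (cases "b = 0")
            case True
            then have "(\<Sum>i<n. (g i)\<^sup>2) = 0" using elim by (simp add: b_def)
            moreover have "(\<Sum>i<k n. (g i)\<^sup>2) \<le> (\<Sum>i<n. (g i)\<^sup>2)" using k by (intro sum_mono2) auto
            ultimately have "a \<le> 0" using k by (simp add: a_def divide_le_0_iff)
            also have "0 \<le> u\<^sup>2 * r" using r by simp
            finally show ?thesis .
          next
            case False
            have "sqrt (a / b) \<le> u" using g by (simp add: ratio_eq a_def b_def)
            then have "(sqrt (a / b))\<^sup>2 \<le> u\<^sup>2" using a b by (intro power_mono) auto
            then have "a / b \<le> u\<^sup>2" using a b by simp
            then have "a \<le> u\<^sup>2 * b" using b False by (simp add: field_simps)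
            also have "\<dots> \<le> u\<^sup>2 * r" using b by (intro mult_left_mono) auto
            finally show ?thesis .
          qed
          then show ?thesis using k by (simp add: a_def field_simps)
        qed simp
      qed
    qed measurable
    also have "\<dots> \<le> measure (gauss_law n) ?A + measure (gauss_law n) ?B" by (rule measure_Un_le) measurable
    also have "\<dots> \<le> exp (- (chi_rate (u\<^sup>2 * r) * real (k n))) + exp (- (chi_rate r * real n))"
      using r k u by (intro add_mono gauss_upper_tail gauss_lower_tail) auto
    finally show ?case using elim by linarith
  qed
qed

text \<open>
  For \<open>u \<le> 0\<close> the rate is infinite, and the bound follows from the case of small positive levels, at
  which the rate is unbounded.
\<close>

lemma ratio_lower_tail:
  assumes u: "u < 1"
  shows "exp_upper (\<lambda>n. real (k n)) (\<lambda>n. measure (gauss_law n) {g. ratio n (k n) g \<in> {..u}}) (ratio_rate u)"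
proof (cases "0 < u")
  case True
  then show ?thesis using u by (rule ratio_lower_tail_pos)
next
  case False
  show ?thesis
    unfolding exp_upper_def
  proof (intro allI impI)
    fix c :: real
    \<comment> \<open>Small enough that \<open>- 1 / 2 - ln w\<close> exceeds \<open>c\<close>.\<close>
    define w where "w = exp (- (\<bar>c\<bar> + 1))"
    have w: "0 < w" "w < 1" by (auto simp: w_def)
    have "c < chi_rate (w\<^sup>2)" using chi_rate_ge_ln[OF w(1)] by (simp add: w_def)
    then have "\<forall>\<^sub>F n in sequentially. measure (gauss_law n) {g. ratio n (k n) g \<in> {..w}} \<le> exp (- (c * real (k n)))"
      using w by (intro exp_upperD[OF ratio_lower_tail_pos]) (auto simp: ratio_rate_def)
    then show "\<forall>\<^sub>F n in sequentially. measure (gauss_law n) {g. ratio n (k n) g \<in> {..u}} \<le> exp (- (c * real (k n)))"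
    proof eventually_elim
      case (elim n)
      interpret prob_space "gauss_law n" by (rule prob_space_gauss_law)
      have "measure (gauss_law n) {g. ratio n (k n) g \<in> {..u}} \<le> measure (gauss_law n) {g. ratio n (k n) g \<in> {..w}}"
        using w False by (intro finite_measure_mono ratio_event) auto
      then show ?case using elim by linarith
    qed
  qed
qed

text \<open>
  The numerator is tilted, while the denominator stays near \<open>1\<close> except for an event that is
  infinitely expensive at the speed \<open>k n\<close>; so no joint law of the two has to be examined.
\<close>

lemma ratio_at:
  assumes u: "0 < u" and e: "0 < e"
  shows "exp_lower (\<lambda>n. real (k n)) (\<lambda>n. measure (gauss_law n) {g. ratio n (k n) g \<in> ball u e}) (ratio_rate u)"
proof -
  have "isCont (\<lambda>q::real \<times> real. sqrt (fst q / snd q)) (u\<^sup>2, 1)" by (intro continuous_intros) auto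
  then have "\<exists>d>0. \<forall>q. dist q (u\<^sup>2, 1) < d \<longrightarrow> dist (sqrt (fst q / snd q)) (sqrt (u\<^sup>2 / 1)) < e"
    unfolding continuous_at_eps_delta using e by auto
  then obtain d where d: "0 < d" "\<And>q. dist q (u\<^sup>2, 1) < d \<Longrightarrow> dist (sqrt (fst q / snd q)) u < e"
    using u by auto
  define \<delta> where "\<delta> = min (d / 2) (1 / 2)"
  have \<delta>: "0 < \<delta>" "\<delta> \<le> d / 2" "\<delta> < 1" using d by (auto simp: \<delta>_def)
  \<comment> \<open>The means \<open>a\<close> of the squares in the numerator and \<open>b\<close> in the denominator determine the ratio.\<close>
  have near: "dist (sqrt (a / b)) u < e" if "\<bar>a - u\<^sup>2\<bar> < \<delta>" "\<bar>b - 1\<bar> < \<delta>" for a b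
  proof -
    have "dist (a, b) (u\<^sup>2, 1) \<le> dist a (u\<^sup>2) + dist b 1"
      unfolding dist_Pair_Pair by (rule sqrt_sum_squares_le_sum) auto
    then have "dist (a, b) (u\<^sup>2, 1) < d" using that \<delta> by (simp add: dist_real_def)
    from d(2)[OF this] show ?thesis by simp
  qed
  have cp: "0 < chi_rate (1 + \<delta>)" "0 < chi_rate (1 - \<delta>)" using \<delta> by (auto intro!: chi_rate_pos)
  let ?P = "\<lambda>n. measure (gauss_law n) {g. \<bar>(\<Sum>i<k n. (g i)\<^sup>2) - real (k n) * u\<^sup>2\<bar> < real (k n) * \<delta>}"
  have 1: "exp_lower (\<lambda>n. real (k n)) ?P (ereal (chi_rate (u\<^sup>2)))"
    unfolding exp_lower_def
  proof (intro allI impI)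
    fix c assume "ereal (chi_rate (u\<^sup>2)) < ereal c"
    then obtain K where K: "\<And>j n. K \<le> j \<Longrightarrow> j \<le> n \<Longrightarrow> exp (- (c * real j)) \<le> measure (gauss_law n) {x. \<bar>(\<Sum>i<j. (x i)\<^sup>2) - real j * u\<^sup>2\<bar> < real j * \<delta>}"
      using gauss_sum_lower[of "u\<^sup>2" \<delta> c] u \<delta>(1) by auto
    have "\<forall>\<^sub>F n in sequentially. real K \<le> real (k n)" using k_lim unfolding filterlim_at_top by (rule spec)
    then show "\<forall>\<^sub>F n in sequentially. exp (- (c * real (k n))) \<le> ?P n"
      using eventually_ge_at_top[of 1]
      by eventually_elim (use K k_le in auto)
  qed
  have 2: "exp_upper (\<lambda>n. real (k n)) (\<lambda>n. exp (- (chi_rate (1 + \<delta>) * real n)) + exp (- (chi_rate (1 - \<delta>) * real n))) \<infinity>"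
    by (intro exp_upper_add k_lim exp_n_negligible cp)
  have "exp_lower (\<lambda>n. real (k n)) (\<lambda>n. ?P n - (exp (- (chi_rate (1 + \<delta>) * real n)) + exp (- (chi_rate (1 - \<delta>) * real n)))) (ereal (chi_rate (u\<^sup>2)))"
    by (rule exp_lower_diff[OF k_lim 1 2]) simp
  moreover have "\<forall>\<^sub>F n in sequentially. ?P n - (exp (- (chi_rate (1 + \<delta>) * real n)) + exp (- (chi_rate (1 - \<delta>) * real n)))
    \<le> measure (gauss_law n) {g. ratio n (k n) g \<in> ball u e}"
    using eventually_ge_at_top[of 1]
  proof eventually_elim
    case (elim n)
    interpret prob_space "gauss_law n" by (rule prob_space_gauss_law)
    have k: "1 \<le> k n" "k n \<le> n" using k_le elim by auto
    let ?R = "{g. ratio n (k n) g \<in> ball u e}"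
    let ?A = "{g::nat \<Rightarrow> real. real n * (1 + \<delta>) \<le> (\<Sum>i<n. (g i)\<^sup>2)}"
    let ?B = "{g::nat \<Rightarrow> real. (\<Sum>i<n. (g i)\<^sup>2) \<le> real n * (1 - \<delta>)}"
    have A: "?A \<in> sets (gauss_law n)" and B: "?B \<in> sets (gauss_law n)" by simp_all
    have R: "?R \<in> sets (gauss_law n)" by (intro ratio_event) simp
    have "?P n \<le> measure (gauss_law n) (?R \<union> (?A \<union> ?B))"
    proof (rule finite_measure_mono)
      show "{g. \<bar>(\<Sum>i<k n. (g i)\<^sup>2) - real (k n) * u\<^sup>2\<bar> < real (k n) * \<delta>} \<subseteq> ?R \<union> (?A \<union> ?B)"
      proof
        fix g assume g: "g \<in> {g. \<bar>(\<Sum>i<k n. (g i)\<^sup>2) - real (k n) * u\<^sup>2\<bar> < real (k n) * \<delta>}"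
        define a where "a = (\<Sum>i<k n. (g i)\<^sup>2) / real (k n)"
        define b where "b = (\<Sum>i<n. (g i)\<^sup>2) / real n"
        have sa: "(\<Sum>i<k n. (g i)\<^sup>2) = real (k n) * a" and sb: "(\<Sum>i<n. (g i)\<^sup>2) = real n * b"
          using k by (auto simp: a_def b_def)
        have "\<bar>(\<Sum>i<k n. (g i)\<^sup>2) - real (k n) * u\<^sup>2\<bar> < real (k n) * \<delta>" using g by simp
        then have "\<bar>real (k n) * (a - u\<^sup>2)\<bar> < real (k n) * \<delta>" unfolding sa by (simp add: right_diff_distrib)
        then have a: "\<bar>a - u\<^sup>2\<bar> < \<delta>" using k by (simp add: abs_mult)
        show "g \<in> ?R \<union> (?A \<union> ?B)"
        proof (cases "\<bar>b - 1\<bar> < \<delta>")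
          case True
          have "ratio n (k n) g = sqrt (a / b)" by (simp add: ratio_eq a_def b_def)
          then have "g \<in> ?R" using near[OF a True] by (simp add: dist_commute)
          then show ?thesis by blast
        next
          case False
          then have "1 + \<delta> \<le> b \<or> b \<le> 1 - \<delta>" by linarith
          then show ?thesis using elim by (auto simp: sb)
        qed
      qed
    qed (intro sets.Un A B R)
    also have "\<dots> \<le> measure (gauss_law n) ?R + measure (gauss_law n) (?A \<union> ?B)" by (intro measure_Un_le sets.Un A B R)
    also have "measure (gauss_law n) (?A \<union> ?B) \<le> measure (gauss_law n) ?A + measure (gauss_law n) ?B" by (intro measure_Un_le A B)
    also have "\<dots> \<le> exp (- (chi_rate (1 + \<delta>) * real n)) + exp (- (chi_rate (1 - \<delta>) * real n))"
      using \<delta> by (intro add_mono gauss_upper_tail gauss_lower_tail) auto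
    finally show ?case by simp
  qed
  ultimately show ?thesis by (rule exp_lower_mono) (use u in \<open>simp add: ratio_rate_def\<close>)
qed

end

section \<open>The rate functions\<close>

lemma heavy_rate_nonneg: "0 < p \<Longrightarrow> 0 \<le> heavy_rate p y"
  by (simp add: heavy_rate_def)

text \<open>
  The rate function of a quantity that is deterministic at the speed considered.
\<close>

definition point_rate :: "real \<Rightarrow> real \<Rightarrow> ereal"
  where "point_rate a y = (if y = a then 0 else \<infinity>)"

lemma point_rate_sublevel: "{y. point_rate a y \<le> ereal \<alpha>} \<subseteq> {a}"
  by (auto simp: point_rate_def split: if_splits)

lemma point_rate_nonneg: "0 \<le> point_rate a y" and point_rate_self: "point_rate a a = 0"
  by (simp_all add: point_rate_def)

text \<open>
  If both tails are infinitely expensive, almost all of the mass is near \<open>m\<close>.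
\<close>

lemma exp_lower_concentrated:
  fixes N :: "nat \<Rightarrow> 'b measure" and Y :: "nat \<Rightarrow> 'b \<Rightarrow> real"
  assumes s: "filterlim s at_top sequentially"
    and prob: "\<And>n. 1 \<le> n \<Longrightarrow> prob_space (N n)"
    and events: "\<And>n A. 1 \<le> n \<Longrightarrow> A \<in> sets borel \<Longrightarrow> {x. Y n x \<in> A} \<in> sets (N n)"
    and low: "\<And>v. v < m \<Longrightarrow> exp_upper s (\<lambda>n. measure (N n) {x. Y n x \<in> {..v}}) \<infinity>"
    and up: "\<And>v. m < v \<Longrightarrow> exp_upper s (\<lambda>n. measure (N n) {x. Y n x \<in> {v..}}) \<infinity>"
    and e: "0 < e"
  shows "exp_lower s (\<lambda>n. measure (N n) {x. Y n x \<in> ball v e}) (point_rate m v)"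
proof (cases "v = m")
  case True
  have "exp_upper s (\<lambda>n. measure (N n) {x. Y n x \<in> {..v - e}} + measure (N n) {x. Y n x \<in> {v + e..}}) \<infinity>"
    using e True by (intro exp_upper_add s low up) auto
  from exp_upperD[OF this, of 1]
  have ev: "\<forall>\<^sub>F n in sequentially. measure (N n) {x. Y n x \<in> {..v - e}} + measure (N n) {x. Y n x \<in> {v + e..}} \<le> exp (- (1 * s n))" by simp
  have "\<forall>\<^sub>F n in sequentially. 2 * exp (- (1 * s n)) \<le> exp (- (0 * s n))"
    by (intro eventually_mult_exp_le[OF s]) auto
  with ev have "\<forall>\<^sub>F n in sequentially. 1 / 2 \<le> measure (N n) {x. Y n x \<in> ball v e}"
    using eventually_ge_at_top[of 1]
  proof eventually_elim
    case (elim n)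
    interpret prob_space "N n" using elim by (intro prob)
    note ev = events[OF elim(3)]
    have "UNIV \<in> events" using ev[of UNIV] by simp
    then have "space (N n) = UNIV" using sets.sets_into_space by blast
    then have "1 = prob UNIV" using prob_space by simp
    also have "UNIV = {x. Y n x \<in> ball v e} \<union> ({x. Y n x \<in> {..v - e}} \<union> {x. Y n x \<in> {v + e..}})"
      using e by (auto simp: dist_real_def)
    also have "prob \<dots> \<le> prob {x. Y n x \<in> ball v e} + prob ({x. Y n x \<in> {..v - e}} \<union> {x. Y n x \<in> {v + e..}})"
      by (intro measure_Un_le sets.Un ev) simp_all
    also have "prob ({x. Y n x \<in> {..v - e}} \<union> {x. Y n x \<in> {v + e..}}) \<le> prob {x. Y n x \<in> {..v - e}} + prob {x. Y n x \<in> {v + e..}}"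
      by (intro measure_Un_le ev) simp_all
    finally show ?case using elim by simp
  qed
  then show ?thesis using True by (intro exp_lower_nonneg s) (simp_all add: point_rate_def)
next
  case False
  then show ?thesis by (simp add: point_rate_def exp_lower_def)
qed

lemma ratio_rate_nonpos: "u \<le> 0 \<Longrightarrow> ratio_rate u = \<infinity>"
  by (simp add: ratio_rate_def)

lemma compact_subset_singleton: "S \<subseteq> {a} \<Longrightarrow> compact (S :: real set)"
  by (drule subset_singletonD, elim disjE) simp_all

text \<open>
  The logarithm keeps the sublevel sets away from \<open>0\<close>, the quadratic term keeps them bounded, and in
  between the rate is continuous.
\<close>

lemma compact_ratio_rate: "compact {u. ratio_rate u \<le> ereal \<alpha>}"
proof -
  \<comment> \<open>Bounds for the sublevel set, from \<open>chi_rate_ge_ln\<close> and \<open>chi_rate_ge\<close>.\<close>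
  let ?l = "exp (- 1 / 2 - \<alpha>)" and ?h = "sqrt \<bar>4 * \<alpha> + 2\<bar>"
  have "{u. ratio_rate u \<le> ereal \<alpha>} = {u \<in> {?l..?h}. chi_rate (u\<^sup>2) \<le> \<alpha>}"
  proof (intro subset_antisym subsetI)
    fix u assume "u \<in> {u. ratio_rate u \<le> ereal \<alpha>}"
    then have u: "0 < u" "chi_rate (u\<^sup>2) \<le> \<alpha>" by (auto simp: ratio_rate_def split: if_splits)
    have "- 1 / 2 - \<alpha> \<le> ln u" using chi_rate_ge_ln[OF u(1)] u(2) by linarith
    then have l: "?l \<le> u" using u(1) by (simp add: ln_ge_iff)
    have "u\<^sup>2 / 4 - 1 / 2 \<le> \<alpha>" using chi_rate_ge[of "u\<^sup>2"] u by simp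
    then have "u\<^sup>2 \<le> \<bar>4 * \<alpha> + 2\<bar>" by simp
    then have "u \<le> ?h" by (rule real_le_rsqrt)
    then show "u \<in> {u \<in> {?l..?h}. chi_rate (u\<^sup>2) \<le> \<alpha>}" using l u by simp
  next
    fix u assume u: "u \<in> {u \<in> {?l..?h}. chi_rate (u\<^sup>2) \<le> \<alpha>}"
    then have "0 < u" by (auto intro: less_le_trans[OF exp_gt_zero])
    then show "u \<in> {u. ratio_rate u \<le> ereal \<alpha>}" using u by (simp add: ratio_rate_def)
  qed
  moreover have "compact {u \<in> {?l..?h}. chi_rate (u\<^sup>2) \<le> \<alpha>}"
  proof -
    have cont: "continuous_on {?l..?h} (\<lambda>u. chi_rate (u\<^sup>2))"
    proof -
      have "u\<^sup>2 \<noteq> 0" if "u \<in> {?l..?h}" for u using that by (auto dest: less_le_trans[OF exp_gt_zero])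
      then show ?thesis unfolding chi_rate_def by (intro continuous_intros) auto
    qed
    have "closed ({?l..?h} \<inter> (\<lambda>u. chi_rate (u\<^sup>2)) -` {..\<alpha>})"
      by (intro continuous_closed_preimage cont) auto
    then have "compact ({?l..?h} \<inter> ({?l..?h} \<inter> (\<lambda>u. chi_rate (u\<^sup>2)) -` {..\<alpha>}))"
      by (intro compact_Int_closed) auto
    moreover have "{?l..?h} \<inter> ({?l..?h} \<inter> (\<lambda>u. chi_rate (u\<^sup>2)) -` {..\<alpha>}) = {u \<in> {?l..?h}. chi_rate (u\<^sup>2) \<le> \<alpha>}" by auto
    ultimately show ?thesis by simp
  qed
  ultimately show ?thesis by simp
qed

lemma compact_heavy_rate:
  assumes p: "0 < p"
  shows "compact {y. sqrt (Mp2 p) \<le> y \<and> ereal (heavy_rate p (y\<^sup>2)) \<le> ereal \<alpha>}"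
proof -
  let ?l = "sqrt (Mp2 p)" and ?h = "sqrt (Mp2 p + \<bar>p * \<alpha>\<bar> powr (2 / p))"
  have M: "0 < Mp2 p" by (rule Mp2_pos[OF p])
  have "{y. ?l \<le> y \<and> ereal (heavy_rate p (y\<^sup>2)) \<le> ereal \<alpha>} = {?l..?h} \<inter> ({?l..?h} \<inter> (\<lambda>y. heavy_rate p (y\<^sup>2)) -` {..\<alpha>})"
  proof (intro subset_antisym subsetI)
    fix y assume "y \<in> {y. ?l \<le> y \<and> ereal (heavy_rate p (y\<^sup>2)) \<le> ereal \<alpha>}"
    then have y: "?l \<le> y" "heavy_rate p (y\<^sup>2) \<le> \<alpha>" by auto
    have "?l\<^sup>2 \<le> y\<^sup>2" using y M by (intro power_mono) auto
    then have My: "0 \<le> y\<^sup>2 - Mp2 p" using M by simp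
    have "(y\<^sup>2 - Mp2 p) powr (p / 2) \<le> \<bar>p * \<alpha>\<bar>" using y(2) p by (simp add: heavy_rate_def field_simps)
    then have "((y\<^sup>2 - Mp2 p) powr (p / 2)) powr (2 / p) \<le> \<bar>p * \<alpha>\<bar> powr (2 / p)" using p by (intro powr_mono2) auto
    then have "y\<^sup>2 - Mp2 p \<le> \<bar>p * \<alpha>\<bar> powr (2 / p)" using p My by (simp add: powr_powr)
    then have "y \<le> ?h" by (intro real_le_rsqrt) simp
    then show "y \<in> {?l..?h} \<inter> ({?l..?h} \<inter> (\<lambda>y. heavy_rate p (y\<^sup>2)) -` {..\<alpha>})" using y by simp
  qed auto
  moreover have "continuous_on {?l..?h} (\<lambda>y. heavy_rate p (y\<^sup>2))"
  proof -
    have "0 \<le> y\<^sup>2 - Mp2 p" if "y \<in> {?l..?h}" for y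
    proof -
      have "?l\<^sup>2 \<le> y\<^sup>2" using that M by (intro power_mono) auto
      then show ?thesis using M by simp
    qed
    then show ?thesis unfolding heavy_rate_def using p by (intro continuous_intros continuous_on_powr') auto
  qed
  then have "closed ({?l..?h} \<inter> (\<lambda>y. heavy_rate p (y\<^sup>2)) -` {..\<alpha>})" by (intro continuous_closed_preimage) auto
  ultimately show ?thesis by (simp only: compact_Int_closed compact_Icc)
qed

lemma heavy_rate_mono:
  assumes p: "0 < p" and y: "sqrt (Mp2 p) \<le> y" "y \<le> z"
  shows "heavy_rate p (y\<^sup>2) \<le> heavy_rate p (z\<^sup>2)"
proof -
  have M: "0 < Mp2 p" by (rule Mp2_pos[OF p])
  have "(sqrt (Mp2 p))\<^sup>2 \<le> y\<^sup>2" using y M by (intro power_mono) auto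
  moreover have "y\<^sup>2 \<le> z\<^sup>2" using y M by (intro power_mono) (auto intro: order_trans[OF _ y(1)])
  ultimately show ?thesis using p M unfolding heavy_rate_def by (intro mult_left_mono powr_mono2) auto
qed

lemma ratio_rate_1: "ratio_rate 1 = 0" by (simp add: ratio_rate_def chi_rate_def zero_ereal_def)

lemma ratio_rate_nonneg: "0 \<le> ratio_rate u"
proof (cases "0 < u")
  case True
  then have "0 \<le> chi_rate (u\<^sup>2)" using ln_le_minus_one[of "u\<^sup>2"] by (simp add: chi_rate_def)
  then show ?thesis using True by (simp add: ratio_rate_def zero_ereal_def)
qed (simp add: ratio_rate_def)

lemma multiplicative_rate_gauss:
  assumes "0 < m" shows "multiplicative_rate m (point_rate m) ratio_rate"
proof
  show "compact {y. m \<le> y \<and> point_rate m y \<le> ereal \<alpha>}" for \<alpha>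
    using point_rate_sublevel[of m \<alpha>] by (intro compact_subset_singleton[of _ m]) auto
  show "compact {u. ratio_rate u \<le> ereal \<alpha>}" for \<alpha> by (rule compact_ratio_rate)
  show "point_rate m y \<le> point_rate m z" if "m \<le> y" "y \<le> z" for y z
    using that by (cases "z = m") (simp_all add: point_rate_def)
qed (use assms in \<open>simp_all add: ratio_rate_1 ratio_rate_nonneg point_rate_nonneg ratio_rate_nonpos, simp_all add: point_rate_def\<close>)

lemma multiplicative_rate_critical:
  assumes p: "0 < p" shows "multiplicative_rate (sqrt (Mp2 p)) (\<lambda>y. ereal (heavy_rate p (y\<^sup>2))) ratio_rate"
proof
  show "compact {y. sqrt (Mp2 p) \<le> y \<and> ereal (heavy_rate p (y\<^sup>2)) \<le> ereal \<alpha>}" for \<alpha> by (rule compact_heavy_rate[OF p])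
  show "compact {u. ratio_rate u \<le> ereal \<alpha>}" for \<alpha> by (rule compact_ratio_rate)
  show "ereal (heavy_rate p ((sqrt (Mp2 p))\<^sup>2)) = 0" using Mp2_pos[OF p] by (simp add: heavy_rate_def zero_ereal_def)
  show "ereal (heavy_rate p (y\<^sup>2)) \<le> ereal (heavy_rate p (z\<^sup>2))" if "sqrt (Mp2 p) \<le> y" "y \<le> z" for y z
    using heavy_rate_mono[OF p that] by simp
qed (use p Mp2_pos[OF p] in \<open>simp_all add: ratio_rate_1 ratio_rate_nonneg ratio_rate_nonpos heavy_rate_nonneg\<close>)

lemma multiplicative_rate_stretched:
  assumes p: "0 < p" shows "multiplicative_rate (sqrt (Mp2 p)) (\<lambda>y. ereal (heavy_rate p (y\<^sup>2))) (point_rate 1)"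
proof
  show "compact {y. sqrt (Mp2 p) \<le> y \<and> ereal (heavy_rate p (y\<^sup>2)) \<le> ereal \<alpha>}" for \<alpha> by (rule compact_heavy_rate[OF p])
  show "compact {u. point_rate 1 u \<le> ereal \<alpha>}" for \<alpha>
    by (rule compact_subset_singleton[OF point_rate_sublevel])
  show "ereal (heavy_rate p ((sqrt (Mp2 p))\<^sup>2)) = 0" using Mp2_pos[OF p] by (simp add: heavy_rate_def zero_ereal_def)
  show "ereal (heavy_rate p (y\<^sup>2)) \<le> ereal (heavy_rate p (z\<^sup>2))" if "sqrt (Mp2 p) \<le> y" "y \<le> z" for y z
    using heavy_rate_mono[OF p that] by simp
  show "point_rate 1 u = \<infinity>" if "u \<le> 0" for u :: real
    using that by (cases "u = 1") (simp_all add: point_rate_def)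
qed (use p Mp2_pos[OF p] in \<open>simp_all add: heavy_rate_nonneg point_rate_nonneg point_rate_self\<close>)

text \<open>
  With the radius fixed at \<open>sqrt (Mp2 p)\<close> the infimum has only one finite term.
\<close>

lemma rate_gauss_eq:
  assumes p: "0 < p"
  shows "multiplicative_rate.rate (sqrt (Mp2 p)) (point_rate (sqrt (Mp2 p))) ratio_rate = rate_gauss p"
proof
  fix x
  let ?m = "sqrt (Mp2 p)"
  interpret multiplicative_rate ?m "point_rate ?m" ratio_rate using Mp2_pos[OF p] by (intro multiplicative_rate_gauss) simp
  have "rate x = ratio_rate (x / ?m)"
  proof (rule antisym[OF rate_le_J])
    show "ratio_rate (x / ?m) \<le> rate x"
      unfolding rate_def by (rule INF_greatest) (auto simp: point_rate_def)
  qed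
  also have "\<dots> = rate_gauss p x"
  proof (cases "0 < x")
    case True
    have "chi_rate ((x / ?m)\<^sup>2) = ((x / ?m)\<^sup>2 - 1) / 2 - ln (x / ?m)" using True m_pos by (intro chi_rate_sq) simp
    also have "((x / ?m)\<^sup>2 - 1) / 2 = (x\<^sup>2 - Mp2 p) / (2 * Mp2 p)"
      using Mp2_pos[OF p] by (simp add: power_divide field_simps)
    finally show ?thesis using True m_pos by (simp add: ratio_rate_def rate_gauss_def)
  next
    case False
    then have "\<not> 0 < x / ?m" using m_pos by (simp add: zero_less_divide_iff)
    then show ?thesis using False by (simp add: ratio_rate_def rate_gauss_def)
  qed
  finally show "rate x = rate_gauss p x" .
qed

lemma rate_critical_eq:
  assumes p: "0 < p"
  shows "multiplicative_rate.rate (sqrt (Mp2 p)) (\<lambda>y. ereal (heavy_rate p (y\<^sup>2))) ratio_rate = rate_critical p"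
proof
  fix x
  let ?m = "sqrt (Mp2 p)"
  interpret multiplicative_rate ?m "\<lambda>y. ereal (heavy_rate p (y\<^sup>2))" ratio_rate by (rule multiplicative_rate_critical[OF p])
  have e: "ratio_rate (x / y) + ereal (heavy_rate p (y\<^sup>2))
    = (if x > 0 then ereal (((x / y)\<^sup>2 - 1) / 2 - ln (x / y) + 1 / p * (y\<^sup>2 - Mp2 p) powr (p / 2)) else \<infinity>)" if "y \<in> {?m..}" for y
  proof -
    have y: "0 < y" using that m_pos unfolding atLeast_iff by linarith
    show ?thesis
    proof (cases "0 < x")
      case True
      then show ?thesis using y chi_rate_sq[of "x / y"] by (simp add: ratio_rate_def heavy_rate_def)
    next
      case False
      then have "\<not> 0 < x / y" using y by (simp add: zero_less_divide_iff)
      then show ?thesis using False by (simp add: ratio_rate_def)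
    qed
  qed
  show "rate x = rate_critical p x"
    unfolding rate_def rate_critical_def by (subst INF_cong[OF refl e]) auto
qed

text \<open>
  With the ratio fixed at \<open>1\<close> only the term \<open>y = x\<close> of the infimum is finite, and it occurs only for
  \<open>x \<ge> sqrt (Mp2 p)\<close>.
\<close>

lemma rate_stretched_eq:
  assumes p: "0 < p"
  shows "multiplicative_rate.rate (sqrt (Mp2 p)) (\<lambda>y. ereal (heavy_rate p (y\<^sup>2))) (point_rate 1) = rate_stretched p"
proof
  fix x
  let ?m = "sqrt (Mp2 p)"
  interpret multiplicative_rate ?m "\<lambda>y. ereal (heavy_rate p (y\<^sup>2))" "point_rate 1" by (rule multiplicative_rate_stretched[OF p])
  have pt: "point_rate 1 (x / y) = (if y = x then 0 else \<infinity>)" if "?m \<le> y" for y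
    using that m_pos by (auto simp: point_rate_def)
  show "rate x = rate_stretched p x"
  proof (cases "?m \<le> x")
    case True
    have "rate x = ereal (heavy_rate p (x\<^sup>2))"
    proof (rule antisym[OF rate_le_K[OF True]])
      show "ereal (heavy_rate p (x\<^sup>2)) \<le> rate x"
        unfolding rate_def by (rule INF_greatest) (auto simp: pt)
    qed
    then show ?thesis using True by (simp add: rate_stretched_def heavy_rate_def)
  next
    case False
    have "\<infinity> \<le> rate x" unfolding rate_def by (rule INF_greatest) (use False in \<open>auto simp: pt\<close>)
    then show ?thesis using False by (simp add: rate_stretched_def)
  qed
qed

section \<open>Moderate deviations of the projected norm\<close>

context
  fixes p :: real and k :: "nat \<Rightarrow> nat" and M :: "nat \<Rightarrow> 'a measure"
    and X :: "nat \<Rightarrow> 'a \<Rightarrow> nat \<Rightarrow> real" and E :: "nat \<Rightarrow> 'a \<Rightarrow> (nat \<Rightarrow> real) set"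
  assumes p: "0 < p" and all_k: "\<forall>n\<ge>1. 1 \<le> k n \<and> k n \<le> n"
    and all_prob: "\<forall>n\<ge>1. prob_space (M n)"
    and all_law: "\<forall>n\<ge>1. distr (M n) borel (X n) = uniform_on_lp_ball p n"
    and all_haar: "\<forall>n\<ge>1. grassmannian_haar n (k n) (distr (M n) (grassmannian_borel n (k n)) (E n))"
    and all_indep: "\<forall>n\<ge>1. indep_rvs (M n) borel (X n) (grassmannian_borel n (k n)) (E n)"
begin

lemma
  assumes "1 \<le> n"
  shows k_bounds: "1 \<le> k n \<and> k n \<le> n" and M_prob: "prob_space (M n)"
    and X_law: "distr (M n) borel (X n) = uniform_on_lp_ball p n"
    and E_haar: "grassmannian_haar n (k n) (distr (M n) (grassmannian_borel n (k n)) (E n))"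
    and XE_indep: "indep_rvs (M n) borel (X n) (grassmannian_borel n (k n)) (E n)"
  using assms all_k all_prob all_law all_haar all_indep by simp_all

definition proj_ratio :: "nat \<Rightarrow> 'a \<Rightarrow> real"
  where "proj_ratio n \<omega> = sqrt (real n / real (k n)) * (nrm n (orth_proj n (E n \<omega>) (X n \<omega>)) / nrm n (X n \<omega>))"

lemma X_meas: "1 \<le> n \<Longrightarrow> X n \<in> borel_measurable (M n)"
  using XE_indep by (simp add: indep_rvs_def)

lemma E_meas: "1 \<le> n \<Longrightarrow> E n \<in> M n \<rightarrow>\<^sub>M grassmannian_borel n (k n)"
  using XE_indep by (simp add: indep_rvs_def)

lemma uniform_prob: "1 \<le> n \<Longrightarrow> prob_space (uniform_on_lp_ball p n)"
  using prob_space.prob_space_distr[OF M_prob X_meas] X_law by metis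

lemma radius_X_meas: "1 \<le> n \<Longrightarrow> (\<lambda>\<omega>. radius p n (X n \<omega>)) \<in> borel_measurable (M n)"
  using measurable_compose[OF X_meas measurable_radius] .

lemma proj_X_meas: "1 \<le> n \<Longrightarrow> (\<lambda>\<omega>. nrm n (orth_proj n (E n \<omega>) (X n \<omega>))) \<in> borel_measurable (M n)"
  by (intro measurable_nrm measurable_orth_proj_compose[OF X_meas E_meas])

lemma proj_ratio_meas: "1 \<le> n \<Longrightarrow> proj_ratio n \<in> borel_measurable (M n)"
  unfolding proj_ratio_def[abs_def]
  by (intro borel_measurable_times borel_measurable_const borel_measurable_divide proj_X_meas measurable_nrm X_meas)

text \<open>
  Scaled to radius and ratio, the independence of length and surviving fraction, with the law of the
  fraction expressed by Gaussian coordinates.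
\<close>

lemma joint_law:
  assumes n: "1 \<le> n" and A: "A \<in> sets borel" and C: "C \<in> sets borel"
  shows "\<P>(\<omega> in M n. radius p n (X n \<omega>) \<in> A \<and> proj_ratio n \<omega> \<in> C)
    = \<P>(\<omega> in M n. radius p n (X n \<omega>) \<in> A) * measure (gauss_law n) {g. ratio n (k n) g \<in> C}"
proof -
  interpret prob_space "M n" by (rule M_prob[OF n])
  interpret G: prob_space "gauss_law n" by (rule prob_space_gauss_law)
  interpret U: uniform_ball p n using p uniform_prob[OF n] by (simp add: uniform_ball_def)
  let ?A = "{a. real n powr (1 / p - 1 / 2) * a \<in> A}" and ?C = "{c. sqrt (real n / real (k n)) * c \<in> C}"
  have A': "?A \<in> sets borel" and C': "?C \<in> sets borel"
  proof -
    have "(\<lambda>a. real n powr (1 / p - 1 / 2) * a) -` A \<in> sets borel" by (rule measurable_sets_borel[OF _ A]) simp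
    then show "?A \<in> sets borel" by (simp add: vimage_def)
    have "(\<lambda>c. sqrt (real n / real (k n)) * c) -` C \<in> sets borel" by (rule measurable_sets_borel[OF _ C]) simp
    then show "?C \<in> sets borel" by (simp add: vimage_def)
  qed
  have AE: "AE x in distr (M n) borel (X n). x \<in> Rn n \<and> x \<noteq> 0"
    unfolding X_law[OF n] using U.AE_\<nu>_Rn U.AE_\<nu>_nonzero[OF AE_lebesgue_Rn_nonzero[OF n]] by (rule AE_conjI)
  have "emeasure (distr (M n) (grassmannian_borel n (k n)) (E n)) {F \<in> grassmannian n (k n). nrm n (orth_proj n F (unit_vec 0)) \<in> ?C}
    = (\<integral>\<^sup>+g. indicator ?C (sqrt (\<Sum>i<k n. (g i)\<^sup>2) / sqrt (\<Sum>i<n. (g i)\<^sup>2)) * gauss_density n g \<partial>lebesgue_Rn n)"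
    using haar_projection_law[OF E_haar[OF n] n C'] by simp
  also have "\<dots> = (\<integral>\<^sup>+g. gauss_density n g * indicator {g. ratio n (k n) g \<in> C} g \<partial>lebesgue_Rn n)"
    by (intro nn_integral_cong) (simp add: ratio_def indicator_def)
  also have "\<dots> = emeasure (gauss_law n) {g. ratio n (k n) g \<in> C}"
    unfolding gauss_law_eq using ratio_event[OF C, of n "k n"] by (subst emeasure_density) simp_all
  finally have g: "emeasure (distr (M n) (grassmannian_borel n (k n)) (E n)) {F \<in> grassmannian n (k n). nrm n (orth_proj n F (unit_vec 0)) \<in> ?C}
    = emeasure (gauss_law n) {g. ratio n (k n) g \<in> C}" .
  have "emeasure (M n) {\<omega> \<in> space (M n). radius p n (X n \<omega>) \<in> A \<and> proj_ratio n \<omega> \<in> C}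
    = emeasure (M n) {\<omega> \<in> space (M n). radius p n (X n \<omega>) \<in> A} * emeasure (gauss_law n) {g. ratio n (k n) g \<in> C}"
    using projection_joint_law[OF M_prob[OF n] XE_indep[OF n] E_haar[OF n] AE A' C'] unfolding g
    by (simp add: radius_def proj_ratio_def)
  then show ?thesis by (simp add: emeasure_eq_measure G.emeasure_eq_measure flip: ennreal_mult)
qed

lemma radius_law:
  assumes n: "1 \<le> n" and A: "A \<in> sets borel"
  shows "\<P>(\<omega> in M n. radius p n (X n \<omega>) \<in> A) = measure (uniform_on_lp_ball p n) {x. radius p n x \<in> A}"
proof -
  have "{x. radius p n x \<in> A} \<in> sets borel"
    using measurable_sets[OF measurable_radius, of A p n] A by (simp add: vimage_def)
  then have "measure (distr (M n) borel (X n)) {x. radius p n x \<in> A} = measure (M n) (X n -` {x. radius p n x \<in> A} \<inter> space (M n))"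
    by (intro measure_distr X_meas n) auto
  then show ?thesis unfolding X_law[OF n] by (simp add: vimage_def Int_def conj_commute)
qed

lemma ratio_law:
  assumes n: "1 \<le> n" and C: "C \<in> sets borel"
  shows "\<P>(\<omega> in M n. proj_ratio n \<omega> \<in> C) = measure (gauss_law n) {g. ratio n (k n) g \<in> C}"
proof -
  interpret prob_space "M n" by (rule M_prob[OF n])
  show ?thesis using joint_law[OF n, of UNIV C] C prob_space by simp
qed

text \<open>
  Divides and multiplies by the length of \<open>X\<close>. If that vanishes, so does the projection, and both
  sides are \<open>0\<close> since division by \<open>0\<close> gives \<open>0\<close>.
\<close>

lemma proj_norm_factor:
  assumes n: "1 \<le> n" and \<omega>: "\<omega> \<in> space (M n)"
  shows "real (k n) powr (- 1 / 2) * proj_norm p X E n \<omega> = radius p n (X n \<omega>) * proj_ratio n \<omega>"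
proof -
  let ?N = "nrm n (orth_proj n (E n \<omega>) (X n \<omega>))"
  have G: "E n \<omega> \<in> grassmannian n (k n)" using measurable_space[OF E_meas[OF n] \<omega>] by simp
  have zero: "?N = 0" if z: "nrm n (X n \<omega>) = 0"
  proof -
    have "(\<Sum>i<n. (X n \<omega> i)\<^sup>2) = 0" using z by (simp add: nrm_eq)
    then have "X n \<omega> i = 0" if "i < n" for i using that by (subst (asm) sum_nonneg_eq_0_iff) auto
    then have "orth_proj n (E n \<omega>) (X n \<omega>) i = 0" for i unfolding orth_proj_matrix[OF G] by simp
    then show ?thesis by (simp add: nrm_eq)
  qed
  have k: "real (k n) > 0" using k_bounds[OF n] by simp
  have "real n powr (1 / p - 1 / 2) * sqrt (real n) = real n powr (1 / p)"
    using n by (simp flip: powr_half_sqrt powr_add)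
  moreover have "real (k n) powr (- 1 / 2) = 1 / sqrt (real (k n))"
    using k by (simp add: powr_minus_divide powr_half_sqrt)
  ultimately have "real (k n) powr (- 1 / 2) * real n powr (1 / p) = real n powr (1 / p - 1 / 2) * sqrt (real n / real (k n))"
    by (simp add: real_sqrt_divide field_simps)
  then show ?thesis
    using zero by (cases "nrm n (X n \<omega>) = 0") (simp_all add: proj_norm_def lp_norm_2 radius_def proj_ratio_def flip: mult.assoc)
qed

text \<open>
  All cases of the theorem are instances: they differ only in the speed and in which of the two
  factors is frozen at this speed.
\<close>

lemma projected_norm_MDP:
  assumes rate: "multiplicative_rate m K J"
    and s: "filterlim s at_top sequentially" and s_pos: "\<And>n. n \<ge> 1 \<Longrightarrow> s n > 0"
    and V_low: "\<And>v. v < m \<Longrightarrow> exp_upper s (\<lambda>n. measure (uniform_on_lp_ball p n) {x. radius p n x \<in> {..v}}) \<infinity>"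
    and V_up: "\<And>v. m < v \<Longrightarrow> exp_upper s (\<lambda>n. measure (uniform_on_lp_ball p n) {x. radius p n x \<in> {v..}}) (K v)"
    and V_at: "\<And>v e. m \<le> v \<Longrightarrow> 0 < e \<Longrightarrow> exp_lower s (\<lambda>n. measure (uniform_on_lp_ball p n) {x. radius p n x \<in> ball v e}) (K v)"
    and B_low: "\<And>u. u < 1 \<Longrightarrow> exp_upper s (\<lambda>n. measure (gauss_law n) {g. ratio n (k n) g \<in> {..u}}) (J u)"
    and B_up: "\<And>u. 1 < u \<Longrightarrow> exp_upper s (\<lambda>n. measure (gauss_law n) {g. ratio n (k n) g \<in> {u..}}) (J u)"
    and B_at: "\<And>u e. 0 < u \<Longrightarrow> 0 < e \<Longrightarrow> exp_lower s (\<lambda>n. measure (gauss_law n) {g. ratio n (k n) g \<in> ball u e}) (J u)"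
  shows "satisfies_MDP M (\<lambda>n \<omega>. real (k n) powr (- 1 / 2) * proj_norm p X E n \<omega>) s (multiplicative_rate.rate m K J)"
proof -
  interpret multiplicative_rate m K J by (rule rate)
  have n1: "\<forall>\<^sub>F n in sequentially. (1::nat) \<le> n" by (rule eventually_ge_at_top)
  have rU: "exp_upper s (\<lambda>n. \<P>(\<omega> in M n. radius p n (X n \<omega>) \<in> A)) r"
    if "exp_upper s (\<lambda>n. measure (uniform_on_lp_ball p n) {x. radius p n x \<in> A}) r" "A \<in> sets borel" for A r
    using n1 by (intro exp_upper_mono[OF that(1)] order_refl, eventually_elim) (simp only: radius_law[OF _ that(2)])
  have rL: "exp_lower s (\<lambda>n. \<P>(\<omega> in M n. radius p n (X n \<omega>) \<in> A)) r"
    if "exp_lower s (\<lambda>n. measure (uniform_on_lp_ball p n) {x. radius p n x \<in> A}) r" "A \<in> sets borel" for A r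
    using n1 by (intro exp_lower_mono[OF that(1)] order_refl, eventually_elim) (simp only: radius_law[OF _ that(2)])
  have bU: "exp_upper s (\<lambda>n. \<P>(\<omega> in M n. proj_ratio n \<omega> \<in> A)) r"
    if "exp_upper s (\<lambda>n. measure (gauss_law n) {g. ratio n (k n) g \<in> A}) r" "A \<in> sets borel" for A r
    using n1 by (intro exp_upper_mono[OF that(1)] order_refl, eventually_elim) (simp only: ratio_law[OF _ that(2)])
  have bL: "exp_lower s (\<lambda>n. \<P>(\<omega> in M n. proj_ratio n \<omega> \<in> A)) r"
    if "exp_lower s (\<lambda>n. measure (gauss_law n) {g. ratio n (k n) g \<in> A}) r" "A \<in> sets borel" for A r
    using n1 by (intro exp_lower_mono[OF that(1)] order_refl, eventually_elim) (simp only: ratio_law[OF _ that(2)])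
  have W_meas: "(\<lambda>\<omega>. real (k n) powr (- 1 / 2) * proj_norm p X E n \<omega>) \<in> borel_measurable (M n)" if n: "1 \<le> n" for n
    unfolding proj_norm_def lp_norm_2 by (intro borel_measurable_times borel_measurable_const proj_X_meas n)
  show ?thesis
  proof (rule product_MDP[where V = "\<lambda>n \<omega>. radius p n (X n \<omega>)" and B = proj_ratio, OF s s_pos M_prob radius_X_meas proj_ratio_meas W_meas proj_norm_factor])
    show "0 \<le> radius p n (X n \<omega>)" for n \<omega> by (rule radius_nonneg)
    show "0 \<le> proj_ratio n \<omega>" for n \<omega> by (simp add: proj_ratio_def)
    show "\<P>(\<omega> in M n. radius p n (X n \<omega>) \<in> A \<and> proj_ratio n \<omega> \<in> C) = \<P>(\<omega> in M n. radius p n (X n \<omega>) \<in> A) * \<P>(\<omega> in M n. proj_ratio n \<omega> \<in> C)"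
      if "1 \<le> n" "A \<in> sets borel" "C \<in> sets borel" for n A C
      unfolding joint_law[OF that] ratio_law[OF that(1,3)] ..
    show "exp_upper s (\<lambda>n. \<P>(\<omega> in M n. radius p n (X n \<omega>) \<in> {..v})) \<infinity>" if "v < m" for v
      by (rule rU[OF V_low[OF that]]) simp
    show "exp_upper s (\<lambda>n. \<P>(\<omega> in M n. radius p n (X n \<omega>) \<in> {v..})) (K v)" if "m < v" for v
      by (rule rU[OF V_up[OF that]]) simp
    show "exp_lower s (\<lambda>n. \<P>(\<omega> in M n. radius p n (X n \<omega>) \<in> ball v e)) (K v)" if "m \<le> v" "0 < e" for v e
      by (rule rL[OF V_at[OF that]]) simp
    show "exp_upper s (\<lambda>n. \<P>(\<omega> in M n. proj_ratio n \<omega> \<in> {..u})) (J u)" if "u < 1" for u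
      by (rule bU[OF B_low[OF that]]) simp
    show "exp_upper s (\<lambda>n. \<P>(\<omega> in M n. proj_ratio n \<omega> \<in> {u..})) (J u)" if "1 < u" for u
      by (rule bU[OF B_up[OF that]]) simp
    show "exp_lower s (\<lambda>n. \<P>(\<omega> in M n. proj_ratio n \<omega> \<in> ball u e)) (J u)" if "0 < u" "0 < e" for u e
      by (rule bL[OF B_at[OF that]]) simp
  qed
qed

end

theorem theorem2:
  fixes p :: real and k :: "nat \<Rightarrow> nat"
    and M :: "nat \<Rightarrow> 'a measure"
    and X :: "nat \<Rightarrow> 'a \<Rightarrow> nat \<Rightarrow> real"
    and E :: "nat \<Rightarrow> 'a \<Rightarrow> (nat \<Rightarrow> real) set"
  assumes "1 \<le> p"
    and "\<forall>n\<ge>1. 1 \<le> k n \<and> k n \<le> n"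
    and "(\<lambda>n. real (k n)) \<in> \<omega>(\<lambda>_. 1)"
    and "(\<lambda>n. real (k n)) \<in> o(\<lambda>n. real n)"
    and "\<forall>n\<ge>1. prob_space (M n)"
    and "\<forall>n\<ge>1. distr (M n) borel (X n) = uniform_on_lp_ball p n"
    and "\<forall>n\<ge>1. grassmannian_haar n (k n) (distr (M n) (grassmannian_borel n (k n)) (E n))"
    and "\<forall>n\<ge>1. indep_rvs (M n) borel (X n) (grassmannian_borel n (k n)) (E n)"
  shows
    "(p \<ge> 2 \<longrightarrow>
        satisfies_MDP M (\<lambda>n \<omega>. real (k n) powr (- 1 / 2) * proj_norm p X E n \<omega>)
          (\<lambda>n. real (k n)) (rate_gauss p)) \<and>
     (p < 2 \<and> (\<lambda>n. real (k n)) \<in> o(\<lambda>n. real n powr (p / 2)) \<longrightarrow>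
        satisfies_MDP M (\<lambda>n \<omega>. real (k n) powr (- 1 / 2) * proj_norm p X E n \<omega>)
          (\<lambda>n. real (k n)) (rate_gauss p)) \<and>
     (p < 2 \<and> (\<forall>n\<ge>1. \<bar>real (k n) - real n powr (p / 2)\<bar> < 1) \<longrightarrow>
        satisfies_MDP M (\<lambda>n \<omega>. real (k n) powr (- 1 / 2) * proj_norm p X E n \<omega>)
          (\<lambda>n. real n powr (p / 2)) (rate_critical p)) \<and>
     (p < 2 \<and> (\<lambda>n. real (k n)) \<in> \<omega>(\<lambda>n. real n powr (p / 2)) \<longrightarrow>
        satisfies_MDP M (\<lambda>n \<omega>. real (k n) powr (- 1 / 2) * proj_norm p X E n \<omega>)
          (\<lambda>n. real n powr (p / 2)) (rate_stretched p))"
proof -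
  have p: "0 < p" using assms(1) by simp
  have uprob: "\<forall>n\<ge>1. prob_space (uniform_on_lp_ball p n)"
    using uniform_prob[OF p assms(2,5,6,7,8)] by blast
  note MDP = projected_norm_MDP[OF p assms(2,5,6,7,8)]
  let ?k = "\<lambda>n. real (k n)" and ?s = "\<lambda>n. real n powr (p / 2)" and ?m = "sqrt (Mp2 p)"
  have k_pos: "?k n > 0" if "1 \<le> n" for n using assms(2) that by (simp add: Suc_le_eq)
  have k_lim: "filterlim ?k at_top sequentially"
  proof -
    have "filterlim ?k at_infinity sequentially" using assms(3) by (simp add: smallomega_1_conv_filterlim)
    moreover have "\<forall>\<^sub>F n in sequentially. 0 < ?k n"
      using eventually_ge_at_top[of 1] by eventually_elim (rule k_pos)
    ultimately show ?thesis by (rule filterlim_at_infinity_imp_filterlim_at_top)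
  qed
  have radius_events: "{x. radius p n x \<in> A} \<in> sets (uniform_on_lp_ball p n)" if "1 \<le> n" "A \<in> sets borel" for n A
    by (rule uniform_ball.radius_event[OF uniform_ballI[OF p uprob that(1)] that(2)])
  have s_lim: "filterlim ?s at_top sequentially" by (rule speed_at_top[OF p])
  have s_pos: "?s n > 0" if "1 \<le> n" for n using that by simp
  note ratio = ratio_lower_tail[OF assms(2) k_lim assms(4)] ratio_upper_tail[OF assms(2) k_lim assms(4)] ratio_at[OF assms(2) k_lim assms(4)]
  have low: "exp_upper s (\<lambda>n. measure (uniform_on_lp_ball p n) {x. radius p n x \<in> {..v}}) \<infinity>"
    if s: "s \<in> o(real)" and v: "v < ?m" for s v
  proof -
    obtain c where "0 < c" "exp_upper real (\<lambda>n. measure (uniform_on_lp_ball p n) {x. radius p n x \<in> {..v}}) (ereal c)"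
      using radius_lower_tail[OF p uprob v] by blast
    then show ?thesis by (intro exp_upper_faster[OF filterlim_real_sequentially _ _ s]) auto
  qed
  \<comment> \<open>Both cases with speed \<open>k n\<close> reduce to upper deviations of the radius being infinitely expensive
    at this speed.\<close>
  have gauss: "satisfies_MDP M (\<lambda>n \<omega>. ?k n powr (- 1 / 2) * proj_norm p X E n \<omega>) ?k (rate_gauss p)"
    if up: "\<And>v. ?m < v \<Longrightarrow> exp_upper ?k (\<lambda>n. measure (uniform_on_lp_ball p n) {x. radius p n x \<in> {v..}}) \<infinity>"
  proof -
    have "0 < ?m" using Mp2_pos[OF p] by simp
    have lowk: "exp_upper ?k (\<lambda>n. measure (uniform_on_lp_ball p n) {x. radius p n x \<in> {..v}}) \<infinity>" if "v < ?m" for v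
      by (rule low[OF _ that]) (use assms(4) in simp)
    show ?thesis
      unfolding rate_gauss_eq[OF p, symmetric]
    proof (rule MDP[OF multiplicative_rate_gauss[OF \<open>0 < ?m\<close>] k_lim k_pos lowk _ _ ratio])
      show "exp_upper ?k (\<lambda>n. measure (uniform_on_lp_ball p n) {x. radius p n x \<in> {v..}}) (point_rate ?m v)" if "?m < v" for v
        using up[OF that] that by (simp add: point_rate_def)
      show "exp_lower ?k (\<lambda>n. measure (uniform_on_lp_ball p n) {x. radius p n x \<in> ball v e}) (point_rate ?m v)" if "?m \<le> v" "0 < e" for v e
        by (rule exp_lower_concentrated[OF k_lim _ radius_events lowk up that(2)]) (use uprob in simp)
    qed
  qed
  have a: "satisfies_MDP M (\<lambda>n \<omega>. ?k n powr (- 1 / 2) * proj_norm p X E n \<omega>) ?k (rate_gauss p)" if p2: "2 \<le> p"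
  proof (rule gauss)
    fix v assume "?m < v"
    then obtain c where "0 < c" "exp_upper real (\<lambda>n. measure (uniform_on_lp_ball p n) {x. radius p n x \<in> {v..}}) (ereal c)"
      using radius_upper_tail_light[OF p uprob p2] by blast
    then show "exp_upper ?k (\<lambda>n. measure (uniform_on_lp_ball p n) {x. radius p n x \<in> {v..}}) \<infinity>"
      by (intro exp_upper_faster[OF filterlim_real_sequentially _ _ assms(4)]) auto
  qed
  have heavy_pos: "0 < heavy_rate p (v\<^sup>2)" if "?m < v" for v
  proof -
    have "?m\<^sup>2 < v\<^sup>2" using that Mp2_pos[OF p] by (intro power_strict_mono) auto
    then show ?thesis using p Mp2_pos[OF p] by (simp add: heavy_rate_def)
  qed
  have b1: "satisfies_MDP M (\<lambda>n \<omega>. ?k n powr (- 1 / 2) * proj_norm p X E n \<omega>) ?k (rate_gauss p)"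
    if p2: "p < 2" and small: "?k \<in> o(?s)"
  proof (rule gauss)
    fix v assume v: "?m < v"
    show "exp_upper ?k (\<lambda>n. measure (uniform_on_lp_ball p n) {x. radius p n x \<in> {v..}}) \<infinity>"
      by (rule exp_upper_faster[OF s_lim radius_upper_tail_heavy[OF p uprob p2 v] _ small]) (simp add: heavy_pos[OF v])
  qed
  have s_small: "?s \<in> o(real)" if "p < 2" using that p by real_asymp
  have b2: "satisfies_MDP M (\<lambda>n \<omega>. ?k n powr (- 1 / 2) * proj_norm p X E n \<omega>) ?s (rate_critical p)"
    if p2: "p < 2" and close: "\<forall>n\<ge>1. \<bar>?k n - ?s n\<bar> < 1"
  proof -
    \<comment> \<open>The rounding of \<open>n powr (p / 2)\<close> to \<open>k n\<close> does not change the speed.\<close>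
    have q: "(\<lambda>n. ?s n / ?k n) \<longlonglongrightarrow> 1"
    proof -
      have "((\<lambda>n. 1 / ?k n) \<longlongrightarrow> 0) sequentially" by (rule tendsto_divide_0[OF tendsto_const filterlim_at_top_imp_at_infinity[OF k_lim]])
      moreover have "\<forall>\<^sub>F n in sequentially. norm (?s n / ?k n - 1) \<le> 1 / ?k n"
        using eventually_ge_at_top[of 1]
      proof eventually_elim
        case (elim n)
        have "?s n / ?k n - 1 = (?s n - ?k n) / ?k n" using k_pos[OF elim] by (simp add: field_simps)
        then have "norm (?s n / ?k n - 1) = \<bar>?s n - ?k n\<bar> / ?k n" using k_pos[OF elim] by simp
        also have "\<dots> \<le> 1 / ?k n" using close elim k_pos[OF elim] by (intro divide_right_mono) (auto simp: abs_minus_commute less_imp_le)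
        finally show ?case .
      qed
      ultimately have "((\<lambda>n. ?s n / ?k n - 1) \<longlongrightarrow> 0) sequentially" by (rule Lim_null_comparison[rotated])
      then show ?thesis by (simp add: LIM_zero_iff)
    qed
    show ?thesis
      unfolding rate_critical_eq[OF p, symmetric]
    proof (rule MDP[OF multiplicative_rate_critical[OF p] s_lim s_pos low[OF s_small[OF p2]] radius_upper_tail_heavy[OF p uprob p2] radius_at_heavy[OF p uprob p2]])
      show "exp_upper ?s (\<lambda>n. measure (gauss_law n) {g. ratio n (k n) g \<in> {..u}}) (ratio_rate u)" if "u < 1" for u
        by (rule exp_upper_speed[OF k_lim ratio(1)[OF that] q])
      show "exp_upper ?s (\<lambda>n. measure (gauss_law n) {g. ratio n (k n) g \<in> {u..}}) (ratio_rate u)" if "1 < u" for u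
        by (rule exp_upper_speed[OF k_lim ratio(2)[OF that] q])
      show "exp_lower ?s (\<lambda>n. measure (gauss_law n) {g. ratio n (k n) g \<in> ball u e}) (ratio_rate u)" if "0 < u" "0 < e" for u e
        by (rule exp_lower_speed[OF k_lim ratio(3)[OF that] q])
    qed
  qed
  have b3: "satisfies_MDP M (\<lambda>n \<omega>. ?k n powr (- 1 / 2) * proj_norm p X E n \<omega>) ?s (rate_stretched p)"
    if p2: "p < 2" and large: "?k \<in> \<omega>(?s)"
  proof -
    have sk: "?s \<in> o(?k)" using large by (simp add: smallomega_iff_smallo)
    have Jpos: "0 < ratio_rate u" if "u \<noteq> 1" for u
    proof (cases "0 < u")
      case True
      then have "u\<^sup>2 \<noteq> 1" using that by (simp add: power2_eq_1_iff)
      then show ?thesis using True chi_rate_pos[of "u\<^sup>2"] by (simp add: ratio_rate_def)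
    qed (simp add: ratio_rate_def)
    have BL: "exp_upper ?s (\<lambda>n. measure (gauss_law n) {g. ratio n (k n) g \<in> {..u}}) r" if "u < 1" for u r
      by (rule exp_upper_faster[OF k_lim ratio(1)[OF that] _ sk]) (use that in \<open>simp add: Jpos\<close>)
    have BU: "exp_upper ?s (\<lambda>n. measure (gauss_law n) {g. ratio n (k n) g \<in> {u..}}) r" if "1 < u" for u r
      by (rule exp_upper_faster[OF k_lim ratio(2)[OF that] _ sk]) (use that in \<open>simp add: Jpos\<close>)
    have BA: "exp_lower ?s (\<lambda>n. measure (gauss_law n) {g. ratio n (k n) g \<in> ball u e}) (point_rate 1 u)" if "0 < u" "0 < e" for u e
      by (rule exp_lower_concentrated[OF s_lim prob_space_gauss_law ratio_event BL BU that(2)])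
    show ?thesis
      unfolding rate_stretched_eq[OF p, symmetric]
      by (rule MDP[OF multiplicative_rate_stretched[OF p] s_lim s_pos low[OF s_small[OF p2]] radius_upper_tail_heavy[OF p uprob p2] radius_at_heavy[OF p uprob p2] BL BU BA])
  qed
  show ?thesis using a b1 b2 b3 by blast
qed

end
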